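(* The following groups all belong to $\mathcal{B}_{\mathfrak{e}}$: (1) every semidirect product $\mathbb{Z}^n\rtimes_A\mathbb{Z}$ with $n\ge1$ and $A\in GL(n,\mathbb{Z})$ (the fundamental groups of $n$-dimensional torus bundles over the circle); (2) every group $UT_n(\mathbb{Z})$ of upper unitriangular $n\times n$ integer matrices; (3) every finitely generated nilpotent group of nilpotency class $2$.
   Context: $\mathfrak{e}(n)=\exp(n)$. $\mathfrak{F}$ is the set of nondecreasing functions from some interval $[Q,\infty)\cap\mathbb{N}$ to the nonnegative reals; $g\preceq f$ means there exist $N\ge0$ and positive integers $K,M$ with $g(n)\le Kf(Mn)$ for all $n\ge N$. For a group $G$ with finite generating set $A$, $S=A\cup A^{-1}$, $\pi:S^*\to G$ the evaluation map and $d_A$ the word metric: a Cayley automatic representation is a bijection $\psi:L\to G$ from a regular $L\subseteq S^*$ such that for each $a\in A$ the relation $\{(\psi^{-1}(g),\psi^{-1}(ga)) : g\in G\}$ is FA-recognizable (i.e., the language of convolutions — parallel readings of the two strings with the shorter padded by a new symbol — is regular). Its function is $h(n)=\max\{d_A(\pi(w),\psi(w)): w\in L,|w|\le n\}$, and $G\in\mathcal{B}_f$ means some Cayley automatic representation (for some finite generating set; this is independent of the choice) has $h\preceq f$. *)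

theory Defs
  imports "HOL-Algebra.Generated_Groups" Complex_Main
begin

definition regular :: "'a set \<Rightarrow> 'a list set \<Rightarrow> bool" where
  "regular Sg L \<longleftrightarrow> L \<subseteq> lists Sg \<and>
     (\<exists>(Q::nat set) q0 (delta :: nat \<Rightarrow> 'a \<Rightarrow> nat) F.
        finite Q \<and> q0 \<in> Q \<and> (\<forall>q\<in>Q. \<forall>a\<in>Sg. delta q a \<in> Q) \<and> F \<subseteq> Q \<and>
        L = {w \<in> lists Sg. foldl delta q0 w \<in> F})"

definition conv :: "'a list \<Rightarrow> 'a list \<Rightarrow> ('a option \<times> 'a option) list" where
  "conv u v = map (\<lambda>i. (if i < length u then Some (u ! i) else None,
                        if i < length v then Some (v ! i) else None))
                  [0..<max (length u) (length v)]"

definition conv_alph :: "'a set \<Rightarrow> ('a option \<times> 'a option) set" where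
  "conv_alph Sg = (insert None (Some ` Sg)) \<times> (insert None (Some ` Sg))"

definition FA_recognizable :: "'a set \<Rightarrow> ('a list \<times> 'a list) set \<Rightarrow> bool" where
  "FA_recognizable Sg R \<longleftrightarrow> R \<subseteq> lists Sg \<times> lists Sg \<and>
     regular (conv_alph Sg) ((\<lambda>(u, v). conv u v) ` R)"

text \<open>Symmetric alphabet S = A \<union> A^-1: the letter (a, True) stands for a, (a, False) for a^-1.\<close>
definition sym_alph :: "'g set \<Rightarrow> ('g \<times> bool) set" where
  "sym_alph A = A \<times> UNIV"

definition eval_word :: "('g, 'b) monoid_scheme \<Rightarrow> ('g \<times> bool) list \<Rightarrow> 'g" where
  "eval_word G w = foldr (\<lambda>(a, b) x. (if b then a else inv\<^bsub>G\<^esub> a) \<otimes>\<^bsub>G\<^esub> x) w \<one>\<^bsub>G\<^esub>"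

definition word_length :: "('g, 'b) monoid_scheme \<Rightarrow> 'g set \<Rightarrow> 'g \<Rightarrow> nat" where
  "word_length G A g = (LEAST n. \<exists>w \<in> lists (sym_alph A). length w = n \<and> eval_word G w = g)"

definition word_dist :: "('g, 'b) monoid_scheme \<Rightarrow> 'g set \<Rightarrow> 'g \<Rightarrow> 'g \<Rightarrow> nat" where
  "word_dist G A x y = word_length G A (inv\<^bsub>G\<^esub> x \<otimes>\<^bsub>G\<^esub> y)"

definition fin_gen_set :: "('g, 'b) monoid_scheme \<Rightarrow> 'g set \<Rightarrow> bool" where
  "fin_gen_set G A \<longleftrightarrow> finite A \<and> A \<subseteq> carrier G \<and> generate G A = carrier G"

definition cayley_automatic_rep ::
  "('g, 'b) monoid_scheme \<Rightarrow> 'g set \<Rightarrow> ('g \<times> bool) list set \<Rightarrow> (('g \<times> bool) list \<Rightarrow> 'g) \<Rightarrow> bool" where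
  "cayley_automatic_rep G A L psi \<longleftrightarrow>
     regular (sym_alph A) L \<and> bij_betw psi L (carrier G) \<and>
     (\<forall>a\<in>A. FA_recognizable (sym_alph A)
                {(u, v). u \<in> L \<and> v \<in> L \<and> psi v = psi u \<otimes>\<^bsub>G\<^esub> a})"

definition rep_fun ::
  "('g, 'b) monoid_scheme \<Rightarrow> 'g set \<Rightarrow> ('g \<times> bool) list set \<Rightarrow> (('g \<times> bool) list \<Rightarrow> 'g) \<Rightarrow> nat \<Rightarrow> real" where
  "rep_fun G A L psi n =
     real (Max (insert 0 {word_dist G A (eval_word G w) (psi w) | w. w \<in> L \<and> length w \<le> n}))"

definition preceq :: "(nat \<Rightarrow> real) \<Rightarrow> (nat \<Rightarrow> real) \<Rightarrow> bool" where
  "preceq g f \<longleftrightarrow> (\<exists>N (K::nat) (M::nat). K > 0 \<and> M > 0 \<and> (\<forall>n\<ge>N. g n \<le> real K * f (M * n)))"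

definition in_B :: "('g, 'b) monoid_scheme \<Rightarrow> (nat \<Rightarrow> real) \<Rightarrow> bool" where
  "in_B G f \<longleftrightarrow> (\<exists>A L psi. fin_gen_set G A \<and> cayley_automatic_rep G A L psi \<and> preceq (rep_fun G A L psi) f)"

definition exp_fun :: "nat \<Rightarrow> real" where
  "exp_fun n = exp (real n)"

text \<open>Integer vectors in Z^n: functions nat => int vanishing outside {0..<n};
 integer n x n matrices: nat => nat => int.\<close>
definition mat_vec :: "nat \<Rightarrow> (nat \<Rightarrow> nat \<Rightarrow> int) \<Rightarrow> (nat \<Rightarrow> int) \<Rightarrow> nat \<Rightarrow> int" where
  "mat_vec n M v = (\<lambda>i. if i < n then (\<Sum>j<n. M i j * v j) else 0)"

definition mat_mult :: "nat \<Rightarrow> (nat \<Rightarrow> nat \<Rightarrow> int) \<Rightarrow> (nat \<Rightarrow> nat \<Rightarrow> int) \<Rightarrow> nat \<Rightarrow> nat \<Rightarrow> int" where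
  "mat_mult n M N = (\<lambda>i j. \<Sum>k<n. M i k * N k j)"

definition id_mat :: "nat \<Rightarrow> nat \<Rightarrow> nat \<Rightarrow> int" where
  "id_mat n = (\<lambda>i j. if i = j \<and> i < n then 1 else 0)"

definition is_nmat :: "nat \<Rightarrow> (nat \<Rightarrow> nat \<Rightarrow> int) \<Rightarrow> bool" where
  "is_nmat n M \<longleftrightarrow> (\<forall>i j. (n \<le> i \<or> n \<le> j) \<longrightarrow> M i j = 0)"

definition GL_int :: "nat \<Rightarrow> (nat \<Rightarrow> nat \<Rightarrow> int) \<Rightarrow> bool" where
  "GL_int n M \<longleftrightarrow> is_nmat n M \<and>
     (\<exists>N. is_nmat n N \<and> mat_mult n M N = id_mat n \<and> mat_mult n N M = id_mat n)"

definition inv_mat :: "nat \<Rightarrow> (nat \<Rightarrow> nat \<Rightarrow> int) \<Rightarrow> nat \<Rightarrow> nat \<Rightarrow> int" where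
  "inv_mat n M = (SOME N. is_nmat n N \<and> mat_mult n M N = id_mat n \<and> mat_mult n N M = id_mat n)"

definition mat_pow_act :: "nat \<Rightarrow> (nat \<Rightarrow> nat \<Rightarrow> int) \<Rightarrow> int \<Rightarrow> (nat \<Rightarrow> int) \<Rightarrow> nat \<Rightarrow> int" where
  "mat_pow_act n M k v = (if 0 \<le> k then (mat_vec n M ^^ nat k) v
                          else (mat_vec n (inv_mat n M) ^^ nat (- k)) v)"

text \<open>Z^n \<rtimes>_A Z: (v,k)(w,l) = (v + A^k w, k + l), i.e. the generator t of Z acts by
 t v t^-1 = A v.\<close>
definition semidirect_ZnZ :: "nat \<Rightarrow> (nat \<Rightarrow> nat \<Rightarrow> int) \<Rightarrow> ((nat \<Rightarrow> int) \<times> int) monoid" where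
  "semidirect_ZnZ n M =
     \<lparr>carrier = {(v, k). \<forall>i\<ge>n. v i = 0},
      mult = (\<lambda>(v, k) (w, l). (\<lambda>i. v i + mat_pow_act n M k w i, k + l)),
      one = (\<lambda>_. 0, 0)\<rparr>"

definition UT_int :: "nat \<Rightarrow> (nat \<Rightarrow> nat \<Rightarrow> int) monoid" where
  "UT_int n =
     \<lparr>carrier = {M. is_nmat n M \<and> (\<forall>i<n. M i i = 1) \<and> (\<forall>i j. j < i \<longrightarrow> M i j = 0)},
      mult = mat_mult n,
      one = id_mat n\<rparr>"

text \<open>Lower central series: gamma_1 = G, gamma_{i+1} = [gamma_i, G]; lcs G i = gamma_{i+1}.\<close>
fun lcs :: "('g, 'b) monoid_scheme \<Rightarrow> nat \<Rightarrow> 'g set" where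
  "lcs G 0 = carrier G"
| "lcs G (Suc i) = generate G
     {x \<otimes>\<^bsub>G\<^esub> y \<otimes>\<^bsub>G\<^esub> inv\<^bsub>G\<^esub> x \<otimes>\<^bsub>G\<^esub> inv\<^bsub>G\<^esub> y | x y. x \<in> lcs G i \<and> y \<in> carrier G}"

definition nilpotent_class :: "('g, 'b) monoid_scheme \<Rightarrow> nat \<Rightarrow> bool" where
  "nilpotent_class G c \<longleftrightarrow> lcs G c = {\<one>\<^bsub>G\<^esub>} \<and> (\<forall>d<c. lcs G d \<noteq> {\<one>\<^bsub>G\<^esub>})"

end

theory Submission
  imports Defs
begin

text \<open>
  Write a group element in integer coordinates \<open>z \<in> \<int>\<^sup>I\<close> and encode \<open>z\<close> by its columns of binary digits
  in two's complement.  A word of length \<open>n\<close> then encodes coordinates of size at most \<open>2\<^sup>n\<close>; as soon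
  as word length is bounded linearly in the coordinates, both \<open>\<pi>(w)\<close> and \<open>\<psi>(w)\<close> have word length
  \<open>O(2\<^sup>n)\<close>, and so has their distance.  It remains to see that right multiplication by a fixed element
  is recognizable, for which it suffices that it is definable in Presburger arithmetic:

  \<^item> in \<open>\<int>\<^sup>n \<rtimes> \<int>\<close>, coordinates \<open>t\<^sup>k v\<close> give \<open>t\<^sup>k v \<cdot> t\<^sup>l w = t\<^bsup>k+l\<^esup> (A\<^bsup>-l\<^esup>(v + w))\<close>, which is affine;
  \<^item> in \<open>UT\<^sub>n(\<int>)\<close>, the matrix entries are transformed linearly;
  \<^item> in class two, ordered monomials satisfy \<open>a\<^sup>xc\<^sup>y \<cdot> a\<^sup>uc\<^sup>v = a\<^bsup>x+u\<^esup>c\<^bsup>y+v+\<beta>(x,u)\<^esup>\<close> with \<open>\<beta>\<close> bilinear.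
    Torsion is dealt with by choosing \<open>x\<close> and \<open>y\<close> in box-shaped transversals of the lattices of
    relations: renormalizing \<open>x + u\<close> involves only finitely many carries \<open>d\<close>, and \<open>\<beta>(x,d)\<close> is linear in \<open>x\<close>.
\<close>

section \<open>Regular languages\<close>

text \<open>Nothing is asked of \<open>\<pi>(w)\<close> except a bound on its word length, so
  letters of the group alphabet may serve as mere names for digit columns; the price is a distance
  of order \<open>2 ^ n\<close>, which stays below \<open>exp n\<close>. The obstacle is to find
  coordinates in which right multiplication by a constant is at worst affine, because automata
  cannot multiply two variables. In the semidirect product this dictates the order of the factors:
  for \<open>v t^k\<close> the product with \<open>w\<close> would contain \<open>A^k w\<close>,
  exponential in \<open>k\<close>. For unitriangular matrices a large nilpotency class does no harm,
  since one of the two factors is a constant matrix. In class two, torsion makes monomials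
  ambiguous: a relation between the generators modulo commutators lifts only to an equation between
  a monomial and a product of commutators, and the commutator exponents need not depend additively
  on the relation. They are therefore chosen separately for each of the finitely many carries.
  Definability is treated without formulas, through finite families of predicates closed under
  reading a digit column.\<close>

lemma regular_if_finite_derivatives:
  assumes fin: "finite \<L>" and L: "L \<in> \<L>" and sub: "L \<subseteq> lists Sg"
    and der: "\<And>K a. K \<in> \<L> \<Longrightarrow> a \<in> Sg \<Longrightarrow> {x. a # x \<in> K} \<in> \<L>"
  shows "regular Sg L"
proof -
  \<comment> \<open>\<open>regular\<close> demands states of type \<open>nat\<close>, so the
    derivatives, which are the true states, are numbered.\<close>
  obtain f :: "'a list set \<Rightarrow> nat" where f: "inj_on f \<L>"
    using finite_imp_inj_to_nat_seg[OF fin] by blast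
  define g where "g = inv_into \<L> f"
  define delta where "delta = (\<lambda>q a. f {x. a # x \<in> g q})"
  have gf: "g (f K) = K" if "K \<in> \<L>" for K using f that by (simp add: g_def)
  have run: "foldl delta (f K) w \<in> f ` {K \<in> \<L>. [] \<in> K} \<longleftrightarrow> w \<in> K"
    if "w \<in> lists Sg" "K \<in> \<L>" for w K
    using that
  proof (induction w arbitrary: K)
    case Nil
    then show ?case using f by (auto dest: inj_onD)
  next
    case (Cons a w)
    then have K: "{x. a # x \<in> K} \<in> \<L>" and a: "w \<in> lists Sg" using der[of K a] by auto
    have "delta (f K) a = f {x. a # x \<in> K}" using Cons.prems by (simp add: delta_def gf)
    then show ?case using Cons.IH[OF K] by simp
  qed
  show ?thesis
    unfolding regular_def
  proof (intro conjI exI)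
    show "finite (f ` \<L>)" "f L \<in> f ` \<L>" using fin L by auto
    show "\<forall>q\<in>f ` \<L>. \<forall>a\<in>Sg. delta q a \<in> f ` \<L>"
    proof (intro ballI)
      fix q a assume "q \<in> f ` \<L>" "a \<in> Sg"
      then obtain K where K: "K \<in> \<L>" "q = f K" by blast
      then have "delta q a = f {x. a # x \<in> K}" by (simp add: delta_def gf)
      then show "delta q a \<in> f ` \<L>" using der[OF K(1) \<open>a \<in> Sg\<close>] by simp
    qed
    show "f ` {K \<in> \<L>. [] \<in> K} \<subseteq> f ` \<L>" by auto
    have "(w \<in> lists Sg \<and> foldl delta (f L) w \<in> f ` {K \<in> \<L>. [] \<in> K}) = (w \<in> L)" for w
      using run[OF _ L, of w] subsetD[OF sub, of w] by argo
    then show "L = {w \<in> lists Sg. foldl delta (f L) w \<in> f ` {K \<in> \<L>. [] \<in> K}}"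
      by simp
  qed (rule sub)
qed

text \<open>Every iterated derivative of a finite language is a set of suffixes of its words, and
  there are only finitely many such sets.\<close>

lemma regular_finite:
  assumes "finite L" "L \<subseteq> lists Sg"
  shows "regular Sg L"
proof (rule regular_if_finite_derivatives)
  define suf where "suf = {x. \<exists>u. u @ x \<in> L}"
  have "suf \<subseteq> (\<Union>w\<in>L. (\<lambda>n. drop n w) ` {..length w})"
  proof
    fix x assume "x \<in> suf"
    then obtain u where u: "u @ x \<in> L" unfolding suf_def by blast
    have "x = drop (length u) (u @ x)" "length u \<in> {..length (u @ x)}" by simp_all
    with u show "x \<in> (\<Union>w\<in>L. (\<lambda>n. drop n w) ` {..length w})" by blast
  qed
  moreover have "finite (\<Union>w\<in>L. (\<lambda>n. drop n w) ` {..length w})" using assms(1) by simp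
  ultimately show "finite (Pow suf)" using finite_subset by blast
  show "L \<in> Pow suf" unfolding suf_def by (simp add: subset_iff) (metis append_Nil)
  show "{x. a # x \<in> K} \<in> Pow suf" if "K \<in> Pow suf" for K a
  proof -
    have "x \<in> suf" if ax: "a # x \<in> suf" for x
    proof -
      from ax obtain u where "u @ a # x \<in> L" unfolding suf_def by blast
      then have "(u @ [a]) @ x \<in> L" by simp
      then show ?thesis unfolding suf_def by blast
    qed
    then show ?thesis using that by auto
  qed
qed (use assms in simp)

text \<open>The language accepted from each state is carried over. Injectivity lets the renamed
  letter determine the transition; the added empty language is the sink for letters outside the
  image of \<open>f\<close>.\<close>

lemma regular_map_inj:
  assumes reg: "regular Sg L" and f: "inj_on f Sg" "f ` Sg \<subseteq> Sg'"
  shows "regular Sg' (map f ` L)"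
proof -
  obtain Q :: "nat set" and q0 delta F where D: "finite Q" "q0 \<in> Q" "\<forall>q\<in>Q. \<forall>a\<in>Sg. delta q a \<in> Q"
      "L = {w \<in> lists Sg. foldl delta q0 w \<in> F}"
    using reg unfolding regular_def by blast
  define lang where "lang = (\<lambda>q. map f ` {w \<in> lists Sg. foldl delta q w \<in> F})"
  show ?thesis
  proof (rule regular_if_finite_derivatives)
    show "finite (insert {} (lang ` Q))" using D by auto
    show "map f ` L \<in> insert {} (lang ` Q)" using D by (auto simp: lang_def)
    show "map f ` L \<subseteq> lists Sg'" using D(4) f(2) by (fastforce simp: in_lists_conv_set)
    fix K a assume K: "K \<in> insert {} (lang ` Q)"
    show "{x. a # x \<in> K} \<in> insert {} (lang ` Q)"
    proof (cases "\<exists>q b. q \<in> Q \<and> K = lang q \<and> b \<in> Sg \<and> a = f b")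
      case True
      then obtain q b where q: "q \<in> Q" "K = lang q" "b \<in> Sg" "a = f b" by blast
      have "{x. a # x \<in> K} = lang (delta q b)"
      proof (intro equalityI subsetI)
        fix x assume "x \<in> {x. a # x \<in> K}"
        then have "f b # x \<in> map f ` {w \<in> lists Sg. foldl delta q w \<in> F}" unfolding q lang_def by simp
        then obtain w where w: "f b # x = map f w" "w \<in> lists Sg" "foldl delta q w \<in> F"
          by (elim imageE CollectE conjE)
        then obtain b' w' where "w = b' # w'" by (cases w) auto
        with w q f(1) show "x \<in> lang (delta q b)" by (auto simp: lang_def dest: inj_onD)
      next
        fix x assume "x \<in> lang (delta q b)"
        then obtain w where "x = map f w" "w \<in> lists Sg" "foldl delta (delta q b) w \<in> F"
          by (auto simp: lang_def)
        then have "a # x = map f (b # w)" "b # w \<in> lists Sg" "foldl delta q (b # w) \<in> F"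
          using q by auto
        then show "x \<in> {x. a # x \<in> K}"
          unfolding q lang_def mem_Collect_eq by (intro image_eqI[of _ _ "b # w"]) auto
      qed
      then show ?thesis using D q by auto
    next
      case False
      have "{x. a # x \<in> K} = {}"
      proof (rule equals0I)
        fix x assume "x \<in> {x. a # x \<in> K}"
        then obtain q where q: "q \<in> Q" "K = lang q" using K by auto
        with \<open>x \<in> {x. a # x \<in> K}\<close> have "a # x \<in> map f ` {w \<in> lists Sg. foldl delta q w \<in> F}"
          by (simp add: lang_def)
        then obtain w where w: "a # x = map f w" "w \<in> lists Sg" by (elim imageE CollectE conjE)
        from w obtain b w' where "w = b # w'" by (cases w) auto
        with q w False show False by auto
      qed
      then show ?thesis by simp
    qed
  qed
qed

section \<open>Convolutions, one column at a time\<close>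

definition hd_opt :: "'a list \<Rightarrow> 'a option" where
  "hd_opt u = (case u of [] \<Rightarrow> None | a # _ \<Rightarrow> Some a)"

definition cons_opt :: "'a option \<Rightarrow> 'a list \<Rightarrow> 'a list" where
  "cons_opt a u = (case a of None \<Rightarrow> u | Some l \<Rightarrow> l # u)"

lemma conv_Nil: "conv u v = [] \<longleftrightarrow> u = [] \<and> v = []"
  by (auto simp: conv_def)

text \<open>\<open>tl [] = []\<close> and \<open>hd_opt [] = None\<close> produce the padding, so
  the recursion continues unchanged after the shorter word has ended.\<close>

lemma conv_Cons:
  assumes "u \<noteq> [] \<or> v \<noteq> []"
  shows "conv u v = (hd_opt u, hd_opt v) # conv (tl u) (tl v)"
proof -
  define m where "m = max (length (tl u)) (length (tl v))"
  have m: "max (length u) (length v) = Suc m"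
    using assms by (cases u; cases v) (auto simp: m_def)
  show ?thesis
    unfolding conv_def m m_def[symmetric] hd_opt_def
    by (cases u; cases v) (simp_all add: upt_conv_Cons map_Suc_upt[symmetric] del: upt_Suc)
qed

lemma conv_map: "conv (map f u) (map f v) = map (map_prod (map_option f) (map_option f)) (conv u v)"
  by (auto simp: conv_def)

text \<open>\<open>map_option\<close> fixes the padding symbol, so renaming letters commutes with
  convolution. This is how digit columns are replaced by letters of the group alphabet.\<close>

lemma FA_recognizable_map_inj:
  assumes R: "FA_recognizable Sg R" and f: "inj_on f Sg" "f ` Sg \<subseteq> Sg'"
  shows "FA_recognizable Sg' ((\<lambda>(u, v). (map f u, map f v)) ` R)"
proof -
  let ?g = "map_prod (map_option f) (map_option f)"
  have o: "inj_on (map_option f) (insert None (Some ` Sg))"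
    using f(1) by (auto simp: inj_on_def)
  have inj: "inj_on ?g (conv_alph Sg)"
    unfolding conv_alph_def by (rule map_prod_inj_on[OF o o])
  have sub: "?g ` conv_alph Sg \<subseteq> conv_alph Sg'"
    using f(2) by (auto simp: conv_alph_def)
  have "(\<lambda>(u, v). conv u v) ` (\<lambda>(u, v). (map f u, map f v)) ` R = map ?g ` (\<lambda>(u, v). conv u v) ` R"
    unfolding image_image by (rule image_cong) (auto simp: conv_map)
  moreover have "(\<lambda>(u, v). (map f u, map f v)) ` R \<subseteq> lists Sg' \<times> lists Sg'"
    using R f(2) unfolding FA_recognizable_def by (fastforce simp: in_lists_conv_set)
  ultimately show ?thesis
    using regular_map_inj[OF _ inj sub] R by (simp add: FA_recognizable_def)
qed

section \<open>Automatic sets of integer valuations\<close>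

definition bits :: "('i \<Rightarrow> int) set" where
  "bits = {b. \<forall>i. b i \<in> {0, 1}}"

definition sec :: "('i \<Rightarrow> int) \<Rightarrow> (('i \<Rightarrow> int) \<Rightarrow> bool) \<Rightarrow> ('i \<Rightarrow> int) \<Rightarrow> bool" where
  "sec b P = (\<lambda>z. P (\<lambda>i. 2 * z i + b i))"

text \<open>Reading binary expansions from the least significant digit turns derivatives of a language
  into the sections \<open>P \<mapsto> (z \<mapsto> P (2 z + b))\<close>; two's complement sign extension makes the
  expansions infinite, so that no padding has to be considered in existential quantification.\<close>

definition aut :: "(('i \<Rightarrow> int) \<Rightarrow> bool) \<Rightarrow> bool" where
  "aut P \<longleftrightarrow> (\<exists>\<F>. finite \<F> \<and> P \<in> \<F> \<and> (\<forall>Q\<in>\<F>. \<forall>b\<in>bits. sec b Q \<in> \<F>))"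

lemma autI:
  assumes "finite \<F>" "P \<in> \<F>" "\<And>Q b. Q \<in> \<F> \<Longrightarrow> b \<in> bits \<Longrightarrow> sec b Q \<in> \<F>"
  shows "aut P"
  using assms unfolding aut_def by blast

lemma autE:
  assumes "aut P"
  obtains \<F> where "finite \<F>" "P \<in> \<F>" "\<And>Q b. Q \<in> \<F> \<Longrightarrow> b \<in> bits \<Longrightarrow> sec b Q \<in> \<F>"
  using assms unfolding aut_def by blast

lemma aut_not: assumes "aut P" shows "aut (\<lambda>z. \<not> P z)"
proof -
  from assms obtain \<F> where F: "finite \<F>" "P \<in> \<F>" "\<And>Q b. Q \<in> \<F> \<Longrightarrow> b \<in> bits \<Longrightarrow> sec b Q \<in> \<F>"
    by (erule autE)
  show ?thesis
  proof (rule autI)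
    show "finite ((\<lambda>Q z. \<not> Q z) ` \<F>)" "(\<lambda>z. \<not> P z) \<in> (\<lambda>Q z. \<not> Q z) ` \<F>"
      using F(1,2) by auto
    fix Q b assume "Q \<in> (\<lambda>Q z. \<not> Q z) ` \<F>" and b: "b \<in> (bits :: ('a \<Rightarrow> int) set)"
    then obtain Q' where "Q' \<in> \<F>" "Q = (\<lambda>z. \<not> Q' z)" by blast
    with F(3)[OF _ b, of Q'] show "sec b Q \<in> (\<lambda>Q z. \<not> Q z) ` \<F>"
      by (intro image_eqI[of _ _ "sec b Q'"]) (simp_all add: sec_def)
  qed
qed

lemma aut_conj: assumes "aut P" "aut P'" shows "aut (\<lambda>z. P z \<and> P' z)"
proof -
  from assms(1) obtain \<F> where F: "finite \<F>" "P \<in> \<F>" "\<And>Q b. Q \<in> \<F> \<Longrightarrow> b \<in> bits \<Longrightarrow> sec b Q \<in> \<F>"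
    by (erule autE)
  from assms(2) obtain \<F>' where F': "finite \<F>'" "P' \<in> \<F>'" "\<And>Q b. Q \<in> \<F>' \<Longrightarrow> b \<in> bits \<Longrightarrow> sec b Q \<in> \<F>'"
    by (erule autE)
  let ?F = "(\<lambda>(Q, Q') z. Q z \<and> Q' z) ` (\<F> \<times> \<F>')"
  show ?thesis
  proof (rule autI)
    show "finite ?F" using F(1) F'(1) by simp
    show "(\<lambda>z. P z \<and> P' z) \<in> ?F" using F(2) F'(2) by (intro image_eqI[of _ _ "(P, P')"]) simp_all
    fix Q b assume "Q \<in> ?F" and b: "b \<in> (bits :: ('a \<Rightarrow> int) set)"
    then obtain R R' where R: "R \<in> \<F>" "R' \<in> \<F>'" "Q = (\<lambda>z. R z \<and> R' z)" by auto
    show "sec b Q \<in> ?F"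
      using F(3)[OF R(1) b] F'(3)[OF R(2) b] R(3)
      by (intro image_eqI[of _ _ "(sec b R, sec b R')"]) (simp_all add: sec_def)
  qed
qed

lemma aut_const: "aut (\<lambda>_. c)"
  by (rule autI[of "{\<lambda>_. c}"]) (simp_all add: sec_def)

lemma aut_ball:
  assumes "finite I" "\<And>i. i \<in> I \<Longrightarrow> aut (P i)"
  shows "aut (\<lambda>z. \<forall>i\<in>I. P i z)"
  using assms
proof (induction I rule: finite_induct)
  case empty
  then show ?case by (simp add: aut_const)
next
  case (insert i I)
  then have "aut (\<lambda>z. P i z \<and> (\<forall>i\<in>I. P i z))" by (intro aut_conj) blast+
  then show ?case by simp
qed

lemma aut_bex:
  assumes "finite I" "\<And>i. i \<in> I \<Longrightarrow> aut (P i)"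
  shows "aut (\<lambda>z. \<exists>i\<in>I. P i z)"
  using aut_not[OF aut_ball[OF assms(1), of "\<lambda>i z. \<not> P i z"]] assms(2) by (simp add: aut_not)

text \<open>Subset construction. The digit of the quantified variable has to be guessed, so a
  section of an existential statement is a disjunction over both guesses; the new family consists of
  the disjunctions of members of \<open>\<F>\<close> under one quantifier. The quantified variable
  sits at index \<open>None\<close>.\<close>

lemma aut_ex:
  fixes P :: "('a option \<Rightarrow> int) \<Rightarrow> bool"
  assumes "aut P"
  shows "aut (\<lambda>z. \<exists>y. P (case_option y z))"
proof -
  from assms obtain \<F> where F: "finite \<F>" "P \<in> \<F>" "\<And>Q b. Q \<in> \<F> \<Longrightarrow> b \<in> bits \<Longrightarrow> sec b Q \<in> \<F>"
    by (erule autE)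
  define ex where "ex = (\<lambda>\<Q> (z :: 'a \<Rightarrow> int). \<exists>y. \<exists>Q\<in>\<Q>. Q (case_option y z) :: bool)"
  have closed: "sec b (ex \<Q>) \<in> ex ` Pow \<F>" if Q: "\<Q> \<subseteq> \<F>" and b: "b \<in> bits" for b \<Q>
  proof (rule image_eqI)
    let ?Q = "\<Union>Q\<in>\<Q>. (\<lambda>c. sec (case_option c b) Q) ` {0, 1}"
    have "case_option c b \<in> bits" if "c \<in> {0, 1}" for c using b that by (auto simp: bits_def split: option.split)
    then have "sec (case_option c b) Q \<in> \<F>" if "c \<in> {0, 1}" "Q \<in> \<Q>" for c Q
      using F(3)[of Q "case_option c b"] Q that by blast
    then show "?Q \<in> Pow \<F>" by (intro PowI UN_least image_subsetI)
    have upd: "(\<lambda>j. 2 * (case_option y z) j + (case_option c b) j) = case_option (2 * y + c) (\<lambda>j. 2 * z j + b j)" for z y c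
      by (simp add: fun_eq_iff split: option.split)
    have split: "(\<exists>y. \<exists>Q\<in>\<Q>. S Q y) \<longleftrightarrow> (\<exists>y. \<exists>Q\<in>\<Q>. S Q (2 * y + 0) \<or> S Q (2 * y + 1))"
      for S :: "(('a option \<Rightarrow> int) \<Rightarrow> bool) \<Rightarrow> int \<Rightarrow> bool"
    proof
      assume "\<exists>y. \<exists>Q\<in>\<Q>. S Q y"
      then obtain y Q where Q: "Q \<in> \<Q>" "S Q y" by blast
      have "y = 2 * (y div 2) + 0 \<or> y = 2 * (y div 2) + 1" by linarith
      then have "S Q (2 * (y div 2) + 0) \<or> S Q (2 * (y div 2) + 1)" using Q(2) by metis
      then show "\<exists>y. \<exists>Q\<in>\<Q>. S Q (2 * y + 0) \<or> S Q (2 * y + 1)" using Q(1) by blast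
    qed blast
    show "sec b (ex \<Q>) = ex ?Q"
    proof
      fix z
      have eq: "sec (case_option c b) Q (case_option y z) = Q (case_option (2 * y + c) (\<lambda>j. 2 * z j + b j))" for Q c y
        by (simp only: sec_def upd)
      have "sec b (ex \<Q>) z \<longleftrightarrow> (\<exists>y. \<exists>Q\<in>\<Q>. Q (case_option y (\<lambda>j. 2 * z j + b j)))"
        unfolding sec_def ex_def ..
      also have "\<dots> \<longleftrightarrow> (\<exists>y. \<exists>Q\<in>\<Q>. sec (case_option 0 b) Q (case_option y z) \<or> sec (case_option 1 b) Q (case_option y z))"
        unfolding eq by (rule split)
      also have "\<dots> \<longleftrightarrow> ex ?Q z" by (simp add: ex_def)
      finally show "sec b (ex \<Q>) z = ex ?Q z" .
    qed
  qed
  show ?thesis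
  proof (rule autI)
    show "finite (ex ` Pow \<F>)" using F(1) by simp
    show "(\<lambda>z. \<exists>y. P (case_option y z)) \<in> ex ` Pow \<F>"
      by (rule image_eqI[of _ _ "{P}"]) (use F(2) in \<open>simp_all add: ex_def\<close>)
  qed (use closed in blast)
qed

text \<open>The equation is additivity in the form that sections use. The bound on digit columns,
  which is not automatic when the index type is infinite, keeps the carries of an affine
  substitution in a finite range.\<close>

definition lin :: "(('i \<Rightarrow> int) \<Rightarrow> int) \<Rightarrow> bool" where
  "lin f \<longleftrightarrow> (\<forall>z b. f (\<lambda>i. 2 * z i + b i) = 2 * f z + f b) \<and> (\<exists>B. \<forall>b\<in>bits. \<bar>f b\<bar> \<le> B)"

lemma lin_var: "lin (\<lambda>z. z i)"
proof -
  have "\<bar>b i\<bar> \<le> 1" if "b \<in> bits" for b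
  proof -
    from that have "b i = 0 \<or> b i = 1" unfolding bits_def by blast
    then show ?thesis by auto
  qed
  then show ?thesis unfolding lin_def by blast
qed

lemma lin_zero: "lin (\<lambda>z. 0)"
  unfolding lin_def by (simp add: exI[of _ 0])

lemma linD: "lin f \<Longrightarrow> f (\<lambda>i. 2 * z i + b i) = 2 * f z + f b"
  unfolding lin_def by blast

lemma linI:
  assumes "\<And>z b. f (\<lambda>i. 2 * z i + b i) = 2 * f z + f b" "\<And>b. b \<in> bits \<Longrightarrow> \<bar>f b\<bar> \<le> B"
  shows "lin f"
  unfolding lin_def using assms by blast

lemma lin_add: assumes "lin f" "lin g" shows "lin (\<lambda>z. f z + g z)"
proof -
  obtain B B' where B: "\<forall>b\<in>bits. \<bar>f b\<bar> \<le> B" "\<forall>b\<in>bits. \<bar>g b\<bar> \<le> B'"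
    using assms unfolding lin_def by blast
  show ?thesis
  proof (rule linI)
    show "\<bar>f b + g b\<bar> \<le> B + B'" if "b \<in> bits" for b
      using bspec[OF B(1) that] bspec[OF B(2) that] by linarith
  qed (simp add: linD[OF assms(1)] linD[OF assms(2)])
qed

lemma lin_cmult: assumes "lin f" shows "lin (\<lambda>z. c * f z)"
proof -
  obtain B where B: "\<forall>b\<in>bits. \<bar>f b\<bar> \<le> B" using assms unfolding lin_def by blast
  show ?thesis
  proof (rule linI)
    show "\<bar>c * f b\<bar> \<le> \<bar>c\<bar> * B" if "b \<in> bits" for b
      using bspec[OF B that] by (simp add: abs_mult mult_left_mono)
    show "c * f (\<lambda>i. 2 * z i + b i) = 2 * (c * f z) + c * f b" for z b
      unfolding linD[OF assms] by (simp add: algebra_simps)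
  qed
qed

lemma lin_diff: "lin f \<Longrightarrow> lin g \<Longrightarrow> lin (\<lambda>z. f z - g z)"
  using lin_add[of f "\<lambda>z. -1 * g z"] lin_cmult[of g "-1"] by simp

lemma lin_sum: "(\<And>i. i \<in> I \<Longrightarrow> lin (f i)) \<Longrightarrow> lin (\<lambda>z. \<Sum>i\<in>I. f i z)"
  by (induction I rule: infinite_finite_induct) (simp_all add: lin_zero lin_add)

text \<open>Column addition with carries: the constants \<open>e\<close> become part of the state,
  and reading a column \<open>b\<close> emits the lowest digit of \<open>f j b + e j\<close> and
  keeps the rest as the next constant.\<close>

lemma aut_affine_subst:
  fixes P :: "('j \<Rightarrow> int) \<Rightarrow> bool"
  assumes P: "aut P" and J: "finite J" and lin: "\<And>j. j \<in> J \<Longrightarrow> lin (f j)"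
  shows "aut (\<lambda>z. P (\<lambda>j. if j \<in> J then f j z + e j else 0))"
proof -
  from P obtain \<F> where F: "finite \<F>" "P \<in> \<F>" "\<And>Q b. Q \<in> \<F> \<Longrightarrow> b \<in> bits \<Longrightarrow> sec b Q \<in> \<F>"
    by (erule autE)
  have "\<forall>j\<in>J. \<exists>B. \<forall>b\<in>bits. \<bar>f j b\<bar> \<le> B" using lin unfolding lin_def by blast
  then obtain B where B: "\<And>j b. j \<in> J \<Longrightarrow> b \<in> bits \<Longrightarrow> \<bar>f j b\<bar> \<le> B j" by metis
  \<comment> \<open>Half the sum of two integers from \<open>[- B' j, B' j]\<close> lies in that
    interval again, so the carries never leave it; the maximum makes it contain the initial
    constant.\<close>
  define B' where "B' = (\<lambda>j. max (B j) \<bar>e j\<bar>)"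
  define E where "E = (\<Pi>\<^sub>E j\<in>J. {- B' j..B' j})"
  define sub where "sub = (\<lambda>(Q, e') z. Q (\<lambda>j. if j \<in> J then f j z + e' j else (0::int)) :: bool)"
  have closed: "sec b (sub (Q, e')) \<in> sub ` (\<F> \<times> E)" if Q: "Q \<in> \<F>" and e: "e' \<in> E" and b: "b \<in> bits" for Q e' b
  proof -
    define e'' where "e'' = restrict (\<lambda>j. (f j b + e' j) div 2) J"
    define c where "c = (\<lambda>j. if j \<in> J then (f j b + e' j) mod 2 else 0)"
    have "- B' j \<le> (f j b + e' j) div 2 \<and> (f j b + e' j) div 2 \<le> B' j" if "j \<in> J" for j
    proof -
      have "\<bar>f j b\<bar> \<le> B' j" using B[OF that b] unfolding B'_def by linarith
      moreover have "- B' j \<le> e' j \<and> e' j \<le> B' j" using e that by (auto simp: E_def dest: PiE_mem)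
      ultimately show ?thesis by linarith
    qed
    then have "e'' \<in> E" by (auto simp: E_def e''_def)
    moreover have "c \<in> bits" by (auto simp: c_def bits_def)
    moreover have "sec b (sub (Q, e')) = sub (sec c Q, e'')"
    proof
      fix z
      have "(if j \<in> J then f j (\<lambda>i. 2 * z i + b i) + e' j else 0)
          = 2 * (if j \<in> J then f j z + e'' j else 0) + c j" for j
      proof (cases "j \<in> J")
        case True
        have "f j b + e' j = 2 * ((f j b + e' j) div 2) + (f j b + e' j) mod 2" by simp
        with True show ?thesis by (simp add: e''_def c_def linD[OF lin[OF True]])
      qed (simp add: c_def)
      then show "sec b (sub (Q, e')) z = sub (sec c Q, e'') z" by (simp add: sec_def sub_def)
    qed
    ultimately show ?thesis using F(3)[OF Q] by auto
  qed
  have e: "restrict e J \<in> E"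
  proof -
    have "- B' j \<le> e j \<and> e j \<le> B' j" for j unfolding B'_def by linarith
    then show ?thesis by (simp add: E_def)
  qed
  have eq: "(\<lambda>z. P (\<lambda>j. if j \<in> J then f j z + e j else 0)) = sub (P, restrict e J)"
    unfolding sub_def by (simp cong: if_cong)
  have "finite E" unfolding E_def using J by (intro finite_PiE) simp_all
  then show ?thesis
    unfolding eq using F(1,2) e closed by (intro autI[of "sub ` (\<F> \<times> E)"]) blast+
qed

text \<open>By substitution one variable suffices, and there a doubled value is zero iff the value
  is, while an odd value never is.\<close>

lemma aut_lin_eq: assumes "lin f" shows "aut (\<lambda>z. f z + e = 0)"
proof -
  have "aut (\<lambda>z. z () = 0)"
    unfolding aut_def
  proof (intro exI conjI)
    show "finite {\<lambda>z::unit \<Rightarrow> int. z () = 0, \<lambda>z. False}" by simp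
    show "\<forall>Q\<in>{\<lambda>z::unit \<Rightarrow> int. z () = 0, \<lambda>z. False}. \<forall>b\<in>bits. sec b Q \<in> {\<lambda>z. z () = 0, \<lambda>z. False}"
    proof (intro ballI)
      fix Q b assume Q: "Q \<in> {\<lambda>z::unit \<Rightarrow> int. z () = 0, \<lambda>z. False}" and "b \<in> (bits :: (unit \<Rightarrow> int) set)"
      then consider "b () = 0" | "b () = 1" by (auto simp: bits_def)
      then show "sec b Q \<in> {\<lambda>z. z () = 0, \<lambda>z. False}"
      proof cases
        case 2
        have "2 * y + 1 \<noteq> 0" for y :: int by presburger
        with Q 2 show ?thesis by (auto simp: sec_def)
      qed (use Q in \<open>auto simp: sec_def\<close>)
    qed
  qed simp
  from aut_affine_subst[OF this, of UNIV "\<lambda>_. f" "\<lambda>_. e"] assms show ?thesis by simp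
qed

text \<open>By substitution one variable suffices, and there the predicate is its own section:
  \<open>0 \<le> 2 * y + b\<close> iff \<open>0 \<le> y\<close> for a bit \<open>b\<close>. Two's
  complement leaves the sign to the infinite tail.\<close>

lemma aut_lin_nonneg: assumes "lin f" shows "aut (\<lambda>z. 0 \<le> f z + e)"
proof -
  have "aut (\<lambda>z. 0 \<le> z ())"
    unfolding aut_def
  proof (intro exI conjI)
    show "\<forall>Q\<in>{\<lambda>z::unit \<Rightarrow> int. 0 \<le> z ()}. \<forall>b\<in>bits. sec b Q \<in> {\<lambda>z. 0 \<le> z ()}"
    proof (intro ballI)
      fix Q b assume "Q \<in> {\<lambda>z::unit \<Rightarrow> int. 0 \<le> z ()}" and "b \<in> (bits :: (unit \<Rightarrow> int) set)"
      moreover from this have "b () = 0 \<or> b () = 1" by (auto simp: bits_def)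
      then have "(0 \<le> 2 * y + b ()) = (0 \<le> y)" for y :: int by auto
      ultimately show "sec b Q \<in> {\<lambda>z. 0 \<le> z ()}" by (simp add: sec_def)
    qed
  qed auto
  from aut_affine_subst[OF this, of UNIV "\<lambda>_. f" "\<lambda>_. e"] assms show ?thesis by simp
qed

section \<open>Encoding integer vectors\<close>

definition vecs :: "'i set \<Rightarrow> ('i \<Rightarrow> int) set" where
  "vecs I = {z. \<forall>i. i \<notin> I \<longrightarrow> z i = 0}"

definition vbits :: "'i set \<Rightarrow> ('i \<Rightarrow> int) set" where
  "vbits I = bits \<inter> vecs I"

lemma finite_vbits: assumes "finite I" shows "finite (vbits I)"
proof -
  have "vbits I \<subseteq> {f. \<forall>x. (x \<in> I \<longrightarrow> f x \<in> {0, 1}) \<and> (x \<notin> I \<longrightarrow> f x = 0)}"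
    unfolding vbits_def bits_def vecs_def by blast
  moreover have "finite {f. \<forall>x. (x \<in> I \<longrightarrow> f x \<in> {0, 1 :: int}) \<and> (x \<notin> I \<longrightarrow> f x = 0)}"
    by (rule finite_set_of_finite_funs) (use assms in simp_all)
  ultimately show ?thesis by (rule finite_subset)
qed

text \<open>Two's complement, least significant column first: \<open>(False, c)\<close> is a column of digits,
  \<open>(True, s)\<close> the final column of signs.  The condition \<open>z \<noteq> - c\<close> forbids sign extension by a
  digit column and thereby makes the encoding unique.\<close>

inductive encodes :: "'i set \<Rightarrow> (bool \<times> ('i \<Rightarrow> int)) list \<Rightarrow> ('i \<Rightarrow> int) \<Rightarrow> bool" for I where
  sign: "s \<in> vbits I \<Longrightarrow> encodes I [(True, s)] (\<lambda>i. - s i)"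
| digit: "encodes I u z \<Longrightarrow> c \<in> vbits I \<Longrightarrow> z \<noteq> (\<lambda>i. - c i)
    \<Longrightarrow> encodes I ((False, c) # u) (\<lambda>i. 2 * z i + c i)"

lemma bit_cases: "c \<in> vbits I \<Longrightarrow> c i = 0 \<or> c i = 1"
  by (auto simp: vbits_def bits_def)

lemma digits_unique:
  assumes "c \<in> vbits I" "c' \<in> vbits I" "(\<lambda>i. 2 * z i + c i) = (\<lambda>i. 2 * z' i + c' i)"
  shows "c = c' \<and> z = z'"
proof -
  have "c i = c' i \<and> z i = z' i" for i
    using bit_cases[OF assms(1), of i] bit_cases[OF assms(2), of i] fun_cong[OF assms(3), of i] by presburger
  then show ?thesis by blast
qed

lemma encodes_lists: "encodes I u z \<Longrightarrow> u \<in> lists (UNIV \<times> vbits I)"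
  by (induction rule: encodes.induct) auto

lemma encodes_fun: "encodes I u z \<Longrightarrow> encodes I u z' \<Longrightarrow> z = z'"
proof (induction arbitrary: z' rule: encodes.induct)
  case sign
  from sign.prems show ?case by (cases rule: encodes.cases) auto
next
  case digit
  from digit.prems show ?case by (cases rule: encodes.cases) (use digit.IH in auto)
qed

text \<open>A sign column repeats itself, \<open>- s = 2 * (- s) + s\<close>. By uniqueness of
  digits this is the only way to split a digit off \<open>- s\<close>, and it is the sign extension
  that \<open>digit\<close> forbids.\<close>

lemma digit_not_sign:
  assumes "c \<in> vbits I" "s \<in> vbits I" "(\<lambda>i. - s i) = (\<lambda>i. 2 * z i + c i)"
  shows "z = (\<lambda>i. - c i)"
proof -
  have "(\<lambda>i. 2 * (- s i) + s i) = (\<lambda>i. 2 * z i + c i)" using assms(3) by auto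
  from digits_unique[OF assms(2,1) this] show ?thesis by auto
qed

lemma encodes_inj: "encodes I u z \<Longrightarrow> encodes I u' z \<Longrightarrow> u = u'"
proof (induction arbitrary: u' rule: encodes.induct)
  case (sign s)
  from sign.prems show ?case
  proof (cases rule: encodes.cases)
    case (sign s')
    then show ?thesis by (auto simp: fun_eq_iff)
  next
    case (digit u z c)
    then show ?thesis using digit_not_sign[of c I s z] sign.hyps by auto
  qed
next
  case (digit u z c)
  from digit.prems show ?case
  proof (cases rule: encodes.cases)
    case (sign s')
    then show ?thesis using digit_not_sign[of c I s' z] digit.hyps by auto
  next
    case (digit v z' c')
    then show ?thesis using digits_unique[of c I c' z z'] \<open>c \<in> vbits I\<close> \<open>\<And>u'. encodes I u' z \<Longrightarrow> u = u'\<close> by auto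
  qed
qed

text \<open>Halving with rounding down never increases an absolute value and decreases it strictly
  unless the coordinate is 0 or -1; once all coordinates are of this kind, a sign column ends the
  word.\<close>

lemma encodes_exists: assumes "finite I" "z \<in> vecs I" shows "\<exists>u. encodes I u z"
  using assms(2)
proof (induction "\<Sum>i\<in>I. nat \<bar>z i\<bar>" arbitrary: z rule: less_induct)
  case less
  show ?case
  proof (cases "(\<lambda>i. - z i) \<in> vbits I")
    case True
    from encodes.sign[OF this] show ?thesis by auto
  next
    case False
    define c where "c = (\<lambda>i. z i mod 2)"
    define y where "y = (\<lambda>i. z i div 2)"
    have c: "c \<in> vbits I" using less.prems by (auto simp: c_def vbits_def bits_def vecs_def)
    have y: "y \<in> vecs I" using less.prems by (auto simp: y_def vecs_def)
    have le: "nat \<bar>y i\<bar> \<le> nat \<bar>z i\<bar>" for i unfolding y_def by linarith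
    have "\<exists>i\<in>I. z i \<notin> {0, -1}" using False less.prems by (auto simp: vbits_def bits_def vecs_def)
    then obtain i where i: "i \<in> I" "z i \<noteq> 0" "z i \<noteq> -1" by auto
    then have lt: "nat \<bar>y i\<bar> < nat \<bar>z i\<bar>" unfolding y_def by linarith
    have "(\<Sum>i\<in>I. nat \<bar>y i\<bar>) < (\<Sum>i\<in>I. nat \<bar>z i\<bar>)"
      using assms(1) le lt i(1) by (intro sum_strict_mono_ex1) auto
    with less.hyps y obtain u where u: "encodes I u y" by blast
    \<comment> \<open>Equality would mean that \<open>z = 2 * y + c = - c\<close>, so that every
      coordinate were 0 or -1.\<close>
    have "y \<noteq> (\<lambda>i. - c i)"
    proof
      assume "y = (\<lambda>i. - c i)"
      then have "z i div 2 = - (z i mod 2)" by (metis c_def y_def)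
      then show False using i by presburger
    qed
    from encodes.digit[OF u c this] show ?thesis by (auto simp: c_def y_def)
  qed
qed

lemma encodes_bound: "encodes I u z \<Longrightarrow> - (2 ^ length u) \<le> z i \<and> z i < 2 ^ length u"
proof (induction rule: encodes.induct)
  case (sign s)
  then show ?case using bit_cases[of s I i] by auto
next
  case (digit u z c)
  then show ?case using bit_cases[of c I i] by auto
qed

section \<open>Automata reading encodings\<close>

text \<open>The states of an automaton reading one encoding: nothing read, a digit column read last,
  or the encoding completed with the given sign column.\<close>

datatype 'i track = Start | After "'i \<Rightarrow> int" | Ended "'i \<Rightarrow> int"

definition tracks :: "'i set \<Rightarrow> 'i track set" where
  "tracks I = {Start} \<union> After ` vbits I \<union> Ended ` vbits I"

text \<open>The value \<open>- c\<close> is encoded by the sign column \<open>c\<close> alone, so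
  remembering the last digit column is enough to enforce the side condition of \<open>digit\<close>.
  An ended track reads only the empty word but keeps its value, because the other word of a
  convolution may still be running.\<close>

fun reads :: "'i set \<Rightarrow> 'i track \<Rightarrow> (bool \<times> ('i \<Rightarrow> int)) list \<Rightarrow> ('i \<Rightarrow> int) \<Rightarrow> bool" where
  "reads I Start u z = encodes I u z"
| "reads I (After c) u z = (encodes I u z \<and> z \<noteq> (\<lambda>i. - c i))"
| "reads I (Ended s) u z = (u = [] \<and> z = (\<lambda>i. - s i))"

text \<open>The second component is the digit column consumed; a completed encoding supplies its sign
  column forever.\<close>

fun next_track :: "'i set \<Rightarrow> 'i track \<Rightarrow> (bool \<times> ('i \<Rightarrow> int)) option \<Rightarrow> ('i track \<times> ('i \<Rightarrow> int)) option" where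
  "next_track I (Ended s) None = Some (Ended s, s)"
| "next_track I (Ended s) (Some _) = None"
| "next_track I _ None = None"
| "next_track I T (Some (False, c)) = (if c \<in> vbits I then Some (After c, c) else None)"
| "next_track I T (Some (True, s)) = (if s \<in> vbits I \<and> T \<noteq> After s then Some (Ended s, s) else None)"

text \<open>An ended track is included: there the empty word yields a blank and itself as tail, and
  the value splits as \<open>- s = 2 * (- s) + s\<close>.\<close>

lemma reads_split:
  assumes "reads I T u z"
  shows "\<exists>T' c z'. next_track I T (hd_opt u) = Some (T', c) \<and> z = (\<lambda>i. 2 * z' i + c i) \<and> reads I T' (tl u) z'"
proof (cases T)
  case (Ended s)
  with assms show ?thesis
    by (intro exI[of _ "Ended s"] exI[of _ s] exI[of _ "\<lambda>i. - s i"]) (simp add: hd_opt_def)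
next
  case Start
  with assms have "encodes I u z" by simp
  then show ?thesis
  proof (cases rule: encodes.cases)
    case (sign s)
    with Start show ?thesis
      by (intro exI[of _ "Ended s"] exI[of _ s] exI[of _ "\<lambda>i. - s i"]) (simp add: hd_opt_def)
  next
    case (digit v y c)
    with Start show ?thesis
      by (intro exI[of _ "After c"] exI[of _ c] exI[of _ y]) (simp add: hd_opt_def)
  qed
next
  case (After d)
  with assms have "encodes I u z" and d: "z \<noteq> (\<lambda>i. - d i)" by simp_all
  from this(1) show ?thesis
  proof (cases rule: encodes.cases)
    case (sign s)
    then have "s \<noteq> d" using d by blast
    with sign After show ?thesis
      by (intro exI[of _ "Ended s"] exI[of _ s] exI[of _ "\<lambda>i. - s i"]) (simp add: hd_opt_def)
  next
    case (digit v y c)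
    with After show ?thesis
      by (intro exI[of _ "After c"] exI[of _ c] exI[of _ y]) (simp add: hd_opt_def)
  qed
qed

text \<open>Converse of \<open>reads_split\<close>. That \<open>hd_opt\<close> and \<open>tl\<close>
  undo \<open>cons_opt\<close> also for a blank depends on blanks being accepted only by an ended
  track, which reads nothing but the empty word.\<close>

lemma reads_step:
  assumes T: "T \<in> tracks I" and n: "next_track I T a = Some (T', c)" and r: "reads I T' x z"
  shows "reads I T (cons_opt a x) (\<lambda>i. 2 * z i + c i)" "hd_opt (cons_opt a x) = a" "tl (cons_opt a x) = x"
    "T' \<in> tracks I" "c \<in> vbits I"
proof -
  have "reads I T (cons_opt a x) (\<lambda>i. 2 * z i + c i) \<and> hd_opt (cons_opt a x) = a
    \<and> tl (cons_opt a x) = x \<and> T' \<in> tracks I \<and> c \<in> vbits I"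
  proof (cases "\<exists>s. T = Ended s")
    case True
    then obtain s where s: "T = Ended s" by blast
    then have "a = None" "T' = Ended s" "c = s" using n by (cases a; simp)+
    moreover have "s \<in> vbits I" using T unfolding s tracks_def by blast
    ultimately show ?thesis using s r T by (simp add: cons_opt_def hd_opt_def)
  next
    case live: False
    then obtain l where "a = Some l" using n by (cases T; cases a) simp_all
    then obtain f d where a: "a = Some (f, d)" by (cases l) simp
    have n': "next_track I T (Some (f, d)) = (if f then if d \<in> vbits I \<and> T \<noteq> After d then Some (Ended d, d) else None
        else if d \<in> vbits I then Some (After d, d) else None)"
      using live by (cases T; cases f) simp_all
    have reads: "reads I T u y \<longleftrightarrow> encodes I u y \<and> (\<forall>s. T = After s \<longrightarrow> y \<noteq> (\<lambda>i. - s i))" for u y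
      using live by (cases T) simp_all
    show ?thesis
    proof (cases f)
      case True
      then have d: "d \<in> vbits I" "T \<noteq> After d" "T' = Ended d" "c = d"
        using n unfolding a n' by (auto split: if_splits)
      then have x: "x = []" "z = (\<lambda>i. - c i)" using r by simp_all
      have eq: "(\<lambda>i. 2 * z i + c i) = (\<lambda>i. - c i)" by (simp add: x(2))
      have "(\<lambda>i. - c i) \<noteq> (\<lambda>i. - s i)" if "T = After s" for s
        using d(2,4) that by (metis ext neg_equal_iff_equal)
      then show ?thesis
        unfolding reads eq using encodes.sign[OF d(1)] True d x(1)
        by (simp add: a cons_opt_def hd_opt_def tracks_def)
    next
      case False
      then have d: "d \<in> vbits I" "T' = After d" "c = d"
        using n unfolding a n' by (auto split: if_splits)
      then have e: "encodes I x z" "z \<noteq> (\<lambda>i. - d i)" using r by simp_all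
      have "(\<lambda>i. 2 * z i + d i) \<noteq> (\<lambda>i. - s i)" if s: "T = After s" for s
      proof
        assume "(\<lambda>i. 2 * z i + d i) = (\<lambda>i. - s i)"
        moreover have "s \<in> vbits I" using T unfolding s tracks_def by blast
        ultimately show False using digit_not_sign[OF d(1), of s z] e(2) by simp
      qed
      then show ?thesis
        unfolding reads using encodes.digit[OF e(1) d(1) e(2)] False d
        by (simp add: a cons_opt_def hd_opt_def tracks_def)
    qed
  qed
  then show "reads I T (cons_opt a x) (\<lambda>i. 2 * z i + c i)" "hd_opt (cons_opt a x) = a" "tl (cons_opt a x) = x"
    "T' \<in> tracks I" "c \<in> vbits I" by simp_all
qed


definition track_lang :: "'i set \<Rightarrow> (('i \<Rightarrow> int) \<Rightarrow> bool) \<Rightarrow> 'i track \<Rightarrow> (bool \<times> ('i \<Rightarrow> int)) list set" where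
  "track_lang I P T = {u. \<exists>z. reads I T u z \<and> P z}"

lemma track_lang_derivative:
  assumes "T \<in> tracks I"
  shows "{x. l # x \<in> track_lang I P T} =
    (case next_track I T (Some l) of None \<Rightarrow> {} | Some (T', c) \<Rightarrow> track_lang I (sec c P) T')"
    (is "?L = ?R")
proof (intro equalityI subsetI)
  fix x assume "x \<in> ?L"
  then obtain z where z: "reads I T (l # x) z" "P z" unfolding track_lang_def by blast
  from reads_split[OF z(1)] obtain T' c z' where
    "next_track I T (Some l) = Some (T', c)" "z = (\<lambda>i. 2 * z' i + c i)" "reads I T' x z'"
    by (auto simp: hd_opt_def)
  with z(2) show "x \<in> ?R" by (auto simp: track_lang_def sec_def)
next
  fix x assume x: "x \<in> ?R"
  then obtain T' c where n: "next_track I T (Some l) = Some (T', c)"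
    by (cases "next_track I T (Some l)") auto
  with x obtain z' where "reads I T' x z'" "sec c P z'" by (auto simp: track_lang_def)
  with reads_step(1)[OF assms n] show "x \<in> ?L"
    unfolding track_lang_def sec_def cons_opt_def by auto
qed

lemma finite_tracks: "finite I \<Longrightarrow> finite (tracks I)"
  by (simp add: tracks_def finite_vbits)

lemma next_track_closed:
  assumes "T \<in> tracks I" "next_track I T a = Some (T', c)"
  shows "T' \<in> tracks I" "c \<in> bits"
proof -
  have "T' \<in> tracks I \<and> c \<in> vbits I"
  proof (cases a)
    case None
    with assms show ?thesis by (cases T) (auto simp: tracks_def)
  next
    case (Some l)
    obtain f d where "l = (f, d)" by (cases l)
    with Some assms show ?thesis by (cases T; cases f) (auto simp: tracks_def split: if_splits)
  qed
  then show "T' \<in> tracks I" "c \<in> bits" by (simp_all add: vbits_def)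
qed

text \<open>The nonempty derivatives are indexed by a member of the family of \<open>P\<close>
  together with a track, hence finite in number.\<close>

lemma regular_encodings:
  assumes I: "finite I" and P: "aut P"
  shows "regular (UNIV \<times> vbits I) {u. \<exists>z. encodes I u z \<and> P z}"
proof -
  from P obtain \<F> where F: "finite \<F>" "P \<in> \<F>" "\<And>Q b. Q \<in> \<F> \<Longrightarrow> b \<in> bits \<Longrightarrow> sec b Q \<in> \<F>"
    by (erule autE)
  let ?LL = "insert {} ((\<lambda>(Q, T). track_lang I Q T) ` (\<F> \<times> tracks I))"
  have "regular (UNIV \<times> vbits I) (track_lang I P Start)"
  proof (rule regular_if_finite_derivatives)
    show "finite ?LL" using F(1) I by (simp add: finite_tracks)
    show "track_lang I P Start \<in> ?LL" using F(2) by (force simp: tracks_def)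
    show "track_lang I P Start \<subseteq> lists (UNIV \<times> vbits I)"
      using encodes_lists by (fastforce simp: track_lang_def)
    fix K l assume "K \<in> ?LL"
    then consider "K = {}" | Q T where "K = track_lang I Q T" "Q \<in> \<F>" "T \<in> tracks I" by auto
    then show "{x. l # x \<in> K} \<in> ?LL"
    proof cases
      case 2
      show ?thesis
      proof (cases "next_track I T (Some l)")
        case None
        then show ?thesis by (simp add: 2(1) track_lang_derivative[OF 2(3)])
      next
        case (Some p)
        then obtain T' c where p: "next_track I T (Some l) = Some (T', c)" by (cases p) simp
        have "{x. l # x \<in> K} = track_lang I (sec c Q) T'"
          by (simp add: 2(1) track_lang_derivative[OF 2(3)] p)
        then show ?thesis using next_track_closed[OF 2(3) p] F(3)[OF 2(2), of c]
          by (intro insertI2 image_eqI[of _ _ "(sec c Q, T')"]) simp_all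
      qed
    qed simp
  qed
  then show ?thesis by (simp add: track_lang_def)
qed

text \<open>Each word runs on its own track; the two are coupled only by one predicate on the
  disjoint sum of their coordinates.\<close>

definition pair_lang :: "'i set \<Rightarrow> (('i + 'i \<Rightarrow> int) \<Rightarrow> bool) \<Rightarrow> 'i track \<Rightarrow> 'i track \<Rightarrow>
    ((bool \<times> ('i \<Rightarrow> int)) option \<times> (bool \<times> ('i \<Rightarrow> int)) option) list set" where
  "pair_lang I R T S = {conv u v | u v. \<exists>y z. reads I T u y \<and> reads I S v z \<and> R (case_sum y z)}"

text \<open>The column of two blanks must be excluded by hand: two ended tracks would accept it, but
  a convolution never contains it.\<close>

lemma pair_lang_derivative:
  assumes T: "T \<in> tracks I" and S: "S \<in> tracks I"
  shows "{x. (a, b) # x \<in> pair_lang I R T S} =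
    (if a = None \<and> b = None then {} else
     case next_track I T a of None \<Rightarrow> {} | Some (T', c) \<Rightarrow>
     case next_track I S b of None \<Rightarrow> {} | Some (S', d) \<Rightarrow> pair_lang I (sec (case_sum c d) R) T' S')"
    (is "?L = ?R")
proof (intro equalityI subsetI)
  have sum: "(\<lambda>i. 2 * case_sum y z i + case_sum c d i) =
      case_sum (\<lambda>i. 2 * y i + c i) (\<lambda>i. 2 * z i + d i)" for y z c d :: "'a \<Rightarrow> int"
    by (auto split: sum.split)
  {
    fix x assume "x \<in> ?L"
    then obtain u v y z where uv: "(a, b) # x = conv u v" "reads I T u y" "reads I S v z" "R (case_sum y z)"
      unfolding pair_lang_def by auto
    then have ne: "u \<noteq> [] \<or> v \<noteq> []" using conv_Nil[of u v] by auto
    with uv(1) have ab: "a = hd_opt u" "b = hd_opt v" "x = conv (tl u) (tl v)" by (simp_all add: conv_Cons)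
    from reads_split[OF uv(2)] obtain T' c y' where 1:
      "next_track I T a = Some (T', c)" "y = (\<lambda>i. 2 * y' i + c i)" "reads I T' (tl u) y'" unfolding ab by blast
    from reads_split[OF uv(3)] obtain S' d z' where 2:
      "next_track I S b = Some (S', d)" "z = (\<lambda>i. 2 * z' i + d i)" "reads I S' (tl v) z'" unfolding ab by blast
    have "sec (case_sum c d) R (case_sum y' z')" using uv(4) by (simp add: sec_def sum 1(2) 2(2))
    with 1(3) 2(3) have "x \<in> pair_lang I (sec (case_sum c d) R) T' S'"
      unfolding pair_lang_def ab(3) by blast
    moreover have "\<not> (a = None \<and> b = None)" using ne by (auto simp: ab hd_opt_def split: list.splits)
    ultimately show "x \<in> ?R" using 1(1) 2(1) by simp
  next
    fix x assume x: "x \<in> ?R"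
    then have ab: "\<not> (a = None \<and> b = None)" by (simp split: if_splits)
    with x obtain T' c where 1: "next_track I T a = Some (T', c)" by (cases "next_track I T a") auto
    with x ab obtain S' d where 2: "next_track I S b = Some (S', d)" by (cases "next_track I S b") auto
    with x ab 1 have "x \<in> pair_lang I (sec (case_sum c d) R) T' S'" by (simp split: if_splits)
    then obtain u v y z where uv: "x = conv u v" "reads I T' u y" "reads I S' v z" "sec (case_sum c d) R (case_sum y z)"
      unfolding pair_lang_def by blast
    note r1 = reads_step[OF T 1 uv(2)] and r2 = reads_step[OF S 2 uv(3)]
    have "cons_opt a u \<noteq> [] \<or> cons_opt b v \<noteq> []" using ab by (auto simp: cons_opt_def split: option.splits)
    from conv_Cons[OF this] have "(a, b) # x = conv (cons_opt a u) (cons_opt b v)"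
      by (simp add: r1 r2 uv(1))
    moreover have "R (case_sum (\<lambda>i. 2 * y i + c i) (\<lambda>i. 2 * z i + d i))"
      using uv(4) by (simp add: sec_def sum)
    ultimately show "x \<in> ?L" using r1(1) r2(1) unfolding pair_lang_def by blast
  }
qed

lemma conv_in_lists:
  assumes "u \<in> lists Sg" "v \<in> lists Sg"
  shows "conv u v \<in> lists (conv_alph Sg)"
  using assms by (auto simp: conv_def conv_alph_def in_lists_conv_set)

lemma FA_recognizable_encodings:
  assumes I: "finite I" and R: "aut R"
  shows "FA_recognizable (UNIV \<times> vbits I) {(u, v). \<exists>y z. encodes I u y \<and> encodes I v z \<and> R (case_sum y z)}"
proof -
  let ?A = "UNIV \<times> vbits I"
  from R obtain \<F> where F: "finite \<F>" "R \<in> \<F>" "\<And>Q b. Q \<in> \<F> \<Longrightarrow> b \<in> bits \<Longrightarrow> sec b Q \<in> \<F>"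
    by (erule autE)
  let ?LL = "insert {} ((\<lambda>(Q, T, S). pair_lang I Q T S) ` (\<F> \<times> tracks I \<times> tracks I))"
  have "regular (conv_alph ?A) (pair_lang I R Start Start)"
  proof (rule regular_if_finite_derivatives)
    show "finite ?LL" using F(1) I by (simp add: finite_tracks)
    show "pair_lang I R Start Start \<in> ?LL" using F(2) by (force simp: tracks_def)
    show "pair_lang I R Start Start \<subseteq> lists (conv_alph ?A)"
    proof
      fix w assume "w \<in> pair_lang I R Start Start"
      then obtain u v y z where "w = conv u v" "encodes I u y" "encodes I v z"
        unfolding pair_lang_def by auto
      then show "w \<in> lists (conv_alph ?A)" using conv_in_lists encodes_lists by metis
    qed
    fix K l assume "K \<in> ?LL"
    then consider "K = {}" | Q T S where "K = pair_lang I Q T S" "Q \<in> \<F>" "T \<in> tracks I" "S \<in> tracks I" by auto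
    then show "{x. l # x \<in> K} \<in> ?LL"
    proof cases
      case 2
      obtain a b where l: "l = (a, b)" by (cases l)
      note der = pair_lang_derivative[OF 2(3,4), of a b Q, folded l 2(1)]
      show ?thesis
      proof (cases "(a = None \<and> b = None) \<or> next_track I T a = None \<or> next_track I S b = None")
        case True
        then have "{x. l # x \<in> K} = {}" unfolding der by (auto split: option.split)
        then show ?thesis by simp
      next
        case False
        then obtain T' c S' d where n: "next_track I T a = Some (T', c)" "next_track I S b = Some (S', d)" by auto
        have "{x. l # x \<in> K} = pair_lang I (sec (case_sum c d) Q) T' S'"
          unfolding der using False by (auto simp: n)
        moreover have "case_sum c d \<in> bits"
          using next_track_closed(2)[OF 2(3) n(1)] next_track_closed(2)[OF 2(4) n(2)]
          unfolding bits_def by (simp split: sum.split)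
        ultimately show ?thesis
          using next_track_closed(1)[OF 2(3) n(1)] next_track_closed(1)[OF 2(4) n(2)] F(3)[OF 2(2)]
          by (intro insertI2 image_eqI[of _ _ "(sec (case_sum c d) Q, T', S')"]) simp_all
      qed
    qed simp
  qed
  moreover have "(\<lambda>(u, v). conv u v) ` {(u, v). \<exists>y z. encodes I u y \<and> encodes I v z \<and> R (case_sum y z)}
      = pair_lang I R Start Start"
    unfolding pair_lang_def by (auto simp: image_iff)
  moreover have "{(u, v). \<exists>y z. encodes I u y \<and> encodes I v z \<and> R (case_sum y z)} \<subseteq> lists ?A \<times> lists ?A"
    using encodes_lists by blast
  ultimately show ?thesis unfolding FA_recognizable_def by simp
qed

section \<open>Word length and the criterion\<close>

text \<open>An upper bound on word length that avoids \<open>LEAST\<close>, which carries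
  information only once the element is known to be a product of letters.\<close>

definition reachable :: "('g, 'b) monoid_scheme \<Rightarrow> 'g set \<Rightarrow> nat \<Rightarrow> 'g \<Rightarrow> bool" where
  "reachable G A n g \<longleftrightarrow> (\<exists>w\<in>lists (sym_alph A). length w \<le> n \<and> eval_word G w = g)"

context group
begin

lemma eval_word_Nil: "eval_word G [] = \<one>"
  by (simp add: eval_word_def)

lemma eval_word_Cons: "eval_word G ((a, b) # w) = (if b then a else inv a) \<otimes> eval_word G w"
  by (simp add: eval_word_def)

lemma eval_word_closed:
  assumes "A \<subseteq> carrier G" "w \<in> lists (sym_alph A)"
  shows "eval_word G w \<in> carrier G"
  using assms(2)
proof (induction w)
  case (Cons l w)
  then show ?case using assms(1) by (cases l) (auto simp: eval_word_Cons sym_alph_def)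
qed (simp add: eval_word_Nil)

lemma eval_word_append:
  assumes "A \<subseteq> carrier G" "u \<in> lists (sym_alph A)" "v \<in> lists (sym_alph A)"
  shows "eval_word G (u @ v) = eval_word G u \<otimes> eval_word G v"
  using assms(2)
proof (induction u)
  case Nil
  then show ?case using eval_word_closed[OF assms(1,3)] by (simp add: eval_word_Nil)
next
  case (Cons l u)
  obtain a b where l: "l = (a, b)" by (cases l)
  then have "a \<in> carrier G" using Cons.hyps assms(1) by (auto simp: sym_alph_def)
  then show ?case
    using Cons eval_word_closed[OF assms(1,3)] eval_word_closed[OF assms(1) Cons.hyps(2)]
    by (simp add: l eval_word_Cons m_assoc)
qed

lemma reachableI: "w \<in> lists (sym_alph A) \<Longrightarrow> length w \<le> n \<Longrightarrow> reachable G A n (eval_word G w)"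
  unfolding reachable_def by blast

lemma reachableE:
  assumes "reachable G A n g"
  obtains w where "w \<in> lists (sym_alph A)" "length w \<le> n" "g = eval_word G w"
  using assms unfolding reachable_def by blast

lemma reachable_mono:
  assumes "reachable G A n g" "n \<le> m" "A \<subseteq> B"
  shows "reachable G B m g"
proof -
  obtain w where w: "w \<in> lists (sym_alph A)" "length w \<le> n" "g = eval_word G w"
    using assms(1) by (rule reachableE)
  have "sym_alph A \<subseteq> sym_alph B" using assms(3) by (auto simp: sym_alph_def)
  then have "w \<in> lists (sym_alph B)" using w(1) lists_mono by blast
  then show ?thesis using reachableI[of w B m] w(2,3) assms(2) by simp
qed

lemma reachable_one: "reachable G A n \<one>"
  using reachableI[of "[]"] by (simp add: eval_word_Nil)

lemma reachable_mult:
  assumes A: "A \<subseteq> carrier G" and "reachable G A n g" "reachable G A m h"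
  shows "reachable G A (n + m) (g \<otimes> h)"
proof -
  obtain u where u: "u \<in> lists (sym_alph A)" "length u \<le> n" "g = eval_word G u"
    using assms(2) by (rule reachableE)
  obtain v where v: "v \<in> lists (sym_alph A)" "length v \<le> m" "h = eval_word G v"
    using assms(3) by (rule reachableE)
  have "u @ v \<in> lists (sym_alph A)" using u(1) v(1) by simp
  moreover have "length (u @ v) \<le> n + m" using u(2) v(2) by simp
  ultimately have "reachable G A (n + m) (eval_word G (u @ v))" by (rule reachableI)
  then show ?thesis using eval_word_append[OF A u(1) v(1)] u(3) v(3) by simp
qed

lemma reachable_letter:
  assumes "A \<subseteq> carrier G" "a \<in> A" shows "reachable G A 1 (if b then a else inv a)"
proof -
  have "a \<in> carrier G" "[(a, b)] \<in> lists (sym_alph A)" using assms by (auto simp: sym_alph_def)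
  then show ?thesis using reachableI[of "[(a, b)]" A 1] by (simp add: eval_word_Cons eval_word_Nil)
qed

lemma reachable_inv:
  assumes A: "A \<subseteq> carrier G" and "reachable G A n g"
  shows "reachable G A n (inv g)"
proof -
  have *: "reachable G A (length w) (inv (eval_word G w))" if "w \<in> lists (sym_alph A)" for w
    using that
  proof (induction w)
    case Nil
    then show ?case by (simp add: eval_word_Nil reachable_one)
  next
    case (Cons l w)
    obtain a b where l: "l = (a, b)" by (cases l)
    then have a: "a \<in> A" using Cons.hyps by (auto simp: sym_alph_def)
    then have ac: "a \<in> carrier G" using A by blast
    have "inv (eval_word G (l # w)) = inv (eval_word G w) \<otimes> (if \<not> b then a else inv a)"
      using ac eval_word_closed[OF A Cons.hyps(2)] by (simp add: l eval_word_Cons inv_mult_group)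
    then show ?case
      using reachable_mult[OF A Cons.IH reachable_letter[OF A a, of "\<not> b"]] by simp
  qed
  obtain w where w: "w \<in> lists (sym_alph A)" "length w \<le> n" "g = eval_word G w"
    using assms(2) by (rule reachableE)
  from reachable_mono[OF *[OF w(1)] w(2) order_refl] show ?thesis by (simp add: w(3))
qed

lemma reachable_int_pow:
  assumes A: "A \<subseteq> carrier G" and a: "a \<in> A"
  shows "reachable G A (nat \<bar>k\<bar>) (a [^] (k :: int))"
proof -
  have nat: "reachable G A n (a [^] n)" for n :: nat
  proof (induction n)
    case 0
    then show ?case using reachable_one[of A 0] by simp
  next
    case (Suc n)
    show ?case
      unfolding nat_pow_Suc using reachable_mult[OF A Suc reachable_letter[OF A a, of True]]
      unfolding if_True Suc_eq_plus1 .
  qed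
  show ?thesis
  proof (cases "k < 0")
    case True
    then have e: "a [^] k = inv (a [^] nat (- k))" unfolding int_pow_def2 by (simp only: if_True)
    have n: "nat \<bar>k\<bar> = nat (- k)" using True by linarith
    show ?thesis unfolding e n by (rule reachable_inv[OF A nat])
  next
    case False
    then have e: "a [^] k = a [^] nat k" unfolding int_pow_def2 by (simp only: if_False)
    have n: "nat \<bar>k\<bar> = nat k" using False by linarith
    show ?thesis unfolding e n by (rule nat)
  qed
qed

lemma word_length_le: "reachable G A n g \<Longrightarrow> word_length G A g \<le> n"
proof -
  assume "reachable G A n g"
  then obtain w where w: "w \<in> lists (sym_alph A)" "length w \<le> n" "g = eval_word G w"
    by (rule reachableE)
  then have "word_length G A g \<le> length w" unfolding word_length_def by (intro Least_le bexI[of _ w]) simp_all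
  with w(2) show ?thesis by simp
qed

lemma generate_if_reachable:
  assumes A: "A \<subseteq> carrier G" and "\<And>g. g \<in> carrier G \<Longrightarrow> \<exists>n. reachable G A n g"
  shows "generate G A = carrier G"
proof
  show "generate G A \<subseteq> carrier G" using generate_incl[OF A] .
  have "eval_word G w \<in> generate G A" if "w \<in> lists (sym_alph A)" for w
    using that
  proof (induction w)
    case (Cons l w)
    obtain a b where l: "l = (a, b)" by (cases l)
    then have "a \<in> A" using Cons.hyps by (auto simp: sym_alph_def)
    then show ?case using Cons.IH by (cases b) (auto simp: l eval_word_Cons intro: generate.intros)
  qed (simp add: eval_word_Nil generate.one)
  then show "carrier G \<subseteq> generate G A" using assms(2) by (metis reachableE subsetI)
qed

text \<open>A finite group may have too few elements to name all digit columns, so it is treated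
  directly: words of one letter suffice, every relation between them is finite, and all distances
  are bounded by a constant.\<close>

lemma in_B_exp_finite:
  assumes fin: "finite (carrier G)"
  shows "in_B G exp_fun"
proof -
  let ?A = "carrier G"
  define L where "L = (\<lambda>g. [(g, True)]) ` ?A"
  define psi where "psi = (\<lambda>w :: ('a \<times> bool) list. fst (hd w))"
  have L: "finite L" "L \<subseteq> lists (sym_alph ?A)" using fin by (auto simp: L_def sym_alph_def)
  have fa: "FA_recognizable (sym_alph ?A) R" if R: "R \<subseteq> L \<times> L" for R
    unfolding FA_recognizable_def
  proof
    show sub: "R \<subseteq> lists (sym_alph ?A) \<times> lists (sym_alph ?A)"
      using R L(2) by (meson Sigma_mono order_trans)
    have "finite R" using finite_subset[OF R] L(1) by simp
    moreover have "(\<lambda>(u, v). conv u v) ` R \<subseteq> lists (conv_alph (sym_alph ?A))"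
    proof (rule image_subsetI)
      fix p assume "p \<in> R"
      then have "p \<in> lists (sym_alph ?A) \<times> lists (sym_alph ?A)" using sub by (rule rev_subsetD)
      then show "(case p of (u, v) \<Rightarrow> conv u v) \<in> lists (conv_alph (sym_alph ?A))"
        using conv_in_lists[of "fst p" "sym_alph ?A" "snd p"] by (simp add: case_prod_beta mem_Times_iff)
    qed
    ultimately show "regular (conv_alph (sym_alph ?A)) ((\<lambda>(u, v). conv u v) ` R)"
      by (intro regular_finite finite_imageI)
  qed
  have bij: "bij_betw psi L ?A"
  proof (rule bij_betwI')
    have LE: "\<exists>x\<in>carrier G. u = [(x, True)]" if "u \<in> L" for u using that by (auto simp: L_def)
    fix u v assume "u \<in> L" "v \<in> L"
    then show "(psi u = psi v) = (u = v)" using LE[of u] LE[of v] by (auto simp: psi_def)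
  next
    fix u assume "u \<in> L"
    then show "psi u \<in> carrier G" by (auto simp: psi_def L_def)
  next
    fix g assume "g \<in> carrier G"
    then have "[(g, True)] \<in> L" unfolding L_def by (rule imageI)
    then show "\<exists>u\<in>L. g = psi u" by (rule bexI[rotated]) (simp add: psi_def)
  qed
  have rep: "cayley_automatic_rep G ?A L psi"
    unfolding cayley_automatic_rep_def
  proof (intro conjI ballI)
    fix a
    show "FA_recognizable (sym_alph ?A) {(u, v). u \<in> L \<and> v \<in> L \<and> psi v = psi u \<otimes> a}"
      by (rule fa) blast
  qed (rule regular_finite[OF L], rule bij)
  define D where "D = (\<lambda>w. word_dist G ?A (eval_word G w) (psi w)) ` L"
  have D: "finite D" using L(1) by (simp add: D_def)
  \<comment> \<open>\<open>Suc\<close> keeps the constant positive when all distances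
    vanish.\<close>
  have "rep_fun G ?A L psi n \<le> real (Suc (Max (insert 0 D))) * exp_fun (1 * n)" for n
  proof -
    have "Max (insert 0 {word_dist G ?A (eval_word G w) (psi w) | w. w \<in> L \<and> length w \<le> n}) \<le> Max (insert 0 D)"
    proof (rule Max_mono)
      show "insert 0 {word_dist G ?A (eval_word G w) (psi w) | w. w \<in> L \<and> length w \<le> n} \<subseteq> insert 0 D"
        unfolding D_def by blast
    qed (use D in simp_all)
    then have "rep_fun G ?A L psi n \<le> real (Suc (Max (insert 0 D))) * 1" unfolding rep_fun_def by simp
    also have "\<dots> \<le> real (Suc (Max (insert 0 D))) * exp_fun (1 * n)"
      by (rule mult_left_mono) (simp_all add: exp_fun_def)
    finally show ?thesis .
  qed
  then have "preceq (rep_fun G ?A L psi) exp_fun"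
    unfolding preceq_def by (intro exI[of _ 0] exI[of _ "Suc (Max (insert 0 D))"] exI[of _ 1]) simp
  moreover have "fin_gen_set G ?A"
    using fin generate_incl[of ?A] generate.incl[of _ ?A G] by (simp add: fin_gen_set_def subset_antisym subsetI)
  ultimately show ?thesis unfolding in_B_def using rep by blast
qed

text \<open>Recognizability is required for multiplication by every element, not only by generators,
  because the generating set still has to be enlarged until it can serve as an alphabet of digit
  columns.\<close>

theorem in_B_exp_if_coordinates:
  fixes phi :: "('i \<Rightarrow> int) \<Rightarrow> 'a"
  assumes A0: "finite A0" "A0 \<subseteq> carrier G" and I: "finite I" and S: "S \<subseteq> vecs I" "aut (\<lambda>z. z \<in> S)"
    and phi: "bij_betw phi S (carrier G)"
    and mult: "\<And>g. g \<in> carrier G \<Longrightarrow>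
      aut (\<lambda>p. p \<circ> Inl \<in> S \<and> p \<circ> Inr \<in> S \<and> phi (p \<circ> Inr) = phi (p \<circ> Inl) \<otimes> g)"
    and len: "\<And>z. z \<in> S \<Longrightarrow> reachable G A0 (K * (1 + (\<Sum>i\<in>I. nat \<bar>z i\<bar>))) (phi z)"
  shows "in_B G exp_fun"
proof (cases "finite (carrier G)")
  case False
  let ?B = "(UNIV :: bool set) \<times> vbits I"
  \<comment> \<open>Arbitrary further generators, as many as there are digit columns. They need not
    be related to the coordinates, since they only lend their names to columns.\<close>
  obtain X where X: "finite X" "card X = card ?B" "X \<subseteq> carrier G"
    using infinite_arbitrarily_large[OF False] by blast
  define A where "A = A0 \<union> X"
  have A: "finite A" "A \<subseteq> carrier G" "A0 \<subseteq> A" using A0 X by (auto simp: A_def)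
  have "card ?B \<le> card A" using X A(1) by (metis A_def card_mono sup_ge2)
  also have "\<dots> \<le> card (sym_alph A)" by (simp add: sym_alph_def card_cartesian_product)
  finally obtain f where f: "f ` ?B \<subseteq> sym_alph A" "inj_on f ?B"
    using card_le_inj[of ?B "sym_alph A"] A(1) I by (auto simp: finite_vbits sym_alph_def)
  define L0 where "L0 = {u. \<exists>z. encodes I u z \<and> z \<in> S}"
  define L where "L = map f ` L0"
  \<comment> \<open>On \<open>L\<close> the decoded vector is unique, because \<open>f\<close> is
    injective on columns and an encoding determines its value.\<close>
  define psi where "psi = (\<lambda>w. phi (SOME z. \<exists>u. w = map f u \<and> encodes I u z))"
  have psi: "psi (map f u) = phi z" if "encodes I u z" for u z
  proof -
    have "z' = z" if "map f u = map f u'" "encodes I u' z'" for u' z'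
    proof -
      have "set u \<union> set u' \<subseteq> ?B"
        using encodes_lists[OF \<open>encodes I u z\<close>] encodes_lists[OF that(2)] by (metis Un_subset_iff in_listsD subsetI)
      then have "u = u'" using that(1) map_inj_on inj_on_subset[OF f(2)] by metis
      then show ?thesis using encodes_fun that(2) \<open>encodes I u z\<close> by metis
    qed
    then have "(SOME z. \<exists>u'. map f u = map f u' \<and> encodes I u' z) = z"
      using that by (intro some_equality) metis+
    then show ?thesis by (simp add: psi_def)
  qed
  have L: "w \<in> L \<longleftrightarrow> (\<exists>u z. w = map f u \<and> encodes I u z \<and> z \<in> S)" for w
    unfolding L_def L0_def by blast
  have reg: "regular (sym_alph A) L"
    unfolding L_def L0_def by (rule regular_map_inj[OF regular_encodings[OF I S(2)] f(2,1)])
  have bij: "bij_betw psi L (carrier G)"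
    unfolding bij_betw_def
  proof
    show "inj_on psi L"
    proof (rule inj_onI)
      fix w w' assume "w \<in> L" "w' \<in> L" and eq: "psi w = psi w'"
      then obtain u z u' z' where u: "w = map f u" "encodes I u z" "z \<in> S"
        "w' = map f u'" "encodes I u' z'" "z' \<in> S" unfolding L by blast
      have "phi z = phi z'" using u eq by (simp add: psi)
      then have "z = z'" using inj_onD[OF bij_betw_imp_inj_on[OF phi]] u by blast
      then show "w = w'" using u encodes_inj by metis
    qed
    have "psi ` L \<subseteq> carrier G"
    proof (rule image_subsetI)
      fix w assume "w \<in> L"
      then obtain u z where "w = map f u" "encodes I u z" "z \<in> S" unfolding L by blast
      then show "psi w \<in> carrier G" using bij_betwE[OF phi] by (simp add: psi)
    qed
    moreover have "g \<in> psi ` L" if g: "g \<in> carrier G" for g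
    proof -
      from g obtain z where z: "z \<in> S" "g = phi z" using phi by (auto simp: bij_betw_def)
      then obtain u where u: "encodes I u z" using encodes_exists[OF I] S(1) by blast
      then have "map f u \<in> L" using z(1) unfolding L by blast
      moreover have "g = psi (map f u)" using psi[OF u] z(2) by simp
      ultimately show ?thesis by blast
    qed
    ultimately show "psi ` L = carrier G" by blast
  qed
  have "FA_recognizable (sym_alph A) {(u, v). u \<in> L \<and> v \<in> L \<and> psi v = psi u \<otimes> a}" if "a \<in> A" for a
  proof -
    define R where "R = (\<lambda>p. p \<circ> Inl \<in> S \<and> p \<circ> Inr \<in> S \<and> phi (p \<circ> Inr) = phi (p \<circ> Inl) \<otimes> a)"
    have "aut R" unfolding R_def using mult A(2) that by blast
    note fa = FA_recognizable_map_inj[OF FA_recognizable_encodings[OF I this] f(2,1)]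
    have "{(u, v). u \<in> L \<and> v \<in> L \<and> psi v = psi u \<otimes> a} =
      (\<lambda>(u, v). (map f u, map f v)) ` {(u, v). \<exists>y z. encodes I u y \<and> encodes I v z \<and> R (case_sum y z)}"
      (is "?R = _ ` ?R'")
    proof (intro equalityI subsetI)
      fix p assume "p \<in> ?R"
      then obtain w w' where p: "p = (w, w')" "w \<in> L" "w' \<in> L" "psi w' = psi w \<otimes> a" by blast
      then obtain u z u' z' where u: "w = map f u" "encodes I u z" "z \<in> S"
        "w' = map f u'" "encodes I u' z'" "z' \<in> S" unfolding L by blast
      have "R (case_sum z z')" using u p(4) by (simp add: R_def psi case_sum_o_inj)
      with u have "(u, u') \<in> ?R'" by blast
      then show "p \<in> (\<lambda>(u, v). (map f u, map f v)) ` ?R'" using p(1) u by (metis (no_types, lifting) case_prod_conv image_eqI)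
    next
      fix p assume "p \<in> (\<lambda>(u, v). (map f u, map f v)) ` ?R'"
      then obtain u v y z where p: "p = (map f u, map f v)" "encodes I u y" "encodes I v z" "R (case_sum y z)"
        by auto
      from p(4) have "y \<in> S" "z \<in> S" "phi z = phi y \<otimes> a" by (simp_all add: R_def case_sum_o_inj)
      with p(1-3) show "p \<in> ?R" by (auto simp: L psi)
    qed
    with fa show ?thesis by simp
  qed
  with reg bij have rep: "cayley_automatic_rep G A L psi" unfolding cayley_automatic_rep_def by blast
  \<comment> \<open>The summand 1 pays for \<open>eval_word G w\<close>, whose length is at most
    \<open>n \<le> 2 ^ n\<close>; the others pay for \<open>psi w\<close>, which has
    \<open>card I\<close> coordinates of absolute value at most \<open>2 ^ n\<close>.\<close>
  define C where "C = 1 + K + K * card I"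
  have dist: "word_dist G A (eval_word G w) (psi w) \<le> C * 2 ^ n" if w: "w \<in> L" "length w \<le> n" for w n
  proof -
    from w obtain u z where u: "w = map f u" "encodes I u z" "z \<in> S" unfolding L by blast
    have wl: "w \<in> lists (sym_alph A)" using reg w(1) unfolding regular_def by blast
    have "nat \<bar>z i\<bar> \<le> 2 ^ n" for i
    proof -
      have "\<bar>z i\<bar> \<le> 2 ^ length u" using encodes_bound[OF u(2), of i] by linarith
      also have "\<dots> \<le> 2 ^ n" using w(2) u(1) by (intro power_increasing) simp_all
      finally show ?thesis by (simp add: nat_le_iff)
    qed
    then have "(\<Sum>i\<in>I. nat \<bar>z i\<bar>) \<le> card I * 2 ^ n" using sum_bounded_above[of I "\<lambda>i. nat \<bar>z i\<bar>" "2 ^ n"] by simp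
    then have "K * (1 + (\<Sum>i\<in>I. nat \<bar>z i\<bar>)) \<le> K * (1 + card I * 2 ^ n)" by simp
    also have "\<dots> \<le> K * 2 ^ n + K * card I * 2 ^ n" by (simp add: algebra_simps)
    finally have 1: "K * (1 + (\<Sum>i\<in>I. nat \<bar>z i\<bar>)) \<le> K * 2 ^ n + K * card I * 2 ^ n" .
    have "length w \<le> 2 ^ n" using w(2) less_exp[of n] by linarith
    with wl have 2: "reachable G A (2 ^ n) (inv (eval_word G w))"
      by (intro reachable_inv[OF A(2)]) (auto simp: reachable_def)
    have "reachable G A (2 ^ n + (K * 2 ^ n + K * card I * 2 ^ n)) (inv (eval_word G w) \<otimes> psi w)"
      using reachable_mult[OF A(2) 2 reachable_mono[OF len[OF u(3)] 1 A(3)]] psi[OF u(2)] u(1) by simp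
    then have "word_dist G A (eval_word G w) (psi w) \<le> 2 ^ n + (K * 2 ^ n + K * card I * 2 ^ n)"
      unfolding word_dist_def by (rule word_length_le)
    then show ?thesis by (simp add: C_def algebra_simps)
  qed
  have "rep_fun G A L psi n \<le> real C * exp_fun (1 * n)" for n
  proof -
    let ?D = "insert 0 {word_dist G A (eval_word G w) (psi w) | w. w \<in> L \<and> length w \<le> n}"
    have le: "d \<le> C * 2 ^ n" if "d \<in> ?D" for d using that dist by auto
    then have "finite ?D" using finite_nat_set_iff_bounded_le by blast
    then have "Max ?D \<le> C * 2 ^ n" using le by (intro Max.boundedI) auto
    then have "rep_fun G A L psi n \<le> real (C * 2 ^ n)" unfolding rep_fun_def by (rule of_nat_mono)
    also have "\<dots> = real C * 2 ^ n" by simp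
    also have "(2 :: real) ^ n \<le> exp 1 ^ n"
      using exp_ge_add_one_self[of 1] by (intro power_mono) simp_all
    then have "real C * 2 ^ n \<le> real C * exp_fun (1 * n)"
      by (simp add: exp_fun_def mult_left_mono exp_of_nat_mult[symmetric])
    finally show ?thesis .
  qed
  then have "preceq (rep_fun G A L psi) exp_fun"
    unfolding preceq_def by (intro exI[of _ 0] exI[of _ C] exI[of _ 1]) (simp add: C_def)
  moreover have "fin_gen_set G A"
  proof -
    have "\<exists>n. reachable G A n g" if g: "g \<in> carrier G" for g
    proof -
      from g obtain z where "z \<in> S" "g = phi z" using phi by (auto simp: bij_betw_def)
      then show ?thesis using reachable_mono[OF len order_refl A(3)] by blast
    qed
    then show ?thesis using A generate_if_reachable[OF A(2)] by (simp add: fin_gen_set_def)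
  qed
  ultimately show ?thesis unfolding in_B_def using rep by blast
qed (rule in_B_exp_finite)

end

section \<open>Affine coordinates\<close>

lemma bits_comp: "b \<in> bits \<Longrightarrow> b \<circ> f \<in> bits"
  by (simp add: bits_def)

lemma aut_reindex:
  assumes "aut P" shows "aut (\<lambda>p. P (p \<circ> f))"
proof -
  from assms obtain \<F> where F: "finite \<F>" "P \<in> \<F>" "\<And>Q b. Q \<in> \<F> \<Longrightarrow> b \<in> bits \<Longrightarrow> sec b Q \<in> \<F>"
    by (erule autE)
  show ?thesis
  proof (rule autI)
    show "finite ((\<lambda>Q p. Q (p \<circ> f)) ` \<F>)" using F(1) by simp
    show "(\<lambda>p. P (p \<circ> f)) \<in> (\<lambda>Q p. Q (p \<circ> f)) ` \<F>" using F(2) by (rule imageI)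
    fix R b assume "R \<in> (\<lambda>Q p. Q (p \<circ> f)) ` \<F>" and b: "b \<in> (bits :: ('b \<Rightarrow> int) set)"
    then obtain Q where Q: "Q \<in> \<F>" "R = (\<lambda>p. Q (p \<circ> f))" by (elim imageE)
    have "sec b R = (\<lambda>p. sec (b \<circ> f) Q (p \<circ> f))" unfolding Q(2) sec_def by (simp add: comp_def)
    then show "sec b R \<in> (\<lambda>Q p. Q (p \<circ> f)) ` \<F>"
      using F(3)[OF Q(1) bits_comp[OF b]] by (rule image_eqI)
  qed
qed

lemma lin_reindex:
  assumes "lin f" shows "lin (\<lambda>p. f (p \<circ> g))"
proof -
  obtain B where B: "\<forall>b\<in>bits. \<bar>f b\<bar> \<le> B" using assms unfolding lin_def by blast
  show ?thesis
  proof (rule linI)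
    show "f ((\<lambda>i. 2 * z i + b i) \<circ> g) = 2 * f (z \<circ> g) + f (b \<circ> g)" for z b
      using linD[OF assms, of "z \<circ> g" "b \<circ> g"] by (simp add: comp_def)
    show "\<bar>f (b \<circ> g)\<bar> \<le> B" if "b \<in> bits" for b using bspec[OF B bits_comp[OF that]] .
  qed
qed

text \<open>The complement of \<open>I\<close> may be infinite, so \<open>aut_ball\<close> does not
  apply. But twice an integer plus a bit vanishes only if both do, so each section is the predicate
  itself or \<open>False\<close>.\<close>

lemma aut_vecs: "aut (\<lambda>z. z \<in> vecs I)"
proof (rule autI)
  let ?F = "{\<lambda>z. z \<in> vecs I, \<lambda>z. False}"
  show "finite ?F" "(\<lambda>z. z \<in> vecs I) \<in> ?F" by simp_all
  fix Q b assume Q: "Q \<in> ?F" and b: "b \<in> (bits :: ('a \<Rightarrow> int) set)"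
  have eq: "2 * x + b i = 0 \<longleftrightarrow> x = 0 \<and> b i = 0" for i x
  proof -
    have "b i = 0 \<or> b i = 1" using b by (simp add: bits_def)
    then show ?thesis by presburger
  qed
  show "sec b Q \<in> ?F"
  proof (cases "b \<in> vecs I")
    case True
    then have "sec b (\<lambda>z. z \<in> vecs I) = (\<lambda>z. z \<in> vecs I)" by (simp add: sec_def vecs_def eq)
    with Q show ?thesis by (auto simp: sec_def)
  next
    case False
    then have "sec b (\<lambda>z. z \<in> vecs I) = (\<lambda>z. False)" by (auto simp: sec_def vecs_def eq fun_eq_iff)
    with Q show ?thesis by (auto simp: sec_def)
  qed
qed

definition restr :: "'i set \<Rightarrow> ('i \<Rightarrow> int) \<Rightarrow> 'i \<Rightarrow> int" where
  "restr I z = (\<lambda>i. if i \<in> I then z i else 0)"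

text \<open>Dependence on finitely many coordinates provides the bound: restricted to
  \<open>I\<close> there are only finitely many digit columns.\<close>

lemma lin_if_additive:
  assumes I: "finite I" and add: "\<And>y z. f (\<lambda>i. y i + z i) = f y + f z" and restr: "\<And>z. f z = f (restr I z)"
  shows "lin f"
proof (rule linI)
  show "f (\<lambda>i. 2 * z i + b i) = 2 * f z + f b" for z b
    using add[of "\<lambda>i. z i + z i" b] add[of z z] by simp
  show "\<bar>f b\<bar> \<le> Max ((\<lambda>b. \<bar>f b\<bar>) ` vbits I)" if b: "b \<in> bits" for b
  proof -
    have "restr I b \<in> vbits I" using b by (simp add: restr_def vbits_def bits_def vecs_def)
    then show ?thesis using restr[of b] finite_vbits[OF I] by (intro Max_ge) auto
  qed
qed

text \<open>The form of recognizability used for unitriangular matrices and torus bundles, whose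
  coordinates fill all of \<open>vecs I\<close>.\<close>

lemma aut_affine_graph:
  assumes I: "finite I" and lin: "\<And>i. i \<in> I \<Longrightarrow> lin (f i)"
  shows "aut (\<lambda>p. p \<circ> Inl \<in> vecs I \<and> p \<circ> Inr \<in> vecs I \<and> (\<forall>i\<in>I. p (Inr i) = f i (p \<circ> Inl) + e i))"
proof -
  have "aut (\<lambda>p. p (Inr i) = f i (p \<circ> Inl) + e i)" if "i \<in> I" for i
  proof -
    have "aut (\<lambda>p. (f i (p \<circ> Inl) - p (Inr i)) + e i = 0)"
      by (rule aut_lin_eq[OF lin_diff[OF lin_reindex[OF lin[OF that]] lin_var]])
    moreover have "((f i (p \<circ> Inl) - p (Inr i)) + e i = 0) = (p (Inr i) = f i (p \<circ> Inl) + e i)" for p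
      by linarith
    ultimately show ?thesis by simp
  qed
  then show ?thesis
    by (intro aut_conj aut_ball I aut_reindex[OF aut_vecs])
qed

text \<open>A homomorphism from the integers satisfies \<open>f x = f 1 [^] x\<close>. This avoids
  computing powers inside the concrete groups.\<close>

lemma (in group) reachable_additive:
  fixes f :: "int \<Rightarrow> 'a"
  assumes A: "A \<subseteq> carrier G" "f 1 \<in> A" and closed: "\<And>x. f x \<in> carrier G"
    and add: "\<And>x y. f (x + y) = f x \<otimes> f y"
  shows "reachable G A (nat \<bar>x\<bar>) (f x)"
proof -
  have zero: "f 0 = \<one>" using add[of 0 0] closed[of 0] by (simp add: l_cancel_one)
  have nat: "f (int n) = f 1 [^] n" for n
  proof (induction n)
    case (Suc n)
    have "f (int (Suc n)) = f (int n) \<otimes> f 1" using add[of "int n" 1] by (simp add: add.commute)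
    then show ?case by (simp add: Suc)
  qed (simp add: zero)
  have neg: "f (- y) = inv (f y)" for y
  proof -
    have "f (- y) \<otimes> f y = \<one>" using add[of "- y" y] by (simp add: zero)
    then show ?thesis using closed inv_equality by metis
  qed
  have "f x = f 1 [^] x"
  proof (cases "x < 0")
    case True
    then have "f x = inv (f (int (nat (- x))))" by (simp add: neg closed)
    then show ?thesis unfolding nat int_pow_def2 using True by simp
  next
    case False
    then have "f x = f (int (nat x))" by simp
    then show ?thesis unfolding nat int_pow_def2 using False by simp
  qed
  with reachable_int_pow[OF A] show ?thesis by simp
qed

section \<open>Unitriangular matrices\<close>

definition ut_index :: "nat \<Rightarrow> (nat \<times> nat) set" where
  "ut_index n = {(i, j). i < j \<and> j < n}"

definition ut_mat :: "nat \<Rightarrow> (nat \<times> nat \<Rightarrow> int) \<Rightarrow> nat \<Rightarrow> nat \<Rightarrow> int" where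
  "ut_mat n z = (\<lambda>i j. if (i, j) \<in> ut_index n then z (i, j) else id_mat n i j)"

abbreviation elem_mat :: "nat \<Rightarrow> nat \<Rightarrow> nat \<Rightarrow> int \<Rightarrow> nat \<Rightarrow> nat \<Rightarrow> int" where
  "elem_mat n k l m \<equiv> ut_mat n ((\<lambda>_. 0)((k, l) := m))"

lemma finite_ut_index: "finite (ut_index n)"
  by (rule finite_subset[of _ "{..<n} \<times> {..<n}"]) (auto simp: ut_index_def)

lemma ut_carrier: "M \<in> carrier (UT_int n) \<longleftrightarrow> is_nmat n M \<and> (\<forall>i<n. M i i = 1) \<and> (\<forall>i j. j < i \<longrightarrow> M i j = 0)"
  by (simp add: UT_int_def)

lemma ut_mat_carrier: "ut_mat n z \<in> carrier (UT_int n)"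
  by (auto simp: ut_carrier ut_mat_def ut_index_def id_mat_def is_nmat_def)

lemma ut_eqI:
  assumes "M \<in> carrier (UT_int n)" "N \<in> carrier (UT_int n)" "\<And>i j. (i, j) \<in> ut_index n \<Longrightarrow> M i j = N i j"
  shows "M = N"
proof (intro ext)
  fix i j
  consider "(i, j) \<in> ut_index n" | "j < i" | "i = j" "i < n" | "n \<le> i \<or> n \<le> j"
    unfolding ut_index_def mem_Collect_eq prod.case by linarith
  then show "M i j = N i j" using assms by cases (auto simp: ut_carrier is_nmat_def)
qed

lemma ut_mat_surj:
  assumes "M \<in> carrier (UT_int n)"
  shows "M = ut_mat n (restr (ut_index n) (\<lambda>(i, j). M i j))"
  by (rule ut_eqI[OF assms ut_mat_carrier]) (simp add: ut_mat_def restr_def)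

lemma sum_id_left: "i < n \<Longrightarrow> (\<Sum>k<n. id_mat n i k * f k) = f i"
  by (simp add: id_mat_def if_distrib[of "\<lambda>x. x * _"] sum.delta cong: if_cong)

lemma sum_id_right: "j < n \<Longrightarrow> (\<Sum>k<n. f k * id_mat n k j) = f j"
proof -
  assume "j < n"
  have "(\<Sum>k<n. f k * id_mat n k j) = (\<Sum>k<n. if k = j then f k else 0)"
    by (rule sum.cong) (simp_all add: id_mat_def)
  then show ?thesis using \<open>j < n\<close> by simp
qed

lemma mat_mult_id_left: "is_nmat n M \<Longrightarrow> mat_mult n (id_mat n) M = M"
proof (intro ext)
  fix i j assume M: "is_nmat n M"
  show "mat_mult n (id_mat n) M i j = M i j"
  proof (cases "i < n")
    case False
    then show ?thesis using M by (simp add: mat_mult_def is_nmat_def id_mat_def)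
  qed (simp add: mat_mult_def sum_id_left)
qed

lemma mat_mult_id_right: "is_nmat n M \<Longrightarrow> mat_mult n M (id_mat n) = M"
proof (intro ext)
  fix i j assume M: "is_nmat n M"
  show "mat_mult n M (id_mat n) i j = M i j"
  proof (cases "j < n")
    case False
    have "(\<Sum>k<n. M i k * id_mat n k j) = 0" using False by (intro sum.neutral) (simp add: id_mat_def)
    then show ?thesis using M False by (simp add: mat_mult_def is_nmat_def)
  qed (simp add: mat_mult_def sum_id_right)
qed

lemma mat_mult_assoc: "mat_mult n (mat_mult n A B) C = mat_mult n A (mat_mult n B C)"
proof (intro ext)
  fix i j
  have "mat_mult n (mat_mult n A B) C i j = (\<Sum>k<n. \<Sum>l<n. A i l * B l k * C k j)"
    by (simp add: mat_mult_def sum_distrib_right)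
  also have "\<dots> = (\<Sum>l<n. \<Sum>k<n. A i l * B l k * C k j)" by (rule sum.swap)
  also have "\<dots> = mat_mult n A (mat_mult n B C) i j"
    by (simp add: mat_mult_def sum_distrib_left mult.assoc)
  finally show "mat_mult n (mat_mult n A B) C i j = mat_mult n A (mat_mult n B C) i j" .
qed

lemma ut_mult_closed:
  assumes M: "M \<in> carrier (UT_int n)" and N: "N \<in> carrier (UT_int n)"
  shows "mat_mult n M N \<in> carrier (UT_int n)"
  unfolding ut_carrier
proof (intro conjI allI impI)
  show "is_nmat n (mat_mult n M N)" using M N by (auto simp: ut_carrier is_nmat_def mat_mult_def)
  fix i assume i: "i < n"
  have "M i k * N k i = id_mat n i k" if "k < n" for k
    using M N that i by (cases k i rule: linorder_cases) (simp_all add: ut_carrier id_mat_def)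
  then have "mat_mult n M N i i = (\<Sum>k<n. id_mat n i k * 1)" by (simp add: mat_mult_def)
  then show "mat_mult n M N i i = 1" by (simp only: sum_id_left[OF i])
next
  fix i j :: nat assume "j < i"
  have "M i k * N k j = 0" for k
  proof (cases "k < i")
    case False
    then have "N k j = 0" using N \<open>j < i\<close> by (simp add: ut_carrier)
    then show ?thesis by simp
  qed (use M in \<open>simp add: ut_carrier\<close>)
  then show "mat_mult n M N i j = 0" unfolding mat_mult_def by (intro sum.neutral ballI)
qed

lemma ut_mat_zero: "ut_mat n (\<lambda>_. 0) = id_mat n"
  by (auto simp: ut_mat_def id_mat_def ut_index_def fun_eq_iff)

lemma ut_monoid: "monoid (UT_int n)"
proof (rule monoidI)
  show "\<one>\<^bsub>UT_int n\<^esub> \<in> carrier (UT_int n)" using ut_mat_carrier[of n "\<lambda>_. 0"] by (simp add: ut_mat_zero UT_int_def)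
qed (use ut_mult_closed in \<open>simp_all add: UT_int_def mat_mult_assoc mat_mult_id_left mat_mult_id_right\<close>)

text \<open>Multiplying by the elementary matrix on the right adds \<open>m\<close> times column
  \<open>k\<close> to column \<open>l\<close>. The assumption on \<open>z\<close> makes column
  \<open>k\<close> a unit vector, so that a single entry changes.\<close>

lemma ut_mat_mult_elem:
  assumes "(k, l) \<in> ut_index n" and z: "\<And>i. z (i, k) = 0"
  shows "mat_mult n (ut_mat n z) (elem_mat n k l m) = ut_mat n (z((k, l) := z (k, l) + m))"
proof (rule ut_eqI[OF ut_mult_closed[OF ut_mat_carrier ut_mat_carrier] ut_mat_carrier])
  fix i j assume ij: "(i, j) \<in> ut_index n"
  have kl: "k < l" "l < n" and j: "j < n" using assms(1) ij by (simp_all add: ut_index_def)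
  have zik: "ut_mat n z i k = id_mat n i k" by (simp add: ut_mat_def z id_mat_def ut_index_def)
  have "elem_mat n k l m x j = id_mat n x j + (if x = k \<and> j = l then m else 0)" for x
    using assms(1) by (auto simp: ut_mat_def id_mat_def ut_index_def)
  then have "mat_mult n (ut_mat n z) (elem_mat n k l m) i j
      = (\<Sum>x<n. ut_mat n z i x * id_mat n x j + (if x = k then (if j = l then ut_mat n z i x * m else 0) else 0))"
    unfolding mat_mult_def by (intro sum.cong) (simp_all add: algebra_simps)
  also have "\<dots> = ut_mat n z i j + (if j = l then id_mat n i k * m else 0)"
    using kl by (simp add: sum.distrib sum_id_right[OF j] zik)
  also have "\<dots> = ut_mat n (z((k, l) := z (k, l) + m)) i j"
    using kl ij by (auto simp: ut_mat_def id_mat_def)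
  finally show "mat_mult n (ut_mat n z) (elem_mat n k l m) i j = ut_mat n (z((k, l) := z (k, l) + m)) i j" .
qed

text \<open>Splitting off a nonzero entry in the leftmost nonzero column \<open>l\<close> leaves column \<open>k < l\<close> zero,
  so that no other entry is affected.\<close>

lemma ut_mat_induct [consumes 1, case_names zero mult]:
  assumes "z \<in> vecs (ut_index n)" and zero: "P (\<lambda>_. 0)"
    and step: "\<And>z k l m. z \<in> vecs (ut_index n) \<Longrightarrow> (k, l) \<in> ut_index n \<Longrightarrow> z (k, l) = 0 \<Longrightarrow> P z \<Longrightarrow>
      mat_mult n (ut_mat n z) (elem_mat n k l m) = ut_mat n (z((k, l) := m)) \<Longrightarrow> P (z((k, l) := m))"
  shows "P z"
  using assms(1)
proof (induction "card {p \<in> ut_index n. z p \<noteq> 0}" arbitrary: z rule: less_induct)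
  case less
  show ?case
  proof (cases "\<exists>l k. z (k, l) \<noteq> 0")
    case False
    then have "z = (\<lambda>_. 0)" by auto
    then show ?thesis using zero by simp
  next
    case True
    define l where "l = (LEAST l. \<exists>k. z (k, l) \<noteq> 0)"
    obtain k where k: "z (k, l) \<noteq> 0" using LeastI_ex[OF True] unfolding l_def by blast
    have min: "z (i, j) = 0" if "j < l" for i j using not_less_Least that unfolding l_def by blast
    have kl: "(k, l) \<in> ut_index n" using k less.prems unfolding vecs_def by blast
    define y where "y = z((k, l) := 0)"
    have y: "y \<in> vecs (ut_index n)" "y (k, l) = 0" "z = y((k, l) := z (k, l))"
      using less.prems by (simp_all add: y_def vecs_def)
    have "{p \<in> ut_index n. y p \<noteq> 0} \<subset> {p \<in> ut_index n. z p \<noteq> 0}" using k kl by (auto simp: y_def)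
    then have "P y"
      using finite_ut_index by (intro less.hyps[OF _ y(1)] psubset_card_mono) simp_all
    have "y (i, k) = 0" for i using min[of k i] kl by (simp add: y_def ut_index_def)
    from ut_mat_mult_elem[of k l n y, OF kl this] y(2)
    have "mat_mult n (ut_mat n y) (elem_mat n k l (z (k, l))) = ut_mat n (y((k, l) := z (k, l)))" by simp
    from step[OF y(1) kl y(2) \<open>P y\<close> this] y(3) show ?thesis by simp
  qed
qed

lemma elem_mat_add:
  assumes "(k, l) \<in> ut_index n"
  shows "mat_mult n (elem_mat n k l x) (elem_mat n k l y) = elem_mat n k l (x + y)"
proof -
  have "k \<noteq> l" using assms by (simp add: ut_index_def)
  then show ?thesis using ut_mat_mult_elem[OF assms, of "(\<lambda>_. 0)((k, l) := x)" y] by simp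
qed

text \<open>Inverses come without determinants or back substitution: every matrix is a product of
  elementary ones, and these are invertible by \<open>elem_mat_add\<close>.\<close>

lemma ut_group: "group (UT_int n)"
proof -
  interpret monoid "UT_int n" by (rule ut_monoid)
  have mult_eq: "x \<otimes>\<^bsub>UT_int n\<^esub> y = mat_mult n x y" and one: "\<one>\<^bsub>UT_int n\<^esub> = id_mat n" for x y
    by (simp_all add: UT_int_def)
  have elem: "elem_mat n k l m \<in> Units (UT_int n)" if "(k, l) \<in> ut_index n" for k l m
  proof -
    have zero: "elem_mat n k l 0 = id_mat n" by (simp add: ut_mat_zero fun_upd_idem)
    show ?thesis
      unfolding Units_def mem_Collect_eq mult_eq one
      by (intro conjI bexI[of _ "elem_mat n k l (- m)"] ut_mat_carrier) (simp_all add: elem_mat_add[OF that] zero)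
  qed
  have "ut_mat n z \<in> Units (UT_int n)" if "z \<in> vecs (ut_index n)" for z
    using that
  proof (induction rule: ut_mat_induct)
    case zero
    then show ?case using Units_one_closed by (simp add: one ut_mat_zero)
  next
    case (mult z k l m)
    from Units_m_closed[OF mult.IH elem[OF mult.hyps(2), of m]] show ?case
      by (simp only: mult_eq mult.hyps(4))
  qed
  moreover have "restr (ut_index n) y \<in> vecs (ut_index n)" for y by (simp add: restr_def vecs_def)
  ultimately have "carrier (UT_int n) \<subseteq> Units (UT_int n)" using ut_mat_surj by (metis subsetI)
  then show ?thesis by unfold_locales
qed

theorem UT_in_B_exp: "in_B (UT_int n) exp_fun"
proof -
  interpret group "UT_int n" by (rule ut_group)
  let ?G = "UT_int n" and ?I = "ut_index n"
  let ?A = "(\<lambda>(k, l). elem_mat n k l 1) ` ?I"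
  have mult_eq: "x \<otimes>\<^bsub>?G\<^esub> y = mat_mult n x y" for x y by (simp add: UT_int_def)
  have one: "\<one>\<^bsub>?G\<^esub> = ut_mat n (\<lambda>_. 0)" by (simp add: UT_int_def ut_mat_zero)
  have A: "?A \<subseteq> carrier ?G" using ut_mat_carrier by auto
  show ?thesis
  proof (rule in_B_exp_if_coordinates)
    show "finite ?A" "?A \<subseteq> carrier ?G" "finite ?I" using A finite_ut_index by simp_all
    show "vecs ?I \<subseteq> vecs ?I" "aut (\<lambda>z. z \<in> vecs ?I)" by (simp_all add: aut_vecs)
    show "bij_betw (ut_mat n) (vecs ?I) (carrier ?G)"
    proof (rule bij_betwI')
      fix y z assume yz: "y \<in> vecs ?I" "z \<in> vecs ?I"
      show "(ut_mat n y = ut_mat n z) = (y = z)"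
      proof
        assume eq: "ut_mat n y = ut_mat n z"
        show "y = z"
        proof
          fix p
          show "y p = z p"
          proof (cases "p \<in> ?I")
            case True
            then show ?thesis using fun_cong[OF fun_cong[OF eq, of "fst p"], of "snd p"] by (simp add: ut_mat_def)
          qed (use yz in \<open>cases p, simp add: vecs_def\<close>)
        qed
      qed simp
    next
      fix M assume "M \<in> carrier ?G"
      from ut_mat_surj[OF this] show "\<exists>z\<in>vecs ?I. M = ut_mat n z"
        by (rule bexI[where x = "restr ?I (\<lambda>(i, j). M i j)"]) (simp add: restr_def vecs_def)
    qed (rule ut_mat_carrier)
  next
    fix N assume N: "N \<in> carrier ?G"
    \<comment> \<open>The terms with \<open>k > i\<close> involve coordinates. The term
      \<open>k = i\<close> contains the diagonal entry 1 and contributes the constant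
      \<open>N i j\<close>; smaller \<open>k\<close> contribute nothing.\<close>
    define f where "f = (\<lambda>(i, j) z. \<Sum>k\<in>{i<..<n}. N k j * z (i, k :: nat))"
    have entry: "mat_mult n (ut_mat n z) N i j = f (i, j) z + N i j" if "(i, j) \<in> ?I" for z i j
    proof -
      have ij: "i < j" "j < n" using that by (simp_all add: ut_index_def)
      have "mat_mult n (ut_mat n z) N i j = (\<Sum>k<n. (if k \<in> {i<..<n} then N k j * z (i, k) else 0) + id_mat n i k * N k j)"
        unfolding mat_mult_def by (intro sum.cong) (auto simp: ut_mat_def ut_index_def id_mat_def)
      also have "\<dots> = (\<Sum>k<n. if k \<in> {i<..<n} then N k j * z (i, k) else 0) + N i j"
        using ij by (simp only: sum.distrib sum_id_left)
      also have "(\<Sum>k<n. if k \<in> {i<..<n} then N k j * z (i, k) else 0) = f (i, j) z"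
        unfolding f_def prod.case by (subst sum.inter_restrict[symmetric]) (auto intro!: sum.cong)
      finally show ?thesis .
    qed
    have lin: "lin (f p)" for p
      unfolding f_def case_prod_beta by (intro lin_sum lin_cmult lin_var)
    have "(p \<circ> Inl \<in> vecs ?I \<and> p \<circ> Inr \<in> vecs ?I \<and> ut_mat n (p \<circ> Inr) = ut_mat n (p \<circ> Inl) \<otimes>\<^bsub>?G\<^esub> N) =
      (p \<circ> Inl \<in> vecs ?I \<and> p \<circ> Inr \<in> vecs ?I \<and> (\<forall>q\<in>?I. p (Inr q) = f q (p \<circ> Inl) + (\<lambda>(i, j). N i j) q))" for p
    proof -
      have "ut_mat n (p \<circ> Inr) = mat_mult n (ut_mat n (p \<circ> Inl)) N \<longleftrightarrow>
        (\<forall>i j. (i, j) \<in> ?I \<longrightarrow> ut_mat n (p \<circ> Inr) i j = mat_mult n (ut_mat n (p \<circ> Inl)) N i j)"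
        using ut_eqI[OF ut_mat_carrier ut_mult_closed[OF ut_mat_carrier N]] by auto
      also have "\<dots> \<longleftrightarrow> (\<forall>i j. (i, j) \<in> ?I \<longrightarrow> p (Inr (i, j)) = f (i, j) (p \<circ> Inl) + N i j)"
        using entry by (simp add: ut_mat_def)
      finally show ?thesis unfolding mult_eq by (auto simp: Ball_def)
    qed
    then show "aut (\<lambda>p. p \<circ> Inl \<in> vecs ?I \<and> p \<circ> Inr \<in> vecs ?I \<and> ut_mat n (p \<circ> Inr) = ut_mat n (p \<circ> Inl) \<otimes>\<^bsub>?G\<^esub> N)"
      using aut_affine_graph[OF finite_ut_index lin] by simp
  next
    fix z assume "z \<in> vecs ?I"
    \<comment> \<open>Each step of the induction turns one zero entry into \<open>m\<close> at the
      cost of a factor of length at most the absolute value of \<open>m\<close>, so the costs add up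
      to the sum over all entries.\<close>
    then have "reachable ?G ?A (\<Sum>i\<in>?I. nat \<bar>z i\<bar>) (ut_mat n z)"
    proof (induction rule: ut_mat_induct)
      case zero
      then show ?case using reachable_one by (simp add: one)
    next
      case (mult z k l m)
      have "elem_mat n k l 1 \<in> ?A" using mult.hyps(2) by (rule rev_image_eqI) simp
      then have "reachable ?G ?A (nat \<bar>m\<bar>) (elem_mat n k l m)"
        by (intro reachable_additive[OF A, of "\<lambda>m. elem_mat n k l m"] ut_mat_carrier)
          (simp_all only: mult_eq elem_mat_add[OF mult.hyps(2)])
      from reachable_mult[OF A mult.IH this]
      have "reachable ?G ?A ((\<Sum>i\<in>?I. nat \<bar>z i\<bar>) + nat \<bar>m\<bar>) (ut_mat n (z((k, l) := m)))"
        by (simp only: mult_eq mult.hyps(4))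
      moreover have "(\<Sum>i\<in>?I. nat \<bar>(z((k, l) := m)) i\<bar>) = (\<Sum>i\<in>?I. nat \<bar>z i\<bar>) + nat \<bar>m\<bar>"
      proof -
        have "(\<Sum>i\<in>?I - {(k, l)}. nat \<bar>(z((k, l) := m)) i\<bar>) = (\<Sum>i\<in>?I - {(k, l)}. nat \<bar>z i\<bar>)"
          by (rule sum.cong) simp_all
        then show ?thesis
          using mult.hyps(3) by (simp add: sum.remove[OF finite_ut_index mult.hyps(2)] del: fun_upd_apply) simp
      qed
      ultimately show ?case by (simp only:)
    qed
    then show "reachable ?G ?A (1 * (1 + (\<Sum>i\<in>?I. nat \<bar>z i\<bar>))) (ut_mat n z)"
      by (rule reachable_mono) simp_all
  qed
qed

section \<open>Torus bundles\<close>

lemma mat_vec_mult: "mat_vec n (mat_mult n A B) v = mat_vec n A (mat_vec n B v)"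
proof
  fix i
  have "(\<Sum>j<n. (\<Sum>k<n. A i k * B k j) * v j) = (\<Sum>j<n. \<Sum>k<n. A i k * B k j * v j)"
    by (simp add: sum_distrib_right)
  also have "\<dots> = (\<Sum>k<n. \<Sum>j<n. A i k * B k j * v j)" by (rule sum.swap)
  also have "\<dots> = (\<Sum>k<n. A i k * (\<Sum>j<n. B k j * v j))" by (simp add: sum_distrib_left mult.assoc)
  finally show "mat_vec n (mat_mult n A B) v i = mat_vec n A (mat_vec n B v) i"
    by (simp add: mat_vec_def mat_mult_def)
qed

lemma mat_vec_id: "v \<in> vecs {..<n} \<Longrightarrow> mat_vec n (id_mat n) v = v"
  by (rule ext) (simp add: mat_vec_def sum_id_left vecs_def)

lemma mat_vec_vecs: "mat_vec n A v \<in> vecs {..<n}"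
  by (simp add: mat_vec_def vecs_def)

lemma mat_vec_add: "mat_vec n A (\<lambda>i. v i + w i) = (\<lambda>i. mat_vec n A v i + mat_vec n A w i)"
  by (rule ext) (simp add: mat_vec_def distrib_left sum.distrib)

locale torus_bundle =
  fixes n :: nat and M :: "nat \<Rightarrow> nat \<Rightarrow> int"
  assumes GL: "GL_int n M"
begin

abbreviation V :: "(nat \<Rightarrow> int) set" where "V \<equiv> vecs {..<n}"
abbreviation act :: "int \<Rightarrow> (nat \<Rightarrow> int) \<Rightarrow> nat \<Rightarrow> int" where "act \<equiv> mat_pow_act n M"
abbreviation G :: "((nat \<Rightarrow> int) \<times> int) monoid" where "G \<equiv> semidirect_ZnZ n M"

lemma inv_mat: "mat_mult n M (inv_mat n M) = id_mat n" "mat_mult n (inv_mat n M) M = id_mat n"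
proof -
  have "\<exists>N. is_nmat n N \<and> mat_mult n M N = id_mat n \<and> mat_mult n N M = id_mat n"
    using GL unfolding GL_int_def by (rule conjunct2)
  from someI_ex[OF this]
  have "is_nmat n (inv_mat n M) \<and> mat_mult n M (inv_mat n M) = id_mat n \<and> mat_mult n (inv_mat n M) M = id_mat n"
    unfolding inv_mat_def .
  then show "mat_mult n M (inv_mat n M) = id_mat n" "mat_mult n (inv_mat n M) M = id_mat n" by simp_all
qed

lemma mat_vec_inv:
  assumes "v \<in> V"
  shows "mat_vec n M (mat_vec n (inv_mat n M) v) = v" "mat_vec n (inv_mat n M) (mat_vec n M v) = v"
  using mat_vec_mult[of n M "inv_mat n M" v] mat_vec_mult[of n "inv_mat n M" M v] mat_vec_id[OF assms]
  by (simp_all add: inv_mat)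

lemma act_vecs: assumes "v \<in> V" shows "act k v \<in> V"
proof -
  have "(mat_vec n A ^^ m) v \<in> V" for A m
    by (induction m) (simp_all add: assms mat_vec_vecs)
  then show ?thesis by (simp add: mat_pow_act_def)
qed

lemma act_add: "act k (\<lambda>i. v i + w i) = (\<lambda>i. act k v i + act k w i)"
proof -
  have "(mat_vec n A ^^ m) (\<lambda>i. v i + w i) = (\<lambda>i. (mat_vec n A ^^ m) v i + (mat_vec n A ^^ m) w i)" for A m
    by (induction m) (simp_all add: mat_vec_add)
  then show ?thesis by (simp add: mat_pow_act_def)
qed

lemma act_0: "act 0 v = v"
  by (simp add: mat_pow_act_def)

text \<open>\<open>mat_pow_act\<close> is defined by cases on the sign of \<open>k\<close>. This
  recursion passes through zero uniformly, and the exponent law is derived from it by induction in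
  both directions.\<close>

lemma act_Suc:
  assumes v: "v \<in> V" shows "act (k + 1) v = mat_vec n M (act k v)"
proof (cases "0 \<le> k")
  case True
  then have "nat (k + 1) = Suc (nat k)" by linarith
  with True show ?thesis by (simp add: mat_pow_act_def)
next
  case False
  \<comment> \<open>For negative \<open>k\<close> the inverse acts \<open>m + 1\<close> times at
    \<open>k\<close> and \<open>m\<close> times at \<open>k + 1\<close>.\<close>
  define m where "m = nat (- k - 1)"
  have k: "nat (- k) = Suc m" "nat (- (k + 1)) = m" using False by (simp_all add: m_def)
  let ?w = "(mat_vec n (inv_mat n M) ^^ m) v"
  have "act (k + 1) v = ?w"
  \<comment> \<open>At \<open>k = - 1\<close> the exponent \<open>k + 1\<close> falls into the
    nonnegative branch of the definition; both sides are then \<open>v\<close>.\<close>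
  proof (cases "k = - 1")
    case True
    then show ?thesis by (simp add: m_def mat_pow_act_def)
  next
    case False
    with \<open>\<not> 0 \<le> k\<close> have "\<not> 0 \<le> k + 1" by linarith
    then show ?thesis by (simp only: mat_pow_act_def if_False k)
  qed
  moreover have "act k v = mat_vec n (inv_mat n M) ?w" using False by (simp add: mat_pow_act_def k)
  moreover have "?w \<in> V" by (induction m) (simp_all add: v mat_vec_vecs)
  ultimately show ?thesis by (simp add: mat_vec_inv)
qed

lemma act_pred:
  assumes v: "v \<in> V" shows "act (k - 1) v = mat_vec n (inv_mat n M) (act k v)"
  using act_Suc[OF v, of "k - 1"] mat_vec_inv(2)[OF act_vecs[OF v], of "k - 1"] by simp

lemma act_act:
  assumes v: "v \<in> V" shows "act k (act l v) = act (k + l) v"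
proof (induction k rule: int_induct[where k = 0])
  case base
  then show ?case by (simp add: act_0)
next
  case (step1 k)
  have e: "k + 1 + l = k + l + 1" by simp
  show ?case unfolding e act_Suc[OF act_vecs[OF v]] act_Suc[OF v] step1(2) ..
next
  case (step2 k)
  have e: "k - 1 + l = k + l - 1" by simp
  show ?case unfolding e act_pred[OF act_vecs[OF v]] act_pred[OF v] step2(2) ..
qed

lemma act_zero: "act k (\<lambda>_. 0) = (\<lambda>_. 0)"
proof
  fix i
  have "act k (\<lambda>i. 0 + 0) i = act k (\<lambda>_. 0) i + act k (\<lambda>_. 0) i" by (subst act_add) simp
  then show "act k (\<lambda>_. 0) i = 0" by simp
qed

lemma G_carrier: "(v, k) \<in> carrier G \<longleftrightarrow> v \<in> V"
  by (auto simp: semidirect_ZnZ_def vecs_def)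

lemma G_mult: "(v, k) \<otimes>\<^bsub>G\<^esub> (w, l) = (\<lambda>i. v i + act k w i, k + l)"
  by (simp add: semidirect_ZnZ_def)

lemma G_one: "\<one>\<^bsub>G\<^esub> = (\<lambda>_. 0, 0)"
  by (simp add: semidirect_ZnZ_def)

lemma vecs_add: "v \<in> V \<Longrightarrow> w \<in> V \<Longrightarrow> (\<lambda>i. v i + w i) \<in> V"
  by (simp add: vecs_def)

lemma G_group: "group G"
proof (rule groupI)
  fix x y z assume xyz: "x \<in> carrier G" "y \<in> carrier G" "z \<in> carrier G"
  obtain u k v l w m where e: "x = (u, k)" "y = (v, l)" "z = (w, m)" by (cases x; cases y; cases z)
  then have V: "u \<in> V" "v \<in> V" "w \<in> V" using xyz by (simp_all add: G_carrier)
  show "x \<otimes>\<^bsub>G\<^esub> y \<in> carrier G" using V by (simp add: e G_carrier G_mult vecs_add act_vecs)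
  show "x \<otimes>\<^bsub>G\<^esub> y \<otimes>\<^bsub>G\<^esub> z = x \<otimes>\<^bsub>G\<^esub> (y \<otimes>\<^bsub>G\<^esub> z)"
    using V by (simp add: e G_mult act_add act_act add.assoc)
next
  show "\<one>\<^bsub>G\<^esub> \<in> carrier G" by (simp add: G_one G_carrier vecs_def)
next
  fix x assume x: "x \<in> carrier G"
  obtain v k where e: "x = (v, k)" by (cases x)
  with x have v: "v \<in> V" by (simp add: G_carrier)
  show "\<one>\<^bsub>G\<^esub> \<otimes>\<^bsub>G\<^esub> x = x" by (simp add: e G_one G_mult act_0)
  show "\<exists>y\<in>carrier G. y \<otimes>\<^bsub>G\<^esub> x = \<one>\<^bsub>G\<^esub>"
  proof
    have "(\<lambda>i. - v i) \<in> V" using v by (simp add: vecs_def)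
    then show "(act (- k) (\<lambda>i. - v i), - k) \<in> carrier G" by (simp add: G_carrier act_vecs)
    have "(\<lambda>i. act (- k) (\<lambda>i. - v i) i + act (- k) v i) = (\<lambda>_. 0)"
      using act_add[of "- k" "\<lambda>i. - v i" v] by (simp add: act_zero)
    then show "(act (- k) (\<lambda>i. - v i), - k) \<otimes>\<^bsub>G\<^esub> x = \<one>\<^bsub>G\<^esub>" by (simp add: e G_mult G_one)
  qed
qed

text \<open>This is \<open>t^k v\<close>, the product of \<open>(0, k)\<close> and
  \<open>(v, 0)\<close>, with \<open>v\<close> stored at the indices below \<open>n\<close> and
  \<open>k\<close> at index \<open>n\<close>.\<close>

definition coord :: "(nat \<Rightarrow> int) \<Rightarrow> (nat \<Rightarrow> int) \<times> int" where
  "coord z = (act (z n) (restr {..<n} z), z n)"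

lemma restr_vecs: "restr {..<n} z \<in> V"
  by (simp add: restr_def vecs_def)

lemma act_inj:
  assumes "v \<in> V" "w \<in> V" "act k v = act k w"
  shows "v = w"
proof -
  have "act (- k) (act k v) = act (- k) (act k w)" unfolding assms(3) ..
  then show ?thesis by (simp add: act_act[OF assms(1)] act_act[OF assms(2)] act_0)
qed

lemma coord_bij: "bij_betw coord (vecs {..n}) (carrier G)"
proof (rule bij_betwI')
  fix y z assume yz: "y \<in> vecs {..n}" "z \<in> vecs {..n}"
  show "(coord y = coord z) = (y = z)"
  proof
    assume "coord y = coord z"
    then have "y n = z n" "restr {..<n} y = restr {..<n} z"
      using act_inj[OF restr_vecs restr_vecs] by (auto simp: coord_def)
    show "y = z"
    proof
      fix i
      consider "i < n" | "i = n" | "n < i" by linarith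
      then show "y i = z i"
      proof cases
        case 1
        then show ?thesis using fun_cong[OF \<open>restr {..<n} y = restr {..<n} z\<close>, of i] by (simp add: restr_def)
      next
        case 3
        then show ?thesis using yz by (simp add: vecs_def)
      qed (simp add: \<open>y n = z n\<close>)
    qed
  qed simp
next
  fix z show "coord z \<in> carrier G" by (simp add: coord_def G_carrier act_vecs restr_vecs)
next
  fix g assume g: "g \<in> carrier G"
  obtain v k where e: "g = (v, k)" by (cases g)
  with g have v: "v \<in> V" by (simp add: G_carrier)
  define z where "z = (act (- k) v)(n := k)"
  have "restr {..<n} z = act (- k) v"
    using act_vecs[OF v, of "- k"] by (auto simp: restr_def z_def vecs_def fun_eq_iff)
  then have "coord z = g" using v by (simp add: coord_def z_def e act_act act_0)
  moreover have "z \<in> vecs {..n}" using act_vecs[OF v, of "- k"] by (auto simp: z_def vecs_def)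
  ultimately show "\<exists>z\<in>vecs {..n}. g = coord z" by blast
qed

theorem in_B_exp: "in_B G exp_fun"
proof -
  interpret group G by (rule G_group)
  define unit where "unit = (\<lambda>(i :: nat) (x :: int). (\<lambda>_. 0)(i := x))"
  let ?A = "insert (\<lambda>_. 0, 1) ((\<lambda>i. (unit i 1, 0)) ` {..<n})"
  have unit: "unit i x \<in> V" if "i < n" for i x using that by (simp add: unit_def vecs_def)
  have A: "?A \<subseteq> carrier G" using unit by (auto simp: G_carrier vecs_def)
  show ?thesis
  proof (rule in_B_exp_if_coordinates)
    show "finite ?A" "?A \<subseteq> carrier G" "finite {..n}" by (simp, rule A, simp)
    show "vecs {..n} \<subseteq> vecs {..n}" "aut (\<lambda>z. z \<in> vecs {..n})" by (simp_all add: aut_vecs)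
    show "bij_betw coord (vecs {..n}) (carrier G)" by (rule coord_bij)
  next
    fix g assume g: "g \<in> carrier G"
    obtain w l where e: "g = (w, l)" by (cases g)
    with g have w: "w \<in> V" by (simp add: G_carrier)
    \<comment> \<open>\<open>f\<close> and \<open>c\<close> are the linear and the constant part of
      the map from \<open>(v, k)\<close> to \<open>(A^(-l) (v + w), k + l)\<close>.\<close>
    define f where "f = (\<lambda>i z. if i < n then act (- l) (restr {..<n} z) i else z n)"
    define c where "c = (\<lambda>i. if i < n then act (- l) w i else l)"
    have lin: "lin (f i)" for i
    proof (cases "i < n")
      case True
      show ?thesis
      proof (rule lin_if_additive[of "{..<n}"])
        fix y z
        have "restr {..<n} (\<lambda>i. y i + z i) = (\<lambda>i. restr {..<n} y i + restr {..<n} z i)"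
          by (simp add: restr_def fun_eq_iff)
        then show "f i (\<lambda>i. y i + z i) = f i y + f i z" using True by (simp add: f_def act_add)
      next
        fix z
        have "restr {..<n} (restr {..<n} z) = restr {..<n} z" by (simp add: restr_def fun_eq_iff)
        then show "f i z = f i (restr {..<n} z)" using True by (simp add: f_def)
      qed simp
    next
      case False
      then have "f i = (\<lambda>z. z n)" by (simp add: f_def fun_eq_iff)
      then show ?thesis by (simp add: lin_var)
    qed
    \<comment> \<open>The vector parts give \<open>A^(k + l) v' = A^k (v + w)\<close>. Cancelling
      the variable power \<open>A^k\<close> leaves only the constant power \<open>A^l\<close>, which
      is moved to the other side.\<close>
    have key: "coord z = coord y \<otimes>\<^bsub>G\<^esub> g \<longleftrightarrow> (\<forall>i\<in>{..n}. z i = f i y + c i)" for y z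
    proof -
      let ?y = "restr {..<n} y" and ?z = "restr {..<n} z"
      let ?s = "\<lambda>i. ?y i + w i"
      have s: "?s \<in> V" by (rule vecs_add[OF restr_vecs w])
      have "coord z = coord y \<otimes>\<^bsub>G\<^esub> g \<longleftrightarrow> z n = y n + l \<and> act (y n) (act l ?z) = act (y n) ?s"
        by (auto simp: coord_def e G_mult act_add act_act[OF restr_vecs])
      also have "act (y n) (act l ?z) = act (y n) ?s \<longleftrightarrow> act l ?z = ?s"
        using act_inj[OF act_vecs[OF restr_vecs] s, of "y n" l z] by auto
      also have "act l ?z = ?s \<longleftrightarrow> ?z = act (- l) ?s"
      proof
        assume "act l ?z = ?s"
        then have "act (- l) (act l ?z) = act (- l) ?s" by simp
        then show "?z = act (- l) ?s" by (simp add: act_act[OF restr_vecs] act_0)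
      next
        assume "?z = act (- l) ?s"
        then have "act l ?z = act l (act (- l) ?s)" by simp
        then show "act l ?z = ?s" by (simp add: act_act[OF s] act_0)
      qed
      also have "?z = act (- l) ?s \<longleftrightarrow> (\<forall>i<n. z i = act (- l) ?y i + act (- l) w i)"
        unfolding act_add using act_vecs[OF restr_vecs[of y], of "- l"] act_vecs[OF w, of "- l"]
        by (auto simp: fun_eq_iff restr_def[of _ z] vecs_def)
      finally show ?thesis by (auto simp: f_def c_def le_less)
    qed
    have "aut (\<lambda>p. p \<circ> Inl \<in> vecs {..n} \<and> p \<circ> Inr \<in> vecs {..n} \<and> (\<forall>i\<in>{..n}. p (Inr i) = f i (p \<circ> Inl) + c i))"
      by (rule aut_affine_graph[OF _ lin]) simp
    then show "aut (\<lambda>p. p \<circ> Inl \<in> vecs {..n} \<and> p \<circ> Inr \<in> vecs {..n} \<and> coord (p \<circ> Inr) = coord (p \<circ> Inl) \<otimes>\<^bsub>G\<^esub> g)"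
      unfolding key by simp
  next
    fix z assume "z \<in> vecs {..n}"
    \<comment> \<open>The index set is generalized so that the vector can be assembled one
      coordinate at a time; with exponent 0 the action is trivial and the product is vector
      addition.\<close>
    have "reachable G ?A (\<Sum>i\<in>J. nat \<bar>v i\<bar>) (restr J v, 0)" if "finite J" "J \<subseteq> {..<n}" for J v
      using that
    proof (induction J rule: finite_induct)
      case empty
      then show ?case using reachable_one by (simp add: restr_def G_one)
    next
      case (insert i J)
      then have i: "i < n" by simp
      have "reachable G ?A (nat \<bar>v i\<bar>) (unit i (v i), 0)"
      proof (rule reachable_additive[OF A, of "\<lambda>x. (unit i x, 0)"])
        show "(unit i 1, 0) \<in> ?A" using i by simp
        show "(unit i x, 0) \<in> carrier G" for x using unit[OF i] by (simp add: G_carrier)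
        show "(unit i (x + y), 0) = (unit i x, 0) \<otimes>\<^bsub>G\<^esub> (unit i y, 0)" for x y
          by (auto simp: G_mult act_0 unit_def)
      qed
      from reachable_mult[OF A this] insert
      have "reachable G ?A (nat \<bar>v i\<bar> + (\<Sum>i\<in>J. nat \<bar>v i\<bar>)) ((unit i (v i), 0) \<otimes>\<^bsub>G\<^esub> (restr J v, 0))" by simp
      moreover have "(unit i (v i), 0) \<otimes>\<^bsub>G\<^esub> (restr J v, 0) = (restr (insert i J) v, 0)"
        using insert.hyps(2) by (auto simp: G_mult act_0 unit_def restr_def)
      ultimately show ?case using insert.hyps by simp
    qed
    from this[of "{..<n}" z] have 1: "reachable G ?A (\<Sum>i<n. nat \<bar>z i\<bar>) (restr {..<n} z, 0)" by simp
    have 2: "reachable G ?A (nat \<bar>z n\<bar>) (\<lambda>_. 0, z n)"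
      by (rule reachable_additive[OF A, of "\<lambda>x. (\<lambda>_. 0, x)"]) (simp_all add: G_carrier vecs_def G_mult act_zero)
    have "coord z = (\<lambda>_. 0, z n) \<otimes>\<^bsub>G\<^esub> (restr {..<n} z, 0)" by (simp add: coord_def G_mult)
    with reachable_mult[OF A 2 1] have "reachable G ?A (nat \<bar>z n\<bar> + (\<Sum>i<n. nat \<bar>z i\<bar>)) (coord z)" by simp
    then show "reachable G ?A (1 * (1 + (\<Sum>i\<in>{..n}. nat \<bar>z i\<bar>))) (coord z)"
      by (rule reachable_mono) (simp_all add: lessThan_Suc_atMost[symmetric])
  qed
qed

end

section \<open>Subgroups of free abelian groups\<close>

definition lattice :: "'i set \<Rightarrow> ('i \<Rightarrow> int) set \<Rightarrow> bool" where
  "lattice I H \<longleftrightarrow> H \<subseteq> vecs I \<and> (\<lambda>_. 0) \<in> H \<and> (\<forall>x\<in>H. \<forall>y\<in>H. (\<lambda>i. x i - y i) \<in> H)"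

lemma lattice_vecs: "lattice I H \<Longrightarrow> x \<in> H \<Longrightarrow> x \<in> vecs I"
  unfolding lattice_def by (meson subsetD)

lemma lattice_zero: "lattice I H \<Longrightarrow> (\<lambda>_. 0) \<in> H"
  unfolding lattice_def by (elim conjE)

lemma lattice_diff: "lattice I H \<Longrightarrow> x \<in> H \<Longrightarrow> y \<in> H \<Longrightarrow> (\<lambda>i. x i - y i) \<in> H"
  unfolding lattice_def by (elim conjE) (drule bspec, assumption, erule bspec)

lemma lattice_add: assumes "lattice I H" "x \<in> H" "y \<in> H" shows "(\<lambda>i. x i + y i) \<in> H"
  using lattice_diff[OF assms(1,2) lattice_diff[OF assms(1) lattice_zero[OF assms(1)] assms(3)]] by simp

lemma lattice_cmult: assumes "lattice I H" "x \<in> H" shows "(\<lambda>i. q * x i) \<in> H"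
proof (induction q rule: int_induct[where k = 0])
  case base
  then show ?case using lattice_zero[OF assms(1)] by simp
next
  case (step1 q)
  show ?case using lattice_add[OF assms(1) step1(2) assms(2)] by (simp add: distrib_right)
next
  case (step2 q)
  show ?case using lattice_diff[OF assms(1) step2(2) assms(2)] by (simp add: left_diff_distrib)
qed

text \<open>The coordinates \<open>x k\<close> of the elements of \<open>H\<close> form an ideal of
  the integers with generator \<open>l\<close>, and \<open>h\<close> is a preimage of
  \<open>l\<close>. The kernel of the projection lives on one index less, which drives the
  inductions on \<open>I\<close>.\<close>

lemma lattice_split:
  assumes H: "lattice (insert k I) H"
  obtains l h where "0 \<le> l" "h \<in> H" "h k = l" "\<And>x. x \<in> H \<Longrightarrow> l dvd x k" "lattice I {x \<in> H. x k = 0}"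
proof -
  have sub: "lattice I {x \<in> H. x k = 0}"
    unfolding lattice_def
  proof (intro conjI subsetI ballI CollectI)
    fix x assume "x \<in> {x \<in> H. x k = 0}"
    then show "x \<in> vecs I" using lattice_vecs[OF H, of x] by (auto simp: vecs_def)
  next
    fix x y assume "x \<in> {x \<in> H. x k = 0}" "y \<in> {x \<in> H. x k = 0}"
    then show "(\<lambda>i. x i - y i) \<in> H" "x k - y k = 0" using lattice_diff[OF H, of x y] by simp_all
  qed (simp_all add: lattice_zero[OF H])
  show thesis
  proof (cases "\<exists>n :: nat. 0 < n \<and> (\<exists>x\<in>H. x k = int n)")
    case False
    have "x k = 0" if x: "x \<in> H" for x
    proof (rule ccontr)
      assume "x k \<noteq> 0"
      then consider "0 < x k" | "0 < - x k" by linarith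
      then show False
      proof cases
        case 1
        then have "0 < nat (x k)" "x k = int (nat (x k))" by simp_all
        then show False using False x by metis
      next
        case 2
        then have "0 < nat (- x k)" "- x k = int (nat (- x k))" by simp_all
        moreover have "(\<lambda>i. - x i) \<in> H" using lattice_cmult[OF H x, of "- 1"] by simp
        ultimately show False using False by metis
      qed
    qed
    then show thesis using that[of 0 "\<lambda>_. 0"] lattice_zero[OF H] sub by simp
  next
    case True
    define m where "m = (LEAST n :: nat. 0 < n \<and> (\<exists>x\<in>H. x k = int n))"
    have m: "0 < m \<and> (\<exists>x\<in>H. x k = int m)" unfolding m_def by (rule LeastI_ex[OF True])
    then obtain h where h: "h \<in> H" "h k = int m" by (elim conjE bexE)
    have "int m dvd x k" if x: "x \<in> H" for x
    proof (rule ccontr)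
      assume "\<not> int m dvd x k"
      then have "x k mod int m \<noteq> 0" using mod_0_imp_dvd by blast
      moreover have "0 \<le> x k mod int m" using m by simp
      ultimately have pos: "0 < x k mod int m" by linarith
      have "x k mod int m < int m" using m by simp
      with pos have r: "0 < nat (x k mod int m)" "nat (x k mod int m) < m" by linarith+
      \<comment> \<open>Euclidean division: the remainder is again a coordinate of an element of
        \<open>H\<close>, against the minimality of \<open>m\<close>.\<close>
      have y: "(\<lambda>i. x i - (x k div int m) * h i) \<in> H" by (rule lattice_diff[OF H x lattice_cmult[OF H h(1)]])
      have "x k - (x k div int m) * h k = int (nat (x k mod int m))"
        using pos by (simp add: h(2) minus_div_mult_eq_mod)
      with y have "\<exists>y\<in>H. y k = int (nat (x k mod int m))" 
        by (rule bexI[where x = "\<lambda>i. x i - (x k div int m) * h i", rotated])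
      with r(1) have "m \<le> nat (x k mod int m)" unfolding m_def by (intro Least_le conjI)
      with r(2) show False by simp
    qed
    with h show thesis using that[of "int m" h] sub by simp
  qed
qed

text \<open>Membership is expressed by a chain of existential quantifiers over multipliers
  \<open>q\<close>, one per index: subtracting \<open>q\<close> times \<open>h\<close> must clear
  coordinate \<open>k\<close> and leave an element of the kernel.\<close>

lemma aut_lattice: "finite I \<Longrightarrow> lattice I H \<Longrightarrow> aut (\<lambda>z. z \<in> H)"
proof (induction I arbitrary: H rule: finite_induct)
  case empty
  have "H = vecs {}"
  proof (rule equalityI)
    show "H \<subseteq> vecs {}" using lattice_vecs[OF empty] by (rule subsetI)
    show "vecs {} \<subseteq> H"
    proof
      fix x :: "'a \<Rightarrow> int" assume "x \<in> vecs {}"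
      then have "x = (\<lambda>_. 0)" by (simp add: vecs_def fun_eq_iff)
      then show "x \<in> H" using lattice_zero[OF empty] by simp
    qed
  qed
  then show ?case by (simp add: aut_vecs)
next
  case (insert k I)
  note H = insert.prems
  obtain l h where lh: "0 \<le> l" "h \<in> H" "h k = l" "\<And>x. x \<in> H \<Longrightarrow> l dvd x k" "lattice I {x \<in> H. x k = 0}"
    using lattice_split[OF H] by metis
  \<comment> \<open>This is \<open>z - q h\<close> with coordinate \<open>k\<close> set to 0, the
    shape that \<open>aut_affine_subst\<close> accepts. The equation \<open>z k = l * q\<close>
    ensures that nothing is lost.\<close>
  let ?v = "\<lambda>q z i. if i \<in> I then z i - h i * q else 0"
  have char: "z \<in> H \<longleftrightarrow> z \<in> vecs (insert k I) \<and> (\<exists>q. z k - l * q = 0 \<and> ?v q z \<in> {x \<in> H. x k = 0})" for z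
  proof
    assume z: "z \<in> H"
    obtain q where q: "z k = l * q" using lh(4)[OF z] by (elim dvdE)
    have zv: "z \<in> vecs (insert k I)" by (rule lattice_vecs[OF H z])
    have "?v q z i = z i - q * h i" for i
      using zv lattice_vecs[OF H lh(2)] insert.hyps(2) q lh(3) by (cases "i = k") (simp_all add: vecs_def)
    then have "?v q z = (\<lambda>i. z i - q * h i)" by (rule ext)
    then have "?v q z \<in> H" using lattice_diff[OF H z lattice_cmult[OF H lh(2)], of q] by simp
    then have "z k - l * q = 0 \<and> ?v q z \<in> {x \<in> H. x k = 0}" using q insert.hyps(2) by simp
    then show "z \<in> vecs (insert k I) \<and> (\<exists>q. z k - l * q = 0 \<and> ?v q z \<in> {x \<in> H. x k = 0})"
      by (rule conjI[OF zv exI[of _ q]])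
  next
    assume "z \<in> vecs (insert k I) \<and> (\<exists>q. z k - l * q = 0 \<and> ?v q z \<in> {x \<in> H. x k = 0})"
    then obtain q where q: "z \<in> vecs (insert k I)" "z k - l * q = 0" "?v q z \<in> H" by (elim conjE exE CollectE)
    have "?v q z i + q * h i = z i" for i
      using q(1,2) lattice_vecs[OF H lh(2)] insert.hyps(2) lh(3) by (cases "i = k") (simp_all add: vecs_def)
    then have "(\<lambda>i. ?v q z i + q * h i) = z" by (rule ext)
    then show "z \<in> H" using lattice_add[OF H q(3) lattice_cmult[OF H lh(2)], of q] by simp
  qed
  have 1: "aut (\<lambda>w :: 'a option \<Rightarrow> int. w (Some k) - l * w None = 0)"
    using aut_lin_eq[OF lin_diff[OF lin_var lin_cmult[OF lin_var]], of "Some k" l None 0] by simp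
  have 2: "aut (\<lambda>w :: 'a option \<Rightarrow> int. ?v (w None) (\<lambda>i. w (Some i)) \<in> {x \<in> H. x k = 0})"
  proof -
    have "aut (\<lambda>w :: 'a option \<Rightarrow> int.
        (\<lambda>i. if i \<in> I then (w (Some i) - h i * w None) + 0 else 0) \<in> {x \<in> H. x k = 0})"
      by (rule aut_affine_subst[OF insert.IH[OF lh(5)] insert.hyps(1), where e = "\<lambda>_. 0"])
        (intro lin_diff lin_cmult lin_var)
    then show ?thesis by (simp only: add_0_right)
  qed
  have "aut (\<lambda>z. z \<in> vecs (insert k I) \<and> (\<exists>q. z k - l * q = 0 \<and> ?v q z \<in> {x \<in> H. x k = 0}))"
    using aut_conj[OF aut_vecs aut_ex[OF aut_conj[OF 1 2]], of "insert k I"] by (simp only: option.case)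
  then show ?case by (rule back_subst[of aut]) (rule ext, rule char[symmetric])
qed

text \<open>\<open>l i = 0\<close> marks a coordinate that is left unbounded.\<close>

definition box :: "'i set \<Rightarrow> ('i \<Rightarrow> int) \<Rightarrow> ('i \<Rightarrow> int) set" where
  "box I l = {z \<in> vecs I. \<forall>i\<in>I. l i \<noteq> 0 \<longrightarrow> 0 \<le> z i \<and> z i < l i}"

lemma aut_box: assumes "finite I" shows "aut (\<lambda>z. z \<in> box I l)"
proof -
  have "aut (\<lambda>z. l i \<noteq> 0 \<longrightarrow> 0 \<le> z i \<and> z i < l i)" for i
  proof (cases "l i = 0")
    case False
    have "aut (\<lambda>z. 0 \<le> z i + 0 \<and> 0 \<le> -1 * z i + (l i - 1))"
      by (intro aut_conj aut_lin_nonneg lin_cmult lin_var)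
    moreover have "(0 \<le> x + 0 \<and> 0 \<le> -1 * x + (l i - 1)) = (l i \<noteq> 0 \<longrightarrow> 0 \<le> x \<and> x < l i)" for x
      using False by auto
    ultimately show ?thesis by simp
  qed (simp add: aut_const)
  then have "aut (\<lambda>z. z \<in> vecs I \<and> (\<forall>i\<in>I. l i \<noteq> 0 \<longrightarrow> 0 \<le> z i \<and> z i < l i))"
    by (intro aut_conj aut_ball aut_vecs assms)
  then show ?thesis by (simp add: box_def)
qed

definition transversal :: "'i set \<Rightarrow> ('i \<Rightarrow> int) set \<Rightarrow> ('i \<Rightarrow> int) set \<Rightarrow> bool" where
  "transversal I H B \<longleftrightarrow> (\<forall>z\<in>vecs I. \<exists>x\<in>B. (\<lambda>i. z i - x i) \<in> H)
     \<and> (\<forall>x\<in>B. \<forall>y\<in>B. (\<lambda>i. x i - y i) \<in> H \<longrightarrow> x = y)"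

lemma transversalI:
  assumes "\<And>z. z \<in> vecs I \<Longrightarrow> \<exists>x\<in>B. (\<lambda>i. z i - x i) \<in> H"
    and "\<And>x y. x \<in> B \<Longrightarrow> y \<in> B \<Longrightarrow> (\<lambda>i. x i - y i) \<in> H \<Longrightarrow> x = y"
  shows "transversal I H B"
  unfolding transversal_def using assms by (intro conjI ballI impI)

lemma transversalE:
  assumes "transversal I H B" "z \<in> vecs I"
  obtains x where "x \<in> B" "(\<lambda>i. z i - x i) \<in> H"
proof -
  have "\<exists>x\<in>B. (\<lambda>i. z i - x i) \<in> H"
    using conjunct1[OF assms(1)[unfolded transversal_def]] assms(2) by (rule bspec)
  then show thesis using that by (elim bexE)
qed

lemma transversal_unique:
  assumes "transversal I H B" "x \<in> B" "y \<in> B" "(\<lambda>i. x i - y i) \<in> H"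
  shows "x = y"
  using bspec[OF bspec[OF conjunct2[OF assms(1)[unfolded transversal_def]] assms(2)] assms(3)] assms(4)
  by (rule mp)

text \<open>Reduction along a triangular basis, as in the Hermite normal form. A multiple of
  \<open>h\<close> brings coordinate \<open>k\<close> to its remainder modulo \<open>l\<close>; the
  other coordinates are then reduced by the kernel. Conversely, two numbers in \<open>[0, l)\<close>
  that are congruent modulo \<open>l\<close> agree, so the difference of two equivalent box elements
  lies in the kernel.\<close>

lemma box_transversal: "finite I \<Longrightarrow> lattice I H \<Longrightarrow> \<exists>l. transversal I H (box I l)"
proof (induction I arbitrary: H rule: finite_induct)
  case empty
  have zero: "vecs {} = {\<lambda>_ :: 'a. 0}" by (auto simp: vecs_def fun_eq_iff)
  then have "box {} (\<lambda>_ :: 'a. 0) = {\<lambda>_. 0}" by (simp add: box_def)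
  with zero have "transversal {} H (box {} (\<lambda>_. 0))"
    using lattice_zero[OF empty] by (simp add: transversal_def)
  then show ?case by (rule exI[of _ "\<lambda>_. 0"])
next
  case (insert k I)
  note H = insert.prems
  obtain l h where lh: "0 \<le> l" "h \<in> H" "h k = l" "\<And>x. x \<in> H \<Longrightarrow> l dvd x k" "lattice I {x \<in> H. x k = 0}"
    using lattice_split[OF H] by metis
  obtain l' where l': "transversal I {x \<in> H. x k = 0} (box I l')" using insert.IH[OF lh(5)] by (elim exE)
  let ?L = "l'(k := l)"
  have upd: "x(k := 0) \<in> box I l'" if "x \<in> box (insert k I) ?L" for x
    using that insert.hyps(2) by (auto simp: box_def vecs_def)
  have "\<exists>x\<in>box (insert k I) ?L. (\<lambda>i. z i - x i) \<in> H" if z: "z \<in> vecs (insert k I)" for z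
  proof -
    \<comment> \<open>For \<open>l = 0\<close> division by zero gives \<open>q = 0\<close>, and
      coordinate \<open>k\<close> stays as it is.\<close>
    define q where "q = z k div l"
    define y where "y = (\<lambda>i. z i - q * h i)"
    have y: "l \<noteq> 0 \<longrightarrow> 0 \<le> y k \<and> y k < l" using lh(1,3) by (simp add: y_def q_def minus_div_mult_eq_mod)
    have "y(k := 0) \<in> vecs I" using z lattice_vecs[OF H lh(2)] by (auto simp: y_def vecs_def)
    with l' obtain x where x: "x \<in> box I l'" "(\<lambda>i. (y(k := 0)) i - x i) \<in> {x \<in> H. x k = 0}"
      by (rule transversalE)
    have xk: "x k = 0" using x(1) insert.hyps(2) by (simp add: box_def vecs_def)
    have "(\<lambda>i. ((y(k := 0)) i - x i) + q * h i) \<in> H"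
      using x(2) by (intro lattice_add[OF H _ lattice_cmult[OF H lh(2)]]) simp
    also have "(\<lambda>i. ((y(k := 0)) i - x i) + q * h i) = (\<lambda>i. z i - (x(k := y k)) i)"
      by (auto simp: y_def xk fun_eq_iff)
    finally have "(\<lambda>i. z i - (x(k := y k)) i) \<in> H" .
    moreover have "x(k := y k) \<in> box (insert k I) ?L" using x(1) y insert.hyps(2) by (auto simp: box_def vecs_def)
    ultimately show ?thesis by (rule bexI)
  qed
  moreover have uniq: "x = y" if xy: "x \<in> box (insert k I) ?L" "y \<in> box (insert k I) ?L" "(\<lambda>i. x i - y i) \<in> H" for x y
  proof -
    have "l dvd x k - y k" using lh(4)[OF xy(3)] .
    then have k: "x k = y k"
    proof (cases "l = 0")
      case False
      then have "0 \<le> x k \<and> x k < l" "0 \<le> y k \<and> y k < l" using xy(1,2) by (simp_all add: box_def)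
      then have less: "\<bar>x k - y k\<bar> < l" by linarith
      show ?thesis
      proof (rule ccontr)
        assume "x k \<noteq> y k"
        then have "\<bar>l\<bar> \<le> \<bar>x k - y k\<bar>" using \<open>l dvd x k - y k\<close> by (intro dvd_imp_le_int) simp_all
        with less show False by linarith
      qed
    next
      case True
      with \<open>l dvd x k - y k\<close> show ?thesis by simp
    qed
    then have "(\<lambda>i. (x(k := 0)) i - (y(k := 0)) i) = (\<lambda>i. x i - y i)" by (simp add: fun_eq_iff)
    then have "(\<lambda>i. (x(k := 0)) i - (y(k := 0)) i) \<in> {x \<in> H. x k = 0}" using xy(3) k by simp
    then have "x(k := 0) = y(k := 0)"
      by (rule transversal_unique[OF l' upd[OF xy(1)] upd[OF xy(2)]])
    then have "(x(k := 0))(k := x k) = (y(k := 0))(k := y k)" unfolding k by (rule arg_cong)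
    then show "x = y" by simp
  qed
  ultimately have "transversal (insert k I) H (box (insert k I) ?L)" by (rule transversalI)
  then show ?case by (rule exI[of _ ?L])
qed

text \<open>An element of the subgroup which vanishes at all bounded coordinates lies, like \<open>0\<close>, in the
  box, hence is \<open>0\<close>.  So a carry is determined by its bounded coordinates.\<close>

lemma finite_carries:
  assumes I: "finite I" and H: "lattice I H" and T: "transversal I H (box I l)"
  shows "finite {d. \<exists>x\<in>box I l. \<exists>y\<in>box I l. d = (\<lambda>i. y i - x i) \<and> (\<lambda>i. d i - b i) \<in> H}" (is "finite ?D")
proof -
  define P where "P = {i \<in> I. l i \<noteq> 0}"
  define L where "L = (\<Sum>i\<in>I. \<bar>l i\<bar>)"
  have bound: "d i \<in> {- L..L}" if d: "d \<in> ?D" and i: "i \<in> P" for d i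
  proof -
    obtain x y where xy: "x \<in> box I l" "y \<in> box I l" "d = (\<lambda>i. y i - x i)" using d by auto
    have "i \<in> I" "l i \<noteq> 0" using i by (simp_all add: P_def)
    then have "0 \<le> x i \<and> x i < l i" "0 \<le> y i \<and> y i < l i" using xy(1,2) by (simp_all add: box_def)
    moreover have "\<bar>l i\<bar> \<le> L" unfolding L_def using I \<open>i \<in> I\<close> by (intro member_le_sum) simp_all
    ultimately show ?thesis unfolding xy(3) by auto
  qed
  have "inj_on (restr P) ?D"
  proof (rule inj_onI)
    fix d d' assume d: "d \<in> ?D" "d' \<in> ?D" and eq: "restr P d = restr P d'"
    obtain x y where xy: "x \<in> box I l" "y \<in> box I l" "d = (\<lambda>i. y i - x i)" "(\<lambda>i. d i - b i) \<in> H"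
      using d(1) by auto
    have d'H: "(\<lambda>i. d' i - b i) \<in> H" using d(2) by auto
    have "(\<lambda>i. (d i - b i) - (d' i - b i)) \<in> H" by (rule lattice_diff[OF H xy(4) d'H])
    then have h: "(\<lambda>i. d i - d' i) \<in> H" by simp
    have "d i = d' i" if "i \<in> P" for i using fun_cong[OF eq, of i] that by (simp add: restr_def)
    \<comment> \<open>The box is nonempty, so its nonzero side lengths are positive; hence it
      contains the zero vector.\<close>
    moreover have "0 < l i" if "i \<in> P" for i using xy(1) that by (auto simp: P_def box_def)
    ultimately have "(\<lambda>i. d i - d' i) \<in> box I l" "(\<lambda>_. 0) \<in> box I l"
      using lattice_vecs[OF H h] by (simp_all add: box_def vecs_def P_def)
    moreover have "(\<lambda>i. (d i - d' i) - 0) \<in> H" using h by simp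
    ultimately have "(\<lambda>i. d i - d' i) = (\<lambda>_. 0)" by (rule transversal_unique[OF T])
    then show "d = d'" by (simp add: fun_eq_iff)
  qed
  moreover have "restr P ` ?D \<subseteq> {f. \<forall>i. (i \<in> P \<longrightarrow> f i \<in> {- L..L}) \<and> (i \<notin> P \<longrightarrow> f i = 0)}"
  proof (rule image_subsetI)
    fix d assume "d \<in> ?D"
    from bound[OF this] show "restr P d \<in> {f. \<forall>i. (i \<in> P \<longrightarrow> f i \<in> {- L..L}) \<and> (i \<notin> P \<longrightarrow> f i = 0)}"
      by (simp add: restr_def)
  qed
  moreover have "finite {f. \<forall>i. (i \<in> P \<longrightarrow> f i \<in> {- L..L}) \<and> (i \<notin> P \<longrightarrow> f i = (0 :: int))}"
    by (rule finite_set_of_finite_funs) (use I in \<open>simp_all add: P_def\<close>)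
  ultimately show ?thesis by (rule inj_on_finite)
qed

section \<open>Nilpotent groups of class two\<close>

context group
begin

definition comm :: "'a \<Rightarrow> 'a \<Rightarrow> 'a" where
  "comm x y = x \<otimes> y \<otimes> inv x \<otimes> inv y"

definition center :: "'a set" where
  "center = {c \<in> carrier G. \<forall>g\<in>carrier G. c \<otimes> g = g \<otimes> c}"

lemma center_closed: "c \<in> center \<Longrightarrow> c \<in> carrier G"
  by (simp add: center_def)

lemma center_commute: "c \<in> center \<Longrightarrow> g \<in> carrier G \<Longrightarrow> c \<otimes> g = g \<otimes> c"
  by (simp add: center_def)

lemma center_subgroup: "subgroup center G"
proof
  show "center \<subseteq> carrier G" "\<one> \<in> center" by (auto simp: center_def)
next
  fix x y assume x: "x \<in> center" and y: "y \<in> center"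
  have "x \<otimes> y \<otimes> g = g \<otimes> (x \<otimes> y)" if g: "g \<in> carrier G" for g
  proof -
    note c = center_closed[OF x] center_closed[OF y] g
    have "x \<otimes> y \<otimes> g = x \<otimes> (g \<otimes> y)" using c center_commute[OF y g] by (simp add: m_assoc)
    also have "\<dots> = (x \<otimes> g) \<otimes> y" using c by (simp add: m_assoc)
    also have "\<dots> = g \<otimes> (x \<otimes> y)" using c center_commute[OF x g] by (simp add: m_assoc)
    finally show ?thesis .
  qed
  then show "x \<otimes> y \<in> center" using center_closed[OF x] center_closed[OF y] by (simp add: center_def)
next
  fix x assume x: "x \<in> center"
  have "inv x \<otimes> g = g \<otimes> inv x" if g: "g \<in> carrier G" for g
  proof -
    note c = center_closed[OF x] g
    have "inv x \<otimes> g = inv (inv g \<otimes> x)" using c by (simp add: inv_mult_group)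
    also have "inv g \<otimes> x = x \<otimes> inv g" using center_commute[OF x, of "inv g"] g by simp
    also have "inv (x \<otimes> inv g) = g \<otimes> inv x" using c by (simp add: inv_mult_group)
    finally show ?thesis .
  qed
  then show "inv x \<in> center" using center_closed[OF x] by (simp add: center_def)
qed

lemmas center_mult = subgroup.m_closed[OF center_subgroup]
  and center_one = subgroup.one_closed[OF center_subgroup]
  and center_int_pow = subgroup_int_pow_closed[OF center_subgroup]

lemma center_swap:
  "c \<in> center \<Longrightarrow> x \<in> carrier G \<Longrightarrow> y \<in> carrier G \<Longrightarrow> (x \<otimes> c) \<otimes> y = (x \<otimes> y) \<otimes> c"
  using center_commute[of c y] center_closed[of c] by (simp add: m_assoc)

lemma comm_closed: "x \<in> carrier G \<Longrightarrow> y \<in> carrier G \<Longrightarrow> comm x y \<in> carrier G"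
  by (simp add: comm_def)

lemma comm_swap: "x \<in> carrier G \<Longrightarrow> y \<in> carrier G \<Longrightarrow> comm x y \<otimes> (y \<otimes> x) = x \<otimes> y"
  by (simp add: comm_def m_assoc inv_solve_left l_inv) (simp add: m_assoc[symmetric])

text \<open>Commutators are identified through
  \<open>c \<otimes> (y \<otimes> x) = x \<otimes> y\<close>, which avoids calculating with
  inverses.\<close>

lemma comm_eqI:
  assumes "x \<in> carrier G" "y \<in> carrier G" "c \<in> carrier G" "c \<otimes> (y \<otimes> x) = x \<otimes> y"
  shows "comm x y = c"
  using comm_swap[OF assms(1,2)] assms comm_closed[OF assms(1,2)] by (metis m_closed right_cancel)

primrec lprod :: "(nat \<Rightarrow> 'a) \<Rightarrow> nat \<Rightarrow> 'a" where
  "lprod f 0 = \<one>"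
| "lprod f (Suc n) = lprod f n \<otimes> f n"

lemma lprod_closed: "(\<And>i. i < n \<Longrightarrow> f i \<in> carrier G) \<Longrightarrow> lprod f n \<in> carrier G"
  by (induction n) simp_all

lemma lprod_subgroup: "subgroup H G \<Longrightarrow> (\<And>i. i < n \<Longrightarrow> f i \<in> H) \<Longrightarrow> lprod f n \<in> H"
  by (induction n) (simp_all add: subgroup.one_closed subgroup.m_closed)

lemma lprod_cong: "(\<And>i. i < n \<Longrightarrow> f i = g i) \<Longrightarrow> lprod f n = lprod g n"
  by (induction n) simp_all

lemma lprod_center_mult:
  assumes "\<And>i. i < n \<Longrightarrow> f i \<in> center" "\<And>i. i < n \<Longrightarrow> g i \<in> center"
  shows "lprod f n \<otimes> lprod g n = lprod (\<lambda>i. f i \<otimes> g i) n"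
  using assms
proof (induction n)
  case (Suc n)
  have c: "lprod f n \<in> center" "lprod g n \<in> center" "f n \<in> center" "g n \<in> center"
    using Suc.prems lprod_subgroup[OF center_subgroup] by simp_all
  note cc = c[THEN center_closed]
  have "(lprod f n \<otimes> f n) \<otimes> (lprod g n \<otimes> g n) = ((lprod f n \<otimes> f n) \<otimes> lprod g n) \<otimes> g n"
    using cc by (simp add: m_assoc)
  also have "(lprod f n \<otimes> f n) \<otimes> lprod g n = (lprod f n \<otimes> lprod g n) \<otimes> f n"
    by (rule center_swap[OF c(3) cc(1,2)])
  also have "\<dots> \<otimes> g n = (lprod f n \<otimes> lprod g n) \<otimes> (f n \<otimes> g n)" using cc by (simp add: m_assoc)
  finally show ?case using Suc by simp
qed simp

lemma lprod_single:
  assumes "k < n" "\<And>i. i < n \<Longrightarrow> i \<noteq> k \<Longrightarrow> f i = \<one>" "f k \<in> carrier G"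
  shows "lprod f n = f k"
  using assms(1,2)
proof (induction n)
  case (Suc n)
  show ?case
  proof (cases "n = k")
    case True
    have "lprod f k = lprod (\<lambda>_. \<one>) k" using Suc.prems True by (intro lprod_cong) simp
    also have "\<dots> = \<one>" by (induction k) simp_all
    finally show ?thesis using True assms(3) by simp
  next
    case False
    then show ?thesis using Suc assms(3) by simp
  qed
qed simp

lemma reachable_lprod:
  assumes A: "A \<subseteq> carrier G" and "\<And>i. i < n \<Longrightarrow> reachable G A (N i) (f i)"
  shows "reachable G A (\<Sum>i<n. N i) (lprod f n)"
  using assms(2)
proof (induction n)
  case 0
  then show ?case by (simp add: reachable_one)
next
  case (Suc n)
  then show ?case using reachable_mult[OF A, of "\<Sum>i<n. N i" "lprod f n" "N n" "f n"] by simp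
qed

end

section \<open>Collecting ordered monomials\<close>

text \<open>With \<open>a\<^sub>i\<close> the generators, \<open>pw x\<close> is the ordered product of the \<open>a\<^sub>i\<^sup>x\<^sup>i\<close> and \<open>cpw y\<close> the product of
  the powers \<open>y (i, j)\<close> of the commutators of \<open>a\<^sub>i\<close> and \<open>a\<^sub>j\<close>, where \<open>j < i\<close>.\<close>

locale class_two_group = group G for G (structure) +
  fixes a :: "nat \<Rightarrow> 'a" and n :: nat
  assumes gens_closed: "\<And>i. i < n \<Longrightarrow> a i \<in> carrier G"
    and gens: "generate G (a ` {..<n}) = carrier G"
    and comm_center: "\<And>x y. x \<in> carrier G \<Longrightarrow> y \<in> carrier G \<Longrightarrow> comm x y \<in> center"
begin

text \<open>Moving \<open>y\<close> past \<open>x'\<close> and then past \<open>x\<close> leaves one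
  commutator each time; both are central and can be carried to the front.\<close>

lemma comm_mult_left:
  assumes x: "x \<in> carrier G" "x' \<in> carrier G" and y: "y \<in> carrier G"
  shows "comm (x \<otimes> x') y = comm x y \<otimes> comm x' y"
proof (rule comm_eqI)
  let ?c = "comm x y" and ?c' = "comm x' y"
  note c = x y comm_closed[OF x(1) y] comm_closed[OF x(2) y]
  have "x \<otimes> x' \<otimes> y = x \<otimes> (?c' \<otimes> (y \<otimes> x'))" using c comm_swap[OF x(2) y] by (simp add: m_assoc)
  also have "\<dots> = (x \<otimes> ?c') \<otimes> (y \<otimes> x')" using c by (simp add: m_assoc)
  also have "x \<otimes> ?c' = ?c' \<otimes> x" using center_commute[OF comm_center[OF x(2) y] x(1)] by simp
  also have "(?c' \<otimes> x) \<otimes> (y \<otimes> x') = ?c' \<otimes> (x \<otimes> y) \<otimes> x'" using c by (simp add: m_assoc)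
  also have "x \<otimes> y = ?c \<otimes> (y \<otimes> x)" using comm_swap[OF x(1) y] by simp
  also have "?c' \<otimes> (?c \<otimes> (y \<otimes> x)) \<otimes> x' = (?c' \<otimes> ?c) \<otimes> (y \<otimes> (x \<otimes> x'))" using c by (simp add: m_assoc)
  also have "?c' \<otimes> ?c = ?c \<otimes> ?c'" using center_commute[OF comm_center[OF x(2) y]] c by simp
  finally show "?c \<otimes> ?c' \<otimes> (y \<otimes> (x \<otimes> x')) = x \<otimes> x' \<otimes> y" by simp
qed (use assms in \<open>simp_all add: comm_closed\<close>)

lemma comm_mult_right:
  assumes x: "x \<in> carrier G" and y: "y \<in> carrier G" "y' \<in> carrier G"
  shows "comm x (y \<otimes> y') = comm x y \<otimes> comm x y'"
proof (rule comm_eqI)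
  let ?c = "comm x y" and ?c' = "comm x y'"
  note c = x y comm_closed[OF x y(1)] comm_closed[OF x y(2)]
  have "x \<otimes> (y \<otimes> y') = (x \<otimes> y) \<otimes> y'" using c by (simp add: m_assoc)
  also have "x \<otimes> y = ?c \<otimes> (y \<otimes> x)" using comm_swap[OF x y(1)] by simp
  also have "?c \<otimes> (y \<otimes> x) \<otimes> y' = ?c \<otimes> (y \<otimes> (x \<otimes> y'))" using c by (simp add: m_assoc)
  also have "x \<otimes> y' = ?c' \<otimes> (y' \<otimes> x)" using comm_swap[OF x y(2)] by simp
  also have "?c \<otimes> (y \<otimes> (?c' \<otimes> (y' \<otimes> x))) = ?c \<otimes> ((y \<otimes> ?c') \<otimes> (y' \<otimes> x))" using c by (simp add: m_assoc)
  also have "y \<otimes> ?c' = ?c' \<otimes> y" using center_commute[OF comm_center[OF x y(2)] y(1)] by simp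
  also have "?c \<otimes> ((?c' \<otimes> y) \<otimes> (y' \<otimes> x)) = ?c \<otimes> ?c' \<otimes> (y \<otimes> y' \<otimes> x)" using c by (simp add: m_assoc)
  finally show "?c \<otimes> ?c' \<otimes> (y \<otimes> y' \<otimes> x) = x \<otimes> (y \<otimes> y')" by simp
qed (use assms in \<open>simp_all add: comm_closed\<close>)

lemma comm_int_pow_left:
  assumes "x \<in> carrier G" "y \<in> carrier G" shows "comm (x [^] (k :: int)) y = comm x y [^] k"
proof -
  have "(\<lambda>x. comm x y) \<in> hom G G" using assms(2) by (intro homI) (simp_all add: comm_closed comm_mult_left)
  from hom_int_pow[OF this assms(1) is_group is_group] show ?thesis .
qed

lemma comm_int_pow_right:
  assumes "x \<in> carrier G" "y \<in> carrier G" shows "comm x (y [^] (k :: int)) = comm x y [^] k"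
proof -
  have "comm x \<in> hom G G" using assms(1) by (intro homI) (simp_all add: comm_closed comm_mult_right)
  from hom_int_pow[OF this assms(2) is_group is_group] show ?thesis .
qed

lemma comm_lprod_right:
  assumes x: "x \<in> carrier G" and f: "\<And>i. i < m \<Longrightarrow> f i \<in> carrier G"
  shows "comm x (lprod f m) = lprod (\<lambda>i. comm x (f i)) m"
  using f
proof (induction m)
  case 0
  show ?case using x by (intro comm_eqI) simp_all
next
  case (Suc m)
  then show ?case using comm_mult_right[OF x, of "lprod f m" "f m"] lprod_closed[of m f] by simp
qed

definition pw :: "nat \<Rightarrow> (nat \<Rightarrow> int) \<Rightarrow> 'a" where
  "pw m x = lprod (\<lambda>i. a i [^] x i) m"

definition crow :: "nat \<Rightarrow> (nat \<times> nat \<Rightarrow> int) \<Rightarrow> 'a" where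
  "crow i y = lprod (\<lambda>j. comm (a i) (a j) [^] y (i, j)) i"

definition cpw :: "nat \<Rightarrow> (nat \<times> nat \<Rightarrow> int) \<Rightarrow> 'a" where
  "cpw m y = lprod (\<lambda>i. crow i y) m"

text \<open>The bilinear form of the collection process: sorting a product moves
  \<open>a i [^] x i\<close> past \<open>a j [^] x' j\<close> for \<open>j < i\<close>, at the cost
  of the commutator of \<open>a i\<close> and \<open>a j\<close> to the power
  \<open>x i * x' j\<close>. \<open>cpw\<close> reads only the entries with
  \<open>j < i\<close>.\<close>

definition cocyc :: "(nat \<Rightarrow> int) \<Rightarrow> (nat \<Rightarrow> int) \<Rightarrow> nat \<times> nat \<Rightarrow> int" where
  "cocyc x x' = (\<lambda>(i, j). x i * x' j)"

lemma pw_closed: "m \<le> n \<Longrightarrow> pw m x \<in> carrier G"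
  unfolding pw_def by (rule lprod_closed) (simp add: gens_closed)

lemma crow_center: "i < n \<Longrightarrow> crow i y \<in> center"
  unfolding crow_def
  by (rule lprod_subgroup[OF center_subgroup], rule center_int_pow, rule comm_center) (simp_all add: gens_closed)

lemma cpw_center: "m \<le> n \<Longrightarrow> cpw m y \<in> center"
  unfolding cpw_def by (rule lprod_subgroup[OF center_subgroup], rule crow_center) simp

lemma crow_add: 
  assumes "i < n" shows "crow i y \<otimes> crow i y' = crow i (\<lambda>p. y p + y' p)"
proof -
  have c: "comm (a i) (a j) \<in> center" if "j < i" for j using assms that by (intro comm_center) (simp_all add: gens_closed)
  have "crow i y \<otimes> crow i y' = lprod (\<lambda>j. comm (a i) (a j) [^] y (i, j) \<otimes> comm (a i) (a j) [^] y' (i, j)) i"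
    unfolding crow_def by (rule lprod_center_mult) (simp_all add: center_int_pow c)
  also have "\<dots> = crow i (\<lambda>p. y p + y' p)"
    unfolding crow_def by (rule lprod_cong) (simp add: int_pow_mult center_closed c)
  finally show ?thesis .
qed

lemma cpw_add:
  assumes "m \<le> n" shows "cpw m y \<otimes> cpw m y' = cpw m (\<lambda>p. y p + y' p)"
proof -
  have "cpw m y \<otimes> cpw m y' = lprod (\<lambda>i. crow i y \<otimes> crow i y') m"
    unfolding cpw_def by (rule lprod_center_mult) (use assms in \<open>simp_all add: crow_center\<close>)
  also have "\<dots> = cpw m (\<lambda>p. y p + y' p)"
    unfolding cpw_def by (rule lprod_cong) (use assms in \<open>simp add: crow_add\<close>)
  finally show ?thesis .
qed

text \<open>The last power of the left factor has to pass all of \<open>pw m x'\<close>, which by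
  bilinearity costs exactly one row of commutators; the rest is the induction hypothesis, since all
  these corrections are central.\<close>

lemma pw_add:
  "m \<le> n \<Longrightarrow> pw m x \<otimes> pw m x' = pw m (\<lambda>i. x i + x' i) \<otimes> cpw m (cocyc x x')"
proof (induction m)
  case 0
  then show ?case by (simp add: pw_def cpw_def)
next
  case (Suc m)
  then have m: "m < n" "m \<le> n" by simp_all
  let ?P = "pw m x" and ?P' = "pw m x'" and ?s = "\<lambda>i. x i + x' i"
  let ?A = "a m [^] x m" and ?A' = "a m [^] x' m" and ?C = "cpw m (cocyc x x')" and ?D = "crow m (cocyc x x')"
  have am: "a m \<in> carrier G" by (rule gens_closed[OF m(1)])
  have c: "?P \<in> carrier G" "?P' \<in> carrier G" "?A \<in> carrier G" "?A' \<in> carrier G" "pw m ?s \<in> carrier G"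
    using m am by (simp_all add: pw_closed)
  have z: "?C \<in> center" "?D \<in> center" using m by (simp_all add: cpw_center crow_center)
  note zc = z[THEN center_closed]
  have "comm ?A ?P' = lprod (\<lambda>j. comm ?A (a j [^] x' j)) m"
    unfolding pw_def using m by (intro comm_lprod_right c) (simp add: gens_closed)
  also have "\<dots> = ?D"
    unfolding crow_def
  proof (rule lprod_cong)
    fix j assume "j < m"
    then have aj: "a j \<in> carrier G" using m by (intro gens_closed) simp
    have "comm ?A (a j [^] x' j) = (comm (a m) (a j) [^] x m) [^] x' j"
      using am aj by (simp add: comm_int_pow_right comm_int_pow_left)
    then show "comm ?A (a j [^] x' j) = comm (a m) (a j) [^] cocyc x x' (m, j)"
      using am aj by (simp add: int_pow_pow comm_closed cocyc_def)
  qed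
  finally have D: "comm ?A ?P' = ?D" .
  have AP: "?A \<otimes> ?P' = (?P' \<otimes> ?A) \<otimes> ?D"
    using comm_swap[OF c(3,2)] center_commute[OF z(2), of "?P' \<otimes> ?A"] c by (simp add: D)
  have "pw (Suc m) x \<otimes> pw (Suc m) x' = (?P \<otimes> ?A) \<otimes> (?P' \<otimes> ?A')" by (simp add: pw_def)
  also have "\<dots> = (?P \<otimes> (?A \<otimes> ?P')) \<otimes> ?A'" using c by (simp add: m_assoc)
  also have "\<dots> = (?P \<otimes> ?P' \<otimes> ?A \<otimes> ?D) \<otimes> ?A'" unfolding AP using c zc by (simp add: m_assoc)
  also have "\<dots> = (?P \<otimes> ?P' \<otimes> ?A \<otimes> ?A') \<otimes> ?D" using c by (intro center_swap[OF z(2)]) simp_all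
  also have "?P \<otimes> ?P' = pw m ?s \<otimes> ?C" using Suc.IH m by simp
  also have "pw m ?s \<otimes> ?C \<otimes> ?A \<otimes> ?A' = (pw m ?s \<otimes> ?C) \<otimes> (?A \<otimes> ?A')" using c zc by (simp add: m_assoc)
  also have "\<dots> = (pw m ?s \<otimes> (?A \<otimes> ?A')) \<otimes> ?C" using c by (intro center_swap[OF z(1)]) simp_all
  also have "?A \<otimes> ?A' = a m [^] ?s m" by (simp add: int_pow_mult am)
  also have "pw m ?s \<otimes> (a m [^] ?s m) \<otimes> ?C \<otimes> ?D = pw (Suc m) ?s \<otimes> cpw (Suc m) (cocyc x x')"
    using c zc am by (simp add: pw_def cpw_def m_assoc del: int_pow_mult)
  finally show ?case .
qed

abbreviation (input) I1 :: "nat set" where "I1 \<equiv> {..<n}"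
abbreviation (input) I2 :: "(nat \<times> nat) set" where "I2 \<equiv> (SIGMA i:{..<n}. {..<i})"

definition phi :: "(nat \<Rightarrow> int) \<Rightarrow> (nat \<times> nat \<Rightarrow> int) \<Rightarrow> 'a" where
  "phi x y = pw n x \<otimes> cpw n y"

lemma pwn [simp]: "pw n x \<in> carrier G"
  by (rule pw_closed) simp

lemma cpwn_center: "cpw n y \<in> center"
  by (rule cpw_center) simp

lemma cpwn [simp]: "cpw n y \<in> carrier G"
  by (rule center_closed[OF cpwn_center])

lemma phi_closed: "phi x y \<in> carrier G"
  by (simp add: phi_def)

lemma cpwn_add: "cpw n y \<otimes> cpw n y' = cpw n (\<lambda>p. y p + y' p)"
  by (rule cpw_add) simp

lemma pwn_add: "pw n x \<otimes> pw n x' = pw n (\<lambda>i. x i + x' i) \<otimes> cpw n (cocyc x x')"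
  by (rule pw_add) simp

lemma pwn_zero: "pw n (\<lambda>_. 0) = \<one>"
proof -
  have "lprod (\<lambda>i. \<one>) m = \<one>" for m by (induction m) simp_all
  then show ?thesis by (simp add: pw_def)
qed

lemma cpwn_zero: "cpw n (\<lambda>_. 0) = \<one>"
proof -
  have "lprod (\<lambda>i. \<one>) m = \<one>" for m by (induction m) simp_all
  then show ?thesis by (simp add: cpw_def crow_def)
qed

lemma pwn_restr: "pw n (restr I1 x) = pw n x"
  unfolding pw_def by (rule lprod_cong) (simp add: restr_def)

lemma cpwn_restr: "cpw n (restr I2 y) = cpw n y"
  unfolding cpw_def
proof (rule lprod_cong)
  fix i assume "i < n"
  then show "crow i (restr I2 y) = crow i y"
    unfolding crow_def by (intro lprod_cong) (simp add: restr_def)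
qed

lemma phi_mult: "phi x y \<otimes> phi x' y' = phi (\<lambda>i. x i + x' i) (\<lambda>p. cocyc x x' p + y p + y' p)"
proof -
  have "phi x y \<otimes> phi x' y' = ((pw n x \<otimes> cpw n y) \<otimes> pw n x') \<otimes> cpw n y'" by (simp add: phi_def m_assoc)
  also have "(pw n x \<otimes> cpw n y) \<otimes> pw n x' = (pw n x \<otimes> pw n x') \<otimes> cpw n y"
    by (rule center_swap[OF cpwn_center]) simp_all
  also have "\<dots> \<otimes> cpw n y' = pw n (\<lambda>i. x i + x' i) \<otimes> (cpw n (cocyc x x') \<otimes> cpw n y \<otimes> cpw n y')"
    by (simp add: pwn_add m_assoc)
  also have "\<dots> = phi (\<lambda>i. x i + x' i) (\<lambda>p. cocyc x x' p + y p + y' p)" by (simp only: cpwn_add phi_def)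
  finally show ?thesis .
qed

lemma phi_pw: "phi x (\<lambda>_. 0) = pw n x"
  by (simp add: phi_def cpwn_zero)

text \<open>The values of \<open>phi\<close> contain the generators and are closed under products
  and inverses.\<close>

lemma phi_surj:
  assumes "g \<in> carrier G" shows "\<exists>x y. g = phi x y"
proof -
  have gen: "\<exists>x y. a i = phi x y" if "i < n" for i
  proof -
    have "pw n ((\<lambda>_. 0)(i := 1)) = a i"
      unfolding pw_def using gens_closed[OF that] by (subst lprod_single[OF that]) simp_all
    then have "a i = phi ((\<lambda>_. 0)(i := 1)) (\<lambda>_. 0)" by (simp add: phi_pw)
    then show ?thesis by (intro exI)
  qed
  have inv_phi: "\<exists>x' y'. inv (phi x y) = phi x' y'" for x y
  proof -
    \<comment> \<open>\<open>?y\<close> also cancels the cocycle that arises when \<open>x\<close>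
      is added to its negative.\<close>
    let ?x = "\<lambda>i. - x i" and ?y = "\<lambda>p. - cocyc x (\<lambda>i. - x i) p - y p"
    have "phi x y \<otimes> phi ?x ?y = phi (\<lambda>_. 0) (\<lambda>_. 0)" by (simp add: phi_mult)
    then have "phi x y \<otimes> phi ?x ?y = \<one>" by (simp add: phi_pw pwn_zero)
    then have "inv (phi x y) = phi ?x ?y" by (metis inv_unique' phi_closed inv_equality inv_inv inv_closed)
    then show ?thesis by (intro exI)
  qed
  have "g \<in> generate G (a ` {..<n})" using assms by (simp add: gens)
  then show ?thesis
  proof (induction rule: generate.induct)
    case one
    have "\<one> = phi (\<lambda>_. 0) (\<lambda>_. 0)" by (simp add: phi_pw pwn_zero)
    then show ?case by (intro exI)
  next
    case (incl h)
    then show ?case using gen by auto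
  next
    case (inv h)
    then obtain i where i: "i < n" "h = a i" by auto
    obtain x y where "h = phi x y" using gen[OF i(1)] i(2) by auto
    then show ?case using inv_phi[of x y] by simp
  next
    case (eng h1 h2)
    then obtain x y x' y' where "h1 = phi x y" "h2 = phi x' y'" by (elim exE)
    then have "h1 \<otimes> h2 = phi (\<lambda>i. x i + x' i) (\<lambda>p. cocyc x x' p + y p + y' p)" by (simp add: phi_mult)
    then show ?case by (intro exI)
  qed
qed

text \<open>The values of \<open>cpw n\<close> make up the commutator subgroup, so these are the
  relations between the generators in the abelianization. \<open>Gam\<close> collects the relations
  between the basic commutators.\<close>

definition Lam :: "(nat \<Rightarrow> int) set" where
  "Lam = {x \<in> vecs I1. \<exists>y. pw n x = cpw n y}"

definition Gam :: "(nat \<times> nat \<Rightarrow> int) set" where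
  "Gam = {y \<in> vecs I2. cpw n y = \<one>}"

lemma cpwn_eq_iff: "cpw n y = cpw n y' \<longleftrightarrow> cpw n (\<lambda>p. y p - y' p) = \<one>"
proof -
  have "cpw n y = cpw n (\<lambda>p. y p - y' p) \<otimes> cpw n y'" by (simp add: cpwn_add)
  then show ?thesis by (simp add: r_cancel_one')
qed

text \<open>\<open>pw n\<close> is not a homomorphism, but replacing two monomials by the monomial
  of the difference costs only a cocycle, hence commutators. This is why \<open>Lam\<close> is a
  subgroup.\<close>

lemma pwn_eq_iff: "pw n x = pw n x' \<otimes> cpw n y \<longleftrightarrow> pw n (\<lambda>i. x i - x' i) = cpw n (\<lambda>p. y p + cocyc x' (\<lambda>i. x i - x' i) p)"
proof -
  let ?d = "\<lambda>i. x i - x' i"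
  let ?b = "cocyc x' ?d"
  have 1: "pw n x' \<otimes> pw n ?d = pw n x \<otimes> cpw n ?b" using pwn_add[of x' ?d] by simp
  have "pw n ?d = cpw n (\<lambda>p. y p + ?b p) \<longleftrightarrow> pw n x' \<otimes> pw n ?d = pw n x' \<otimes> (cpw n y \<otimes> cpw n ?b)"
    by (simp add: cpwn_add)
  also have "\<dots> \<longleftrightarrow> pw n x \<otimes> cpw n ?b = (pw n x' \<otimes> cpw n y) \<otimes> cpw n ?b" by (simp add: 1 m_assoc)
  also have "\<dots> \<longleftrightarrow> pw n x = pw n x' \<otimes> cpw n y" by simp
  finally show ?thesis by simp
qed

lemma Lam_iff: "(\<lambda>i. x i - x' i) \<in> Lam \<longleftrightarrow> (\<lambda>i. x i - x' i) \<in> vecs I1 \<and> (\<exists>y. pw n x = pw n x' \<otimes> cpw n y)"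
proof -
  have "(\<exists>y. pw n (\<lambda>i. x i - x' i) = cpw n y) \<longleftrightarrow> (\<exists>y. pw n x = pw n x' \<otimes> cpw n y)"
  proof
    assume "\<exists>y. pw n (\<lambda>i. x i - x' i) = cpw n y"
    then obtain y where "pw n (\<lambda>i. x i - x' i) = cpw n y" by (elim exE)
    then have "pw n x = pw n x' \<otimes> cpw n (\<lambda>p. y p - cocyc x' (\<lambda>i. x i - x' i) p)" unfolding pwn_eq_iff by simp
    then show "\<exists>y. pw n x = pw n x' \<otimes> cpw n y" by (intro exI)
  next
    assume "\<exists>y. pw n x = pw n x' \<otimes> cpw n y"
    then obtain y where "pw n x = pw n x' \<otimes> cpw n y" by (elim exE)
    then have "pw n (\<lambda>i. x i - x' i) = cpw n (\<lambda>p. y p + cocyc x' (\<lambda>i. x i - x' i) p)" unfolding pwn_eq_iff .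
    then show "\<exists>y. pw n (\<lambda>i. x i - x' i) = cpw n y" by (intro exI)
  qed
  then show ?thesis by (simp add: Lam_def)
qed

lemma lattice_Lam: "lattice I1 Lam"
  unfolding lattice_def
proof (intro conjI ballI)
  show "Lam \<subseteq> vecs I1" by (auto simp: Lam_def)
  have "pw n (\<lambda>_. 0) = cpw n (\<lambda>_. 0)" by (simp add: pwn_zero cpwn_zero)
  then show "(\<lambda>_. 0) \<in> Lam" unfolding Lam_def vecs_def by (intro CollectI conjI exI) simp_all
  fix x x' assume "x \<in> Lam" "x' \<in> Lam"
  then obtain y y' where xy: "x \<in> vecs I1" "pw n x = cpw n y" "x' \<in> vecs I1" "pw n x' = cpw n y'"
    by (auto simp: Lam_def)
  have "pw n x = pw n x' \<otimes> cpw n (\<lambda>p. y p - y' p)" by (simp add: xy cpwn_add)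
  moreover have "(\<lambda>i. x i - x' i) \<in> vecs I1" using xy by (simp add: vecs_def)
  ultimately show "(\<lambda>i. x i - x' i) \<in> Lam" unfolding Lam_iff by (intro conjI exI)
qed

lemma lattice_Gam: "lattice I2 Gam"
  unfolding lattice_def
proof (intro conjI ballI)
  show "Gam \<subseteq> vecs I2" by (auto simp: Gam_def)
  show "(\<lambda>_. 0) \<in> Gam" by (simp add: Gam_def vecs_def cpwn_zero)
  fix y y' assume "y \<in> Gam" "y' \<in> Gam"
  then have y: "y \<in> vecs I2" "y' \<in> vecs I2" "cpw n y = cpw n y'" by (simp_all add: Gam_def)
  then have "(\<lambda>p. y p - y' p) \<in> vecs I2" by (simp add: vecs_def)
  with y(3) show "(\<lambda>p. y p - y' p) \<in> Gam" unfolding cpwn_eq_iff by (simp add: Gam_def)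
qed

lemma Gam_iff: "restr I2 (\<lambda>p. y p - y' p) \<in> Gam \<longleftrightarrow> cpw n y = cpw n y'"
proof -
  have "restr I2 (\<lambda>p. y p - y' p) \<in> vecs I2" by (simp add: restr_def vecs_def)
  then show ?thesis unfolding Gam_def by (simp only: cpwn_eq_iff[of y y'] cpwn_restr mem_Collect_eq simp_thms)
qed

lemma phi_eq_iff:
  assumes "(\<lambda>i. x i - x' i) \<in> vecs I1"
  shows "phi x y = phi x' y' \<longleftrightarrow> (\<lambda>i. x i - x' i) \<in> Lam \<and> pw n x = pw n x' \<otimes> cpw n (\<lambda>p. y' p - y p)"
proof -
  have "phi x y = phi x' y' \<longleftrightarrow> pw n x \<otimes> cpw n y = (pw n x' \<otimes> cpw n (\<lambda>p. y' p - y p)) \<otimes> cpw n y"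
    by (simp add: phi_def m_assoc cpwn_add)
  also have "\<dots> \<longleftrightarrow> pw n x = pw n x' \<otimes> cpw n (\<lambda>p. y' p - y p)" by simp
  finally show ?thesis using assms unfolding Lam_iff by blast
qed

text \<open>Once \<open>pw n d\<close> and \<open>pw n x\<close> are known to differ by commutators
  with exponents \<open>r\<close>, equality of group elements becomes a condition on commutator
  exponents alone, which \<open>Gam\<close> decides.\<close>

lemma phi_eq_iff_cpw:
  assumes "pw n d = pw n x \<otimes> cpw n r"
  shows "phi d y = phi x y' \<longleftrightarrow> cpw n y = cpw n (\<lambda>p. y' p - r p)"
proof -
  have "phi d y = phi x y' \<longleftrightarrow> pw n x \<otimes> cpw n (\<lambda>p. r p + y p) = pw n x \<otimes> cpw n y'"
    by (simp add: phi_def assms m_assoc cpwn_add)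
  also have "\<dots> \<longleftrightarrow> cpw n (\<lambda>p. r p + y p) = cpw n y'" by simp
  also have "\<dots> \<longleftrightarrow> cpw n (\<lambda>p. r p + y p - y' p) = \<one>" by (rule cpwn_eq_iff)
  also have "(\<lambda>p. r p + y p - y' p) = (\<lambda>p. y p - (y' p - r p))" by (simp add: fun_eq_iff)
  also have "cpw n (\<lambda>p. y p - (y' p - r p)) = \<one> \<longleftrightarrow> cpw n y = cpw n (\<lambda>p. y' p - r p)"
    by (rule cpwn_eq_iff[symmetric])
  finally show ?thesis .
qed

theorem in_B_exp: "in_B G exp_fun"
proof -
  have fin: "finite I1" "finite I2" by simp_all
  obtain l where T1: "transversal I1 Lam (box I1 l)" using box_transversal[OF fin(1) lattice_Lam] by (elim exE)
  obtain k where T2: "transversal I2 Gam (box I2 k)" using box_transversal[OF fin(2) lattice_Gam] by (elim exE)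
  let ?B1 = "box I1 l" and ?B2 = "box I2 k"
  let ?I = "Inl ` I1 \<union> Inr ` I2 :: (nat + nat \<times> nat) set"
  \<comment> \<open>The basic commutators are made generators as well, so that their powers visibly
    have length linear in the exponents.\<close>
  let ?A = "a ` I1 \<union> (\<lambda>(i, j). comm (a i) (a j)) ` I2"
  define S where "S = {z :: nat + nat \<times> nat \<Rightarrow> int. z \<circ> Inl \<in> ?B1 \<and> z \<circ> Inr \<in> ?B2}"
  define Phi where "Phi = (\<lambda>z. phi (z \<circ> Inl) (z \<circ> Inr))"
  have box1: "x \<in> vecs I1" if "x \<in> ?B1" for x using that by (simp add: box_def)
  have box2: "y \<in> vecs I2" if "y \<in> ?B2" for y using that by (simp add: box_def)
  have diff1: "(\<lambda>i. x i - x' i) \<in> vecs I1" if "x \<in> vecs I1" "x' \<in> vecs I1" for x x'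
    using that by (simp add: vecs_def)
  have restr2: "restr I2 (\<lambda>p. y p - y' p) = (\<lambda>p. y p - y' p)" if "y \<in> vecs I2" "y' \<in> vecs I2" for y y'
    using that by (simp add: vecs_def restr_def fun_eq_iff)
  have autS: "aut (\<lambda>z. z \<in> S)"
    unfolding S_def mem_Collect_eq by (intro aut_conj aut_reindex[OF aut_box] fin)
  have A: "?A \<subseteq> carrier G"
  proof -
    have "a i \<in> carrier G" "comm (a i) (a j) \<in> carrier G" if "i < n" "j < i" for i j
      using that by (simp_all add: gens_closed comm_closed)
    then show ?thesis using gens_closed by auto
  qed
  show ?thesis
  proof (rule in_B_exp_if_coordinates)
    show "finite ?A" "?A \<subseteq> carrier G" "finite ?I" using A by simp_all
    show "aut (\<lambda>z. z \<in> S)" by (rule autS)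
    show "S \<subseteq> vecs ?I"
    proof
      fix z assume "z \<in> S"
      then have z: "z \<circ> Inl \<in> vecs I1" "z \<circ> Inr \<in> vecs I2" using box1 box2 by (simp_all add: S_def)
      have "z q = 0" if "q \<notin> ?I" for q
      proof (cases q)
        case (Inl i)
        then have "i \<notin> I1" using that by blast
        then have "(z \<circ> Inl) i = 0" using z(1) unfolding vecs_def by blast
        then show ?thesis using Inl by simp
      next
        case (Inr p)
        then have "p \<notin> I2" using that by blast
        then have "(z \<circ> Inr) p = 0" using z(2) unfolding vecs_def by blast
        then show ?thesis using Inr by simp
      qed
      then show "z \<in> vecs ?I" unfolding vecs_def by simp
    qed
    show "bij_betw Phi S (carrier G)"
    proof (rule bij_betwI')
      fix z z' assume "z \<in> S" "z' \<in> S"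
      then have z: "z \<circ> Inl \<in> ?B1" "z \<circ> Inr \<in> ?B2" "z' \<circ> Inl \<in> ?B1" "z' \<circ> Inr \<in> ?B2" by (simp_all add: S_def)
      show "(Phi z = Phi z') = (z = z')"
      proof
        assume "Phi z = Phi z'"
        then have eq: "phi (z \<circ> Inl) (z \<circ> Inr) = phi (z' \<circ> Inl) (z' \<circ> Inr)" by (simp add: Phi_def)
        have "(\<lambda>i. (z \<circ> Inl) i - (z' \<circ> Inl) i) \<in> Lam"
          using eq phi_eq_iff[OF diff1[OF box1[OF z(1)] box1[OF z(3)]]] by metis
        then have l: "z \<circ> Inl = z' \<circ> Inl" by (rule transversal_unique[OF T1 z(1,3)])
        then have "cpw n (z \<circ> Inr) = cpw n (z' \<circ> Inr)" using eq by (simp add: phi_def)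
        then have "(\<lambda>p. (z \<circ> Inr) p - (z' \<circ> Inr) p) \<in> Gam"
          using Gam_iff[of "z \<circ> Inr" "z' \<circ> Inr"] unfolding restr2[OF box2[OF z(2)] box2[OF z(4)]] by (rule iffD2[rotated])
        then have r: "z \<circ> Inr = z' \<circ> Inr" by (rule transversal_unique[OF T2 z(2,4)])
        show "z = z'"
        proof
          fix q show "z q = z' q" using fun_cong[OF l] fun_cong[OF r] by (cases q) simp_all
        qed
      qed simp
    next
      fix g assume "g \<in> carrier G"
      then obtain x0 y0 where g0: "g = phi x0 y0" using phi_surj by (metis)
      define x where "x = restr I1 x0"
      have x: "x \<in> vecs I1" "pw n x = pw n x0" by (simp add: x_def restr_def vecs_def) (simp add: x_def pwn_restr)
      \<comment> \<open>Passing to the representative \<open>x1\<close> costs a product of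
        commutators. It is absorbed into the exponents \<open>y0\<close> before these are reduced in
        turn.\<close>
      obtain x1 where x1: "x1 \<in> ?B1" "(\<lambda>i. x i - x1 i) \<in> Lam" using transversalE[OF T1 x(1)] by metis
      then obtain y where y: "pw n x = pw n x1 \<otimes> cpw n y" unfolding Lam_iff by (elim conjE exE)
      define y2 where "y2 = restr I2 (\<lambda>p. y p + y0 p)"
      have y2: "y2 \<in> vecs I2" by (simp add: y2_def restr_def vecs_def)
      obtain y1 where y1: "y1 \<in> ?B2" "(\<lambda>p. y2 p - y1 p) \<in> Gam" using transversalE[OF T2 y2] by metis
      have "cpw n y2 = cpw n y1"
        using Gam_iff[of y2 y1] y1(2) restr2[OF y2 box2[OF y1(1)]] by simp
      then have "g = phi x1 y1"
        by (simp add: g0 phi_def x(2)[symmetric] y m_assoc cpwn_add y2_def cpwn_restr)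
      then have "g = Phi (case_sum x1 y1)" by (simp add: Phi_def case_sum_o_inj)
      moreover have "case_sum x1 y1 \<in> S" using x1(1) y1(1) by (simp add: S_def case_sum_o_inj)
      ultimately show "\<exists>z\<in>S. g = Phi z" by (rule bexI)
    qed (simp add: Phi_def phi_closed)
  next
    fix g assume "g \<in> carrier G"
    then obtain x0' y0 where g0: "g = phi x0' y0" using phi_surj by metis
    define x0 where "x0 = restr I1 x0'"
    have x0: "x0 \<in> vecs I1" by (simp add: x0_def restr_def vecs_def)
    have g: "g = phi x0 y0" by (simp add: g0 phi_def x0_def pwn_restr)
    \<comment> \<open>If \<open>z' = z g\<close>, the difference of the first exponents must be
      congruent to the exponents \<open>x0\<close> of \<open>g\<close> modulo \<open>Lam\<close>;
      both of them lie in the box.\<close>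
    define D where "D = {d. \<exists>x\<in>?B1. \<exists>y\<in>?B1. d = (\<lambda>i. y i - x i) \<and> (\<lambda>i. d i - x0 i) \<in> Lam}"
    have finD: "finite D" unfolding D_def by (rule finite_carries[OF fin(1) lattice_Lam T1])
    have "\<exists>r. pw n d = pw n x0 \<otimes> cpw n r" if "d \<in> D" for d
      using that unfolding D_def Lam_iff by blast
    \<comment> \<open>A mere choice for each \<open>d\<close>; no additivity of
      \<open>\<rho>\<close> is required.\<close>
    then obtain \<rho> where \<rho>: "\<And>d. d \<in> D \<Longrightarrow> pw n d = pw n x0 \<otimes> cpw n (\<rho> d)" by metis
    \<comment> \<open>In \<open>w\<close>, the outer \<open>Inl\<close> and \<open>Inr\<close>
      select \<open>z\<close> and \<open>z'\<close>, the inner ones their exponents \<open>x\<close>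
      and \<open>y\<close>. With \<open>d\<close> fixed, the cocycle is linear in
      \<open>x\<close>.\<close>
    let ?f = "\<lambda>(d :: nat \<Rightarrow> int) (p :: nat \<times> nat) (w :: (nat + nat \<times> nat) + (nat + nat \<times> nat) \<Rightarrow> int). w (Inr (Inr p)) - w (Inl (Inr p)) - d (snd p) * w (Inl (Inl (fst p)))"
    let ?E = "\<lambda>d w. (\<forall>i\<in>I1. w (Inr (Inl i)) - w (Inl (Inl i)) + - d i = 0)
      \<and> (\<lambda>p. if p \<in> I2 then ?f d p w + (\<rho> d p - y0 p) else 0) \<in> Gam"
    have key: "Phi z' = Phi z \<otimes> g \<longleftrightarrow> (\<exists>d\<in>D. ?E d (case_sum z z'))" if zz: "z \<in> S" "z' \<in> S" for z z'
    proof -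
      let ?x = "z \<circ> Inl" and ?y = "z \<circ> Inr" and ?x' = "z' \<circ> Inl" and ?y' = "z' \<circ> Inr"
      let ?d = "\<lambda>i. ?x' i - ?x i"
      have B: "?x \<in> ?B1" "?x' \<in> ?B1" using zz by (simp_all add: S_def)
      have d: "?d \<in> vecs I1" by (rule diff1[OF box1[OF B(2)] box1[OF B(1)]])
      \<comment> \<open>The element \<open>z\<close> is cancelled on the left: the quotient of
        \<open>z'\<close> by \<open>z\<close> has first exponents \<open>x' - x\<close>, and its
        commutator exponents are corrected by the cocycle.\<close>
      have Gd: "Phi z' = Phi z \<otimes> g \<longleftrightarrow> phi ?d (\<lambda>p. ?y' p - ?y p - cocyc ?x ?d p) = phi x0 y0"
      proof -
        have "Phi z' = Phi z \<otimes> phi ?d (\<lambda>p. ?y' p - ?y p - cocyc ?x ?d p)"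
          by (simp add: Phi_def phi_mult comp_def)
        then show ?thesis unfolding g by (simp add: Phi_def phi_closed)
      qed
      have E: "?E d (case_sum z z') \<longleftrightarrow> d = ?d \<and> cpw n (\<lambda>p. ?y' p - ?y p - cocyc ?x d p) = cpw n (\<lambda>p. y0 p - \<rho> d p)"
        if "d \<in> D" for d
      proof -
        from that obtain x1 x2 where x12: "x1 \<in> ?B1" "x2 \<in> ?B1" "d = (\<lambda>i. x2 i - x1 i)"
          unfolding D_def by (elim CollectE bexE conjE)
        have dv: "d \<in> vecs I1" unfolding x12(3) by (rule diff1[OF box1[OF x12(2)] box1[OF x12(1)]])
        have "(\<forall>i\<in>I1. z' (Inl i) - z (Inl i) + - d i = 0) \<longleftrightarrow> d = ?d"
        proof
          assume 0: "\<forall>i\<in>I1. z' (Inl i) - z (Inl i) + - d i = 0"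
          show "d = ?d"
          proof
            fix i show "d i = ?d i"
            proof (cases "i \<in> I1")
              case True
              then show ?thesis using bspec[OF 0 True] by simp
            next
              case False
              then have "d i = 0" "?d i = 0" using dv d unfolding vecs_def by simp_all
              then show ?thesis by simp
            qed
          qed
        next
          assume "d = ?d"
          then have "d i = z' (Inl i) - z (Inl i)" for i by (simp add: fun_eq_iff)
          then show "\<forall>i\<in>I1. z' (Inl i) - z (Inl i) + - d i = 0" by simp
        qed
        then have l: "(\<forall>i\<in>I1. case_sum z z' (Inr (Inl i)) - case_sum z z' (Inl (Inl i)) + - d i = 0) \<longleftrightarrow> d = ?d"
          by (simp only: sum.case)
        have r: "(\<lambda>p. if p \<in> I2 then ?f d p (case_sum z z') + (\<rho> d p - y0 p) else 0)
          = restr I2 (\<lambda>p. (?y' p - ?y p - cocyc ?x d p) - (y0 p - \<rho> d p))"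
          by (rule ext) (simp add: restr_def cocyc_def case_prod_beta)
        show ?thesis unfolding l r Gam_iff ..
      qed
      show ?thesis
      proof
        assume "Phi z' = Phi z \<otimes> g"
        then have eq: "phi ?d (\<lambda>p. ?y' p - ?y p - cocyc ?x ?d p) = phi x0 y0" unfolding Gd .
        have "(\<lambda>i. ?d i - x0 i) \<in> Lam"
          using iffD1[OF phi_eq_iff[OF diff1[OF d x0]] eq] by (rule conjunct1)
        then have dD: "?d \<in> D"
          unfolding D_def by (intro CollectI bexI[OF _ B(1)] bexI[OF _ B(2)] conjI refl)
        have "cpw n (\<lambda>p. ?y' p - ?y p - cocyc ?x ?d p) = cpw n (\<lambda>p. y0 p - \<rho> ?d p)"
          using iffD1[OF phi_eq_iff_cpw[OF \<rho>[OF dD]] eq] .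
        then have "?E ?d (case_sum z z')" by (intro iffD2[OF E[OF dD]] conjI refl)
        then show "\<exists>d\<in>D. ?E d (case_sum z z')" using dD by (rule bexI)
      next
        assume "\<exists>d\<in>D. ?E d (case_sum z z')"
        then obtain d where d': "d \<in> D" "?E d (case_sum z z')" by (rule bexE)
        have "d = ?d" and "cpw n (\<lambda>p. ?y' p - ?y p - cocyc ?x d p) = cpw n (\<lambda>p. y0 p - \<rho> d p)"
          using iffD1[OF E[OF d'(1)] d'(2)] by (rule conjunct1, rule conjunct2)
        then have dD: "?d \<in> D" and "cpw n (\<lambda>p. ?y' p - ?y p - cocyc ?x ?d p) = cpw n (\<lambda>p. y0 p - \<rho> ?d p)"
          using d'(1) by simp_all
        then have "phi ?d (\<lambda>p. ?y' p - ?y p - cocyc ?x ?d p) = phi x0 y0"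
          by (intro iffD2[OF phi_eq_iff_cpw[OF \<rho>[OF dD]]])
        then show "Phi z' = Phi z \<otimes> g" unfolding Gd .
      qed
    qed
    have "aut (\<lambda>w. \<exists>d\<in>D. ?E d w)"
    proof (intro aut_bex finD aut_conj aut_ball fin(1))
      fix d :: "nat \<Rightarrow> int" and i :: nat
      show "aut (\<lambda>w. w (Inr (Inl i)) - w (Inl (Inl i)) + - d i = 0)"
        by (rule aut_lin_eq) (intro lin_diff lin_var)
      show "aut (\<lambda>w. (\<lambda>p. if p \<in> I2 then ?f d p w + (\<rho> d p - y0 p) else 0) \<in> Gam)"
        by (rule aut_affine_subst[OF aut_lattice[OF fin(2) lattice_Gam] fin(2)]) (intro lin_diff lin_cmult lin_var)
    qed
    then have "aut (\<lambda>w. w \<circ> Inl \<in> S \<and> w \<circ> Inr \<in> S \<and> (\<exists>d\<in>D. ?E d w))"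
      by (intro aut_conj aut_reindex[OF autS])
    moreover have "(w \<circ> Inl \<in> S \<and> w \<circ> Inr \<in> S \<and> (\<exists>d\<in>D. ?E d w)) =
      (w \<circ> Inl \<in> S \<and> w \<circ> Inr \<in> S \<and> Phi (w \<circ> Inr) = Phi (w \<circ> Inl) \<otimes> g)" for w
    proof -
      have "case_sum (w \<circ> Inl) (w \<circ> Inr) = w" by (simp add: case_sum_expand_Inr_pointfree)
      then show ?thesis using key[of "w \<circ> Inl" "w \<circ> Inr"] by (intro conj_cong refl) (simp only:)
    qed
    ultimately show "aut (\<lambda>w. w \<circ> Inl \<in> S \<and> w \<circ> Inr \<in> S \<and> Phi (w \<circ> Inr) = Phi (w \<circ> Inl) \<otimes> g)"
      by simp
  next
    fix z assume "z \<in> S"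
    have "reachable G ?A (\<Sum>i<n. nat \<bar>z (Inl i)\<bar>) (pw n (z \<circ> Inl))"
      unfolding pw_def
    proof (rule reachable_lprod[OF A])
      fix i assume "i < n"
      then show "reachable G ?A (nat \<bar>z (Inl i)\<bar>) (a i [^] (z \<circ> Inl) i)"
        using reachable_int_pow[OF A, of "a i" "z (Inl i)"] by simp
    qed
    moreover have "reachable G ?A (\<Sum>i<n. \<Sum>j<i. nat \<bar>z (Inr (i, j))\<bar>) (cpw n (z \<circ> Inr))"
      unfolding cpw_def crow_def
    proof (intro reachable_lprod[OF A])
      fix i j assume ij: "i < n" "j < i"
      have "comm (a i) (a j) \<in> ?A" using ij by (intro UnI2 image_eqI[of _ _ "(i, j)"]) simp_all
      from reachable_int_pow[OF A this, of "z (Inr (i, j))"]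
      show "reachable G ?A (nat \<bar>z (Inr (i, j))\<bar>) (comm (a i) (a j) [^] (z \<circ> Inr) (i, j))" by simp
    qed
    ultimately have R: "reachable G ?A ((\<Sum>i<n. nat \<bar>z (Inl i)\<bar>) + (\<Sum>i<n. \<Sum>j<i. nat \<bar>z (Inr (i, j))\<bar>)) (Phi z)"
      unfolding Phi_def phi_def by (rule reachable_mult[OF A])
    have S: "(\<Sum>q\<in>?I. nat \<bar>z q\<bar>) = (\<Sum>i<n. nat \<bar>z (Inl i)\<bar>) + (\<Sum>i<n. \<Sum>j<i. nat \<bar>z (Inr (i, j))\<bar>)"
    proof -
      have "(\<Sum>q\<in>?I. nat \<bar>z q\<bar>) = (\<Sum>q\<in>Inl ` I1. nat \<bar>z q\<bar>) + (\<Sum>q\<in>Inr ` I2. nat \<bar>z q\<bar>)"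
        by (rule sum.union_disjoint) auto
      then show ?thesis by (simp add: sum.reindex sum.Sigma)
    qed
    show "reachable G ?A (1 * (1 + (\<Sum>q\<in>?I. nat \<bar>z q\<bar>))) (Phi z)"
      unfolding S by (rule reachable_mono[OF R _ order_refl]) simp
  qed
qed

end

text \<open>The indexing starts at 0, so \<open>lcs G 2\<close> is the third term of the lower
  central series; its triviality says that commutators commute with everything.\<close>

lemma class_two_in_B_exp:
  fixes G :: "('g, 'b) monoid_scheme"
  assumes "group G" "fin_gen_set G A" "lcs G 2 = {\<one>\<^bsub>G\<^esub>}"
  shows "in_B G exp_fun"
proof -
  interpret group G by fact
  have A: "finite A" "A \<subseteq> carrier G" "generate G A = carrier G" using assms(2) by (simp_all add: fin_gen_set_def)
  obtain f where f: "bij_betw f {0..<card A} A" using ex_bij_betw_nat_finite[OF A(1)] by (elim exE)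
  then have im: "f ` {..<card A} = A" by (simp add: bij_betw_def lessThan_atLeast0)
  have center: "comm x y \<in> center" if xy: "x \<in> carrier G" "y \<in> carrier G" for x y
  proof -
    have "comm x y \<in> lcs G 1" using xy by (auto simp: comm_def intro!: generate.incl)
    then have "comm (comm x y) g \<in> lcs G 2" if "g \<in> carrier G" for g
      using that unfolding numeral_2_eq_2 lcs.simps(2)[of G "Suc 0"]
      by (intro generate.incl CollectI exI[of _ "comm x y"] exI[of _ g]) (simp add: comm_def[of "comm x y"])
    then have one: "comm (comm x y) g = \<one>\<^bsub>G\<^esub>" if "g \<in> carrier G" for g using that assms(3) by simp
    have "comm x y \<otimes>\<^bsub>G\<^esub> g = g \<otimes>\<^bsub>G\<^esub> comm x y" if "g \<in> carrier G" for g
      using comm_swap[of "comm x y" g] one[OF that] that comm_closed[OF xy] by simp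
    then show ?thesis using comm_closed[OF xy] by (simp add: center_def)
  qed
  have "class_two_group G f (card A)"
  proof unfold_locales
    show "f i \<in> carrier G" if "i < card A" for i using that im A(2) by blast
    show "generate G (f ` {..<card A}) = carrier G" by (simp add: im A(3))
  qed (rule center)
  then show ?thesis by (rule class_two_group.in_B_exp)
qed

theorem mainTheorem10:
  shows "(\<forall>n M. 1 \<le> n \<and> GL_int n M \<longrightarrow> in_B (semidirect_ZnZ n M) exp_fun)
       \<and> (\<forall>n. 1 \<le> n \<longrightarrow> in_B (UT_int n) exp_fun)
       \<and> (\<forall>G :: ('g, 'b) monoid_scheme.
            group G \<and> (\<exists>A. fin_gen_set G A) \<and> nilpotent_class G 2 \<longrightarrow> in_B G exp_fun)"
proof (intro conjI allI impI)
  fix n M assume "1 \<le> n \<and> GL_int n M"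
  then have "torus_bundle n M" by (simp add: torus_bundle_def)
  then show "in_B (semidirect_ZnZ n M) exp_fun" by (rule torus_bundle.in_B_exp)
next
  fix n show "in_B (UT_int n) exp_fun" by (rule UT_in_B_exp)
next
  fix G :: "('g, 'b) monoid_scheme"
  assume "group G \<and> (\<exists>A. fin_gen_set G A) \<and> nilpotent_class G 2"
  then obtain A where "group G" "fin_gen_set G A" "lcs G 2 = {\<one>\<^bsub>G\<^esub>}"
    unfolding nilpotent_class_def by (elim conjE exE)
  then show "in_B G exp_fun" by (rule class_two_in_B_exp)
qed

end
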